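(* Let $\Omega=(-1,1)^2$, $a>0$, $0<\epsilon\le 1$, let $Lu=-\epsilon^2\Delta u+au$, and let $\Omega_1,\dots,\Omega_N$ with maps $M_l:S\to\Omega_l$ be a decomposition of $\Omega$ as in the context. Then there exists a constant $C_\epsilon>0$ (depending on $\epsilon$ but independent of $W$) such that $$\mathcal{U}^{N,W}(\{\mathcal F_u\})\le C_\epsilon(\log W)^2\,\mathcal{V}^{N,W}(\{\mathcal F_u\})\qquad\text{for all }\{\mathcal F_u\}\in\mathcal S^{N,W},$$ provided $W=O(1/\epsilon)$, i.e. for all integers $W\ge 2$ with $W\le K/\epsilon$, where $K>0$ is any fixed constant (on which $C_\epsilon$ may depend).
   Context: The underlying boundary value problem is $-\epsilon^2\Delta w+aw=f$ in $\Omega=(-1,1)^2$, $w=g$ on $\Gamma=\partial\Omega$, with $a>0$ a real constant and $0<\epsilon\le1$. Decomposition: $\Omega$ is divided into rectangles (or squares) $\Omega_1,\dots,\Omega_N$ by a uniform or non-uniform refinement in each coordinate direction. $S=(-1,1)^2$ is the reference square with coordinates $(\xi,\eta)$, $I=(-1,1)$, and $M_l:S\to\Omega_l$ is an analytic map with analytic inverse, mapping sides of $S$ to sides of $\Omega_l$, with Jacobian determinant $J_l>0$; the parametrizations of a common edge induced by the two adjacent maps coincide. Spectral element functions: $\mathcal S^{N,W}$ is the set of families $\{\mathcal F_u\}=\{\hat u_l(\xi,\eta)\}_{l=1}^N$, where each $\hat u_l$ is a polynomial of degree at most $W$ in each of $\xi,\eta$ separately. Put $u_l=\hat u_l\circ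 M_l^{-1}$ on $\Omega_l$. No continuity across elements is imposed. $L_l$ is defined by $L_l\hat u_l=\sqrt{J_l}\,\big((Lu_l)\circ M_l\big)$, so that $\int_{\Omega_l}|Lu_l|^2\,d\mathbf x=\int_S|L_l\hat u_l|^2\,d\xi d\eta$. Norms on $I$: for $0<\sigma<1$, $\|v\|_{\sigma,I}^2=\|v\|_{0,I}^2+\int_I\int_I\frac{(v(t)-v(t'))^2}{|t-t'|^{1+2\sigma}}\,dt\,dt'$, and $\|v\|_{1+\sigma,I}^2=\|v\|_{0,I}^2+\|v'\|_{\sigma,I}^2$, where $\|\cdot\|_{0,I}$ is the $L^2$ norm. Norms on an edge are the norms over $I$ of the function pulled back by the parametrization of the edge by $I$ induced by the element maps. For an edge $\gamma$ shared by $\Omega_m$ and $\Omega_n$, $[u]=u_m-u_n$ and $[u_{x_k}]=(u_m)_{x_k}-(u_n)_{x_k}$ on $\gamma$, $k=1,2$ (physical-coordinate derivatives), regarded as functions on $I$. Quadratic forms: $$\mathcal V^{N,W}(\{\mathcal F_u\})=\sum_{l=1}^N\|L_l\hat u_l\|_{0,S}^2+\sum_{\gamma}\Big(\|[u]\|_{0,\gamma}^2+\sum_{k=1}^2\|[u_{x_k}]\|_{1/2,\gamma}^2\Big)+\sum_{\Gamma^s\subseteq\partial\Omega}\|u\|_{3/2,\Gamma^s}^2,$$ where $\gamma$ runs over all inter-element edges (those not on $\partial\Omega$) and $\Gamma^s$ over all element edges on $\partial\Omega$; $$\mathcal U^{N,W}(\{\mathcal F_u\})=\sum_{l=1}^N\int_S\Big(\epsilon^4\big((\hat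 u_l)_{\xi\xi}^2+2(\hat u_l)_{\xi\eta}^2+(\hat u_l)_{\eta\eta}^2\big)+\epsilon^2\big((\hat u_l)_\xi^2+(\hat u_l)_\eta^2\big)+\hat u_l^2\Big)\,d\xi d\eta.$$ *)

theory Defs
  imports "HOL-Analysis.Analysis"
begin

definition Omega :: "(real \<times> real) set" where
  "Omega = {-1<..<1} \<times> {-1<..<1}"

definition refS :: "(real \<times> real) set" where
  "refS = {-1<..<1} \<times> {-1<..<1}"

definition refI :: "real set" where
  "refI = {-1<..<1}"

(* Power series are only asked to represent f on the part of a neighbourhood that lies in A,
   so that values of f outside A are irrelevant.  For a closed rectangle A this is the usual
   analyticity up to the boundary: the series then converges on a full neighbourhood. *)
definition real_analytic_on ::
    "(real \<times> real \<Rightarrow> 'b::real_normed_vector) \<Rightarrow> (real \<times> real) set \<Rightarrow> bool" where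
  "real_analytic_on f A \<longleftrightarrow>
     (\<forall>p\<in>A. \<exists>r>0. \<exists>c :: nat \<times> nat \<Rightarrow> 'b. \<forall>q\<in>A. dist p q < r \<longrightarrow>
        ((\<lambda>(i, j). ((fst q - fst p) ^ i * (snd q - snd p) ^ j) *\<^sub>R c (i, j)) has_sum f q) UNIV)"

(* Partial derivatives relative to R.  On a closed rectangle R they are uniquely determined for
   functions differentiable up to the boundary: the usual ones inside, one-sided on the sides. *)
definition pdx :: "(real \<times> real) set \<Rightarrow> (real \<times> real \<Rightarrow> real) \<Rightarrow> real \<times> real \<Rightarrow> real" where
  "pdx R f p = frechet_derivative f (at p within R) (1, 0)"

definition pdy :: "(real \<times> real) set \<Rightarrow> (real \<times> real \<Rightarrow> real) \<Rightarrow> real \<times> real \<Rightarrow> real" where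
  "pdy R f p = frechet_derivative f (at p within R) (0, 1)"

definition diff_op ::
    "real \<Rightarrow> real \<Rightarrow> (real \<times> real) set \<Rightarrow> (real \<times> real \<Rightarrow> real) \<Rightarrow> real \<times> real \<Rightarrow> real" where
  "diff_op \<epsilon> a R u p = - \<epsilon>\<^sup>2 * (pdx R (pdx R u) p + pdy R (pdy R u) p) + a * u p"

definition jacobian :: "(real \<times> real \<Rightarrow> real \<times> real) \<Rightarrow> real \<times> real \<Rightarrow> real" where
  "jacobian F p =
     pdx (closure refS) (fst \<circ> F) p * pdy (closure refS) (snd \<circ> F) p
     - pdy (closure refS) (fst \<circ> F) p * pdx (closure refS) (snd \<circ> F) p"

definition rect_sides :: "(real \<times> real) set \<Rightarrow> (real \<times> real) set set" where
  "rect_sides R = {e. \<exists>a b c d. a < b \<and> c < d \<and> R = {a<..<b} \<times> {c<..<d} \<and>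
     e \<in> {{a} \<times> {c..d}, {b} \<times> {c..d}, {a..b} \<times> {c}, {a..b} \<times> {d}}}"

(* The four sides of the reference square, each represented by its parametrization over [-1,1]. *)
definition side_params :: "(real \<Rightarrow> real \<times> real) set" where
  "side_params = {\<lambda>t. (-1, t), \<lambda>t. (1, t), \<lambda>t. (t, -1), \<lambda>t. (t, 1)}"

definition elem_side :: "(real \<times> real \<Rightarrow> real \<times> real) \<Rightarrow> (real \<Rightarrow> real \<times> real) \<Rightarrow> (real \<times> real) set" where
  "elem_side F s = (\<lambda>t. F (s t)) ` {-1..1}"

(* The edge shared by elements m and n occurs exactly once, namely with m < n. *)
definition inter_edges ::
    "nat \<Rightarrow> (nat \<Rightarrow> real \<times> real \<Rightarrow> real \<times> real)
      \<Rightarrow> (nat \<times> (real \<Rightarrow> real \<times> real) \<times> nat \<times> (real \<Rightarrow> real \<times> real)) set" where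
  "inter_edges N M = {(m, s, n, s'). m \<in> {1..N} \<and> n \<in> {1..N} \<and> m < n \<and>
     s \<in> side_params \<and> s' \<in> side_params \<and> elem_side (M m) s = elem_side (M n) s'}"

definition boundary_edges ::
    "nat \<Rightarrow> (nat \<Rightarrow> real \<times> real \<Rightarrow> real \<times> real) \<Rightarrow> (nat \<times> (real \<Rightarrow> real \<times> real)) set" where
  "boundary_edges N M = {(l, s). l \<in> {1..N} \<and> s \<in> side_params \<and>
     elem_side (M l) s \<subseteq> frontier Omega}"

definition refinement :: "nat \<Rightarrow> (nat \<Rightarrow> real) \<Rightarrow> bool" where
  "refinement k x \<longleftrightarrow> x 0 = -1 \<and> x k = 1 \<and> (\<forall>i<k. x i < x (Suc i))"

definition grid_cells :: "nat \<Rightarrow> (nat \<Rightarrow> real) \<Rightarrow> nat \<Rightarrow> (nat \<Rightarrow> real) \<Rightarrow> (real \<times> real) set set" where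
  "grid_cells k x k' y = {{x i<..<x (Suc i)} \<times> {y j<..<y (Suc j)} | i j. i < k \<and> j < k'}"

definition element_map :: "(real \<times> real) set \<Rightarrow> (real \<times> real \<Rightarrow> real \<times> real) \<Rightarrow> bool" where
  "element_map R F \<longleftrightarrow>
     F ` refS = R \<and> bij_betw F (closure refS) (closure R) \<and>
     real_analytic_on F (closure refS) \<and>
     real_analytic_on (inv_into (closure refS) F) (closure R) \<and>
     (\<forall>s\<in>side_params. elem_side F s \<in> rect_sides R) \<and>
     (\<forall>p\<in>refS. jacobian F p > 0)"

definition decomposition ::
    "nat \<Rightarrow> (nat \<Rightarrow> (real \<times> real) set) \<Rightarrow> (nat \<Rightarrow> real \<times> real \<Rightarrow> real \<times> real) \<Rightarrow> bool" where
  "decomposition N Om M \<longleftrightarrow>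
     (\<exists>k x k' y. refinement k x \<and> refinement k' y \<and> bij_betw Om {1..N} (grid_cells k x k' y)) \<and>
     (\<forall>l\<in>{1..N}. element_map (Om l) (M l)) \<and>
     (\<forall>(m, s, n, s')\<in>inter_edges N M. \<forall>t\<in>{-1..1}. M m (s t) = M n (s' t))"

definition spectral_space :: "nat \<Rightarrow> nat \<Rightarrow> (nat \<Rightarrow> real \<times> real \<Rightarrow> real) set" where
  "spectral_space N W = {u. \<forall>l\<in>{1..N}. \<exists>c :: nat \<Rightarrow> nat \<Rightarrow> real.
     \<forall>\<xi> \<eta>. u l (\<xi>, \<eta>) = (\<Sum>i\<le>W. \<Sum>j\<le>W. c i j * \<xi> ^ i * \<eta> ^ j)}"

definition phys ::
    "(real \<times> real \<Rightarrow> real \<times> real) \<Rightarrow> (real \<times> real \<Rightarrow> real) \<Rightarrow> real \<times> real \<Rightarrow> real" where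
  "phys F v = v \<circ> inv_into (closure refS) F"

definition elem_op ::
    "real \<Rightarrow> real \<Rightarrow> (real \<times> real) set \<Rightarrow> (real \<times> real \<Rightarrow> real \<times> real)
      \<Rightarrow> (real \<times> real \<Rightarrow> real) \<Rightarrow> real \<times> real \<Rightarrow> real" where
  "elem_op \<epsilon> a R F v p = sqrt (jacobian F p) * diff_op \<epsilon> a (closure R) (phys F v) (F p)"

definition l2_sq :: "(real \<Rightarrow> real) \<Rightarrow> real" where
  "l2_sq v = (LINT t:refI|lborel. (v t)\<^sup>2)"

(* Squared Sobolev-Slobodeckij norms of order \<sigma> and 1 + \<sigma> on I, for 0 < \<sigma> < 1.
   They are only applied to traces that are smooth on the closed interval,
   for which all the integrals are finite. *)
definition frac_sq :: "real \<Rightarrow> (real \<Rightarrow> real) \<Rightarrow> real" where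
  "frac_sq \<sigma> v = l2_sq v +
     (LINT t:refI|lborel. LINT t':refI|lborel. (v t - v t')\<^sup>2 / \<bar>t - t'\<bar> powr (1 + 2 * \<sigma>))"

definition frac1_sq :: "real \<Rightarrow> (real \<Rightarrow> real) \<Rightarrow> real" where
  "frac1_sq \<sigma> v = l2_sq v + frac_sq \<sigma> (deriv v)"

definition jump ::
    "(real \<times> real \<Rightarrow> real) \<Rightarrow> (real \<times> real \<Rightarrow> real) \<Rightarrow> (real \<Rightarrow> real \<times> real) \<Rightarrow> real \<Rightarrow> real" where
  "jump f g e t = f (e t) - g (e t)"

definition V_form ::
    "real \<Rightarrow> real \<Rightarrow> nat \<Rightarrow> (nat \<Rightarrow> (real \<times> real) set) \<Rightarrow> (nat \<Rightarrow> real \<times> real \<Rightarrow> real \<times> real)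
      \<Rightarrow> (nat \<Rightarrow> real \<times> real \<Rightarrow> real) \<Rightarrow> real" where
  "V_form \<epsilon> a N Om M u =
     (\<Sum>l=1..N. LINT p:refS|lborel. (elem_op \<epsilon> a (Om l) (M l) (u l) p)\<^sup>2) +
     (\<Sum>(m, s, n, s')\<in>inter_edges N M.
        l2_sq (jump (phys (M m) (u m)) (phys (M n) (u n)) (M m \<circ> s)) +
        frac_sq (1/2) (jump (pdx (closure (Om m)) (phys (M m) (u m)))
                            (pdx (closure (Om n)) (phys (M n) (u n))) (M m \<circ> s)) +
        frac_sq (1/2) (jump (pdy (closure (Om m)) (phys (M m) (u m)))
                            (pdy (closure (Om n)) (phys (M n) (u n))) (M m \<circ> s))) +
     (\<Sum>(l, s)\<in>boundary_edges N M. frac1_sq (1/2) (phys (M l) (u l) \<circ> M l \<circ> s))"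

definition U_form :: "real \<Rightarrow> nat \<Rightarrow> (nat \<Rightarrow> real \<times> real \<Rightarrow> real) \<Rightarrow> real" where
  "U_form \<epsilon> N u =
     (\<Sum>l=1..N. LINT p:refS|lborel.
        \<epsilon> ^ 4 * ((pdx refS (pdx refS (u l)) p)\<^sup>2 + 2 * (pdy refS (pdx refS (u l)) p)\<^sup>2
               + (pdy refS (pdy refS (u l)) p)\<^sup>2) +
        \<epsilon>\<^sup>2 * ((pdx refS (u l) p)\<^sup>2 + (pdy refS (u l) p)\<^sup>2) + (u l p)\<^sup>2)"

end

(* Since epsilon is fixed, only the degrees W <= K/epsilon matter, and all of these spaces lie in
   the finite-dimensional space of degree floor(K/epsilon).  On that space U and V are quadratic forms
   in the polynomial coefficients, so the estimate holds as soon as V is positive definite.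

   If V vanishes, the u_l solve -epsilon^2 Lap w + a w = 0 in the closed cells, vanish on the boundary,
   and match across the edges together with their gradients.  A classical maximum principle then
   applies: at a positive maximum over all closed cells the gradient is zero and the one-sided second
   derivatives are nonpositive, contradicting the equation.  This needs the u_l to be C^2 up to the
   boundary of the cells, which follows from the analyticity of the inverse element maps, and no
   integration by parts.  The factor (log W)^2 is only used through log W >= log 2. *)
theory Submission imports Defs begin

subsection \<open>Quadratic forms in finitely many coefficients\<close>

text \<open>V has to satisfy two different demands. Quadraticity needs all of them to converge: a
  divergent Bochner integral is 0 by convention, and the value then need not depend quadratically on
  the coefficients. Hence the Lipschitz bounds that accompany the traces. The matching conditions
  speak of values and gradients only, so second derivatives are read off in a single closed cell
  that carries the maximum; its neighbours merely fix signs of first derivatives. The argument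
  excludes positive values, and since a quadratic form is even it also excludes negative ones. All
  derivatives are taken within closed rectangles, where they are unique even at corners, so nothing
  has to be extended across a side.\<close>

definition quadratic_form_on :: "'i set \<Rightarrow> (('i \<Rightarrow> real) \<Rightarrow> real) \<Rightarrow> bool" where
  "quadratic_form_on A Q \<longleftrightarrow> (\<exists>B. \<forall>c. Q c = (\<Sum>i\<in>A. \<Sum>j\<in>A. c i * c j * B i j))"

lemma quadratic_form_onI:
  assumes "\<And>c. Q c = (\<Sum>i\<in>A. \<Sum>j\<in>A. c i * c j * B i j)"
  shows "quadratic_form_on A Q"
  using assms unfolding quadratic_form_on_def by blast

lemma quadratic_form_on_zero: "quadratic_form_on A (\<lambda>c. 0)"
  by (rule quadratic_form_onI[where B = "\<lambda>_ _. 0"]) simp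

lemma quadratic_form_on_add:
  assumes "quadratic_form_on A Q" "quadratic_form_on A Q'"
  shows "quadratic_form_on A (\<lambda>c. Q c + Q' c)"
proof -
  obtain B B' where "\<And>c. Q c = (\<Sum>i\<in>A. \<Sum>j\<in>A. c i * c j * B i j)"
    "\<And>c. Q' c = (\<Sum>i\<in>A. \<Sum>j\<in>A. c i * c j * B' i j)"
    using assms unfolding quadratic_form_on_def by blast
  then show ?thesis
    by (intro quadratic_form_onI[where B = "\<lambda>i j. B i j + B' i j"])
      (simp add: sum.distrib distrib_left)
qed

lemma quadratic_form_on_cmult:
  assumes "quadratic_form_on A Q"
  shows "quadratic_form_on A (\<lambda>c. r * Q c)"
proof -
  obtain B where "\<And>c. Q c = (\<Sum>i\<in>A. \<Sum>j\<in>A. c i * c j * B i j)"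
    using assms unfolding quadratic_form_on_def by blast
  then show ?thesis
    by (intro quadratic_form_onI[where B = "\<lambda>i j. r * B i j"])
      (simp add: sum_distrib_left algebra_simps)
qed

lemma quadratic_form_on_sum:
  assumes "\<And>x. x \<in> X \<Longrightarrow> quadratic_form_on A (Q x)"
  shows "quadratic_form_on A (\<lambda>c. \<Sum>x\<in>X. Q x c)"
  using assms
  by (induction X rule: infinite_finite_induct)
    (auto intro: quadratic_form_on_zero quadratic_form_on_add)

lemma quadratic_form_on_square:
  "quadratic_form_on A (\<lambda>c. (\<Sum>i\<in>A. c i * v i)\<^sup>2)"
  by (rule quadratic_form_onI[where B = "\<lambda>i j. v i * v j"])
    (simp add: power2_eq_square sum_product algebra_simps)

text \<open>Coefficient vectors are total functions, and the induction on the index set below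
  overwrites one coordinate; this makes values off \<open>A\<close> harmless.\<close>

lemma quadratic_form_on_cong_arg:
  assumes "quadratic_form_on A Q" "\<And>i. i \<in> A \<Longrightarrow> c i = c' i"
  shows "Q c = Q c'"
proof -
  obtain B where "\<And>c. Q c = (\<Sum>i\<in>A. \<Sum>j\<in>A. c i * c j * B i j)"
    using assms(1) unfolding quadratic_form_on_def by blast
  then show ?thesis by (simp add: assms(2) cong: sum.cong)
qed

lemma quadratic_form_on_upper_bound:
  assumes "quadratic_form_on A Q"
  obtains C where "C \<ge> 0" "\<And>c. Q c \<le> C * (\<Sum>i\<in>A. (c i)\<^sup>2)"
proof -
  obtain B where B: "\<And>c. Q c = (\<Sum>i\<in>A. \<Sum>j\<in>A. c i * c j * B i j)"
    using assms unfolding quadratic_form_on_def by blast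
  show thesis
  proof (cases "finite A")
    \<comment> \<open>A sum over an infinite index set is 0 by convention, so Q vanishes identically
      here.\<close>
    case False
    then have "\<And>c. Q c = 0" using B by simp
    then show thesis using that[of 0] by simp
  next
    case True
    define C where "C = (\<Sum>i\<in>A. \<Sum>j\<in>A. \<bar>B i j\<bar>)"
    have "Q c \<le> C * (\<Sum>i\<in>A. (c i)\<^sup>2)" for c
    proof -
      define s where "s = (\<Sum>i\<in>A. (c i)\<^sup>2)"
      have *: "c i * c j * B i j \<le> s * \<bar>B i j\<bar>" if "i \<in> A" "j \<in> A" for i j
      proof -
        have m: "(c k)\<^sup>2 \<le> s" if "k \<in> A" for k
          unfolding s_def using True that by (intro member_le_sum) auto
        have "\<bar>c i * c j\<bar> \<le> ((c i)\<^sup>2 + (c j)\<^sup>2) / 2"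
          using sum_squares_bound[of "\<bar>c i\<bar>" "\<bar>c j\<bar>"] by (simp add: abs_mult)
        also have "\<dots> \<le> s"
          using add_mono[OF m[OF that(1)] m[OF that(2)]] by simp
        finally have "\<bar>c i * c j\<bar> \<le> s" .
        then have "\<bar>c i * c j\<bar> * \<bar>B i j\<bar> \<le> s * \<bar>B i j\<bar>"
          by (rule mult_right_mono) simp
        then show ?thesis
          using abs_ge_self[of "c i * c j * B i j"] by (simp add: abs_mult)
      qed
      have "Q c \<le> (\<Sum>i\<in>A. \<Sum>j\<in>A. s * \<bar>B i j\<bar>)"
        unfolding B by (intro sum_mono *)
      also have "\<dots> = C * s"
        by (simp add: C_def sum_distrib_left mult.commute)
      finally show ?thesis by (simp add: s_def)
    qed
    moreover have "C \<ge> 0" unfolding C_def by (intro sum_nonneg) auto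
    ultimately show thesis using that by blast
  qed
qed

text \<open>Induction on the dimension: completing the square in one coordinate leaves the Schur
  complement, which is again positive definite.\<close>
lemma positive_definite_coercive:
  assumes "finite A" "quadratic_form_on A Q"
    and "\<And>c. Q c \<ge> 0" "\<And>c i. Q c = 0 \<Longrightarrow> i \<in> A \<Longrightarrow> c i = 0"
  shows "\<exists>C\<ge>0. \<forall>c. (\<Sum>i\<in>A. (c i)\<^sup>2) \<le> C * Q c"
  using assms
proof (induction A arbitrary: Q rule: finite_induct)
  case empty
  then show ?case by (intro exI[of _ 0]) auto
next
  case (insert k A)
  obtain B where B: "\<And>c. Q c = (\<Sum>i\<in>insert k A. \<Sum>j\<in>insert k A. c i * c j * B i j)"
    using insert.prems(1) unfolding quadratic_form_on_def by blast
  define \<beta> where "\<beta> = B k k"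
  define b where "b c = (\<Sum>i\<in>A. c i * (B i k + B k i))" for c :: "'a \<Rightarrow> real"
  define QA where "QA c = (\<Sum>i\<in>A. \<Sum>j\<in>A. c i * c j * B i j)" for c :: "'a \<Rightarrow> real"
  \<comment> \<open>The correction - b^2 / (4 \<beta>) is the minimum over x of \<beta> x^2 + x b,
    attained at x = - b / (2 \<beta>); the same point reappears in \<open>Q'_eq\<close>.\<close>
  define Q' where "Q' c = QA c + (- 1 / (4 * \<beta>)) * (b c)\<^sup>2" for c :: "'a \<Rightarrow> real"
  have Q: "Q c = \<beta> * (c k)\<^sup>2 + c k * b c + QA c" for c
    unfolding B \<beta>_def b_def QA_def using insert.hyps
    by (simp add: sum.distrib power2_eq_square sum_distrib_left algebra_simps)
  have "\<beta> = Q (\<lambda>i. if i = k then 1 else 0)"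
  proof -
    have "(\<Sum>i\<in>A. f i * (if i = k then 1 else 0)) = (0::real)" for f
      using insert.hyps by (intro sum.neutral) auto
    moreover have "b (\<lambda>i. if i = k then 1 else 0) = 0"
      unfolding b_def using insert.hyps by (intro sum.neutral) auto
    moreover have "QA (\<lambda>i. if i = k then 1 else 0) = 0"
      unfolding QA_def using insert.hyps by (intro sum.neutral) auto
    ultimately show ?thesis unfolding Q by simp
  qed
  \<comment> \<open>\<beta> is the value of Q at the k-th unit vector; were it 0, definiteness would
    force the coordinate 1 to vanish.\<close>
  then have "\<beta> > 0"
    using insert.prems(2)[of "\<lambda>i. if i = k then 1 else 0"]
      insert.prems(3)[of "\<lambda>i. if i = k then 1 else 0" k] by fastforce
  have square: "Q c = \<beta> * (c k + b c / (2 * \<beta>))\<^sup>2 + Q' c" for c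
    unfolding Q Q'_def using \<open>\<beta> > 0\<close> by (simp add: field_simps power2_eq_square)
  have qf: "quadratic_form_on A Q'"
    unfolding Q'_def
    by (intro quadratic_form_on_add quadratic_form_on_cmult)
      (auto simp: QA_def b_def intro: quadratic_form_on_square quadratic_form_onI)
  \<comment> \<open>Inserting the minimiser kills the square, so Q' is the restriction of Q to a
    subspace and inherits sign and definiteness from it.\<close>
  have Q'_eq: "Q' c = Q (c(k := - b c / (2 * \<beta>)))" for c
  proof -
    have "b (c(k := r)) = b c" for r
      unfolding b_def using insert.hyps by (intro sum.cong) auto
    moreover have "Q' (c(k := r)) = Q' c" for r
      using insert.hyps by (intro quadratic_form_on_cong_arg[OF qf]) auto
    ultimately show ?thesis by (simp add: square)
  qed
  have nonneg: "Q' c \<ge> 0" for c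
    unfolding Q'_eq by (rule insert.prems(2))
  have "c i = 0" if "Q' c = 0" "i \<in> A" for c i
  proof -
    have "(c(k := - b c / (2 * \<beta>))) i = 0"
      using insert.prems(3)[OF that(1)[unfolded Q'_eq], of i] that(2) by blast
    moreover have "i \<noteq> k" using that insert.hyps by blast
    ultimately show ?thesis by simp
  qed
  with insert.IH[OF qf] nonneg obtain C where C: "C \<ge> 0" "\<And>c. (\<Sum>i\<in>A. (c i)\<^sup>2) \<le> C * Q' c"
    by blast
  have "quadratic_form_on A (\<lambda>c. (b c)\<^sup>2)"
    unfolding b_def by (rule quadratic_form_on_square)
  then obtain D where D: "D \<ge> 0" "\<And>c. (b c)\<^sup>2 \<le> D * (\<Sum>i\<in>A. (c i)\<^sup>2)"
    using quadratic_form_on_upper_bound by metis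
  \<comment> \<open>The summands pay in turn for z^2, for b^2 and for the coordinates in
    \<open>A\<close>: c k = z - b / (2 \<beta>) gives (c k)^2 <= 2 z^2 + b^2 / (2 \<beta>^2), while
    \<beta> z^2 and Q' are both at most Q.\<close>
  define E where "E = 2 / \<beta> + D * C / (2 * \<beta>\<^sup>2) + C"
  have "(\<Sum>i\<in>insert k A. (c i)\<^sup>2) \<le> E * Q c" for c
  proof -
    define z where "z = c k + b c / (2 * \<beta>)"
    have 1: "(c k)\<^sup>2 \<le> 2 * z\<^sup>2 + (b c)\<^sup>2 / (2 * \<beta>\<^sup>2)"
    proof -
      have "(z - y)\<^sup>2 + (z + y)\<^sup>2 = 2 * z\<^sup>2 + 2 * y\<^sup>2" for y
        by (simp add: power2_eq_square algebra_simps)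
      from this[of "b c / (2 * \<beta>)"]
      have "(c k)\<^sup>2 + (z + b c / (2 * \<beta>))\<^sup>2 = 2 * z\<^sup>2 + 2 * (b c / (2 * \<beta>))\<^sup>2"
        by (simp add: z_def)
      moreover have "2 * (b c / (2 * \<beta>))\<^sup>2 = (b c)\<^sup>2 / (2 * \<beta>\<^sup>2)"
        by (simp add: power_divide power_mult_distrib)
      moreover have "(z + b c / (2 * \<beta>))\<^sup>2 \<ge> 0" by simp
      ultimately show ?thesis by linarith
    qed
    have Q'Q: "Q' c \<le> Q c" using \<open>\<beta> > 0\<close> by (simp add: square)
    have "\<beta> * z\<^sup>2 \<le> Q c" using nonneg[of c] by (simp add: square z_def)
    then have 2: "2 * z\<^sup>2 \<le> 2 / \<beta> * Q c"
      using \<open>\<beta> > 0\<close> by (simp add: field_simps)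
    have 3: "(\<Sum>i\<in>A. (c i)\<^sup>2) \<le> C * Q c"
      using C(2)[of c] mult_left_mono[OF Q'Q C(1)] by linarith
    have "(b c)\<^sup>2 \<le> D * (C * Q c)"
      using D(2)[of c] mult_left_mono[OF 3 D(1)] by linarith
    then have 4: "(b c)\<^sup>2 / (2 * \<beta>\<^sup>2) \<le> D * C / (2 * \<beta>\<^sup>2) * Q c"
      using \<open>\<beta> > 0\<close> by (simp add: field_simps)
    have "(\<Sum>i\<in>insert k A. (c i)\<^sup>2) = (c k)\<^sup>2 + (\<Sum>i\<in>A. (c i)\<^sup>2)"
      using insert.hyps by simp
    also have "\<dots> \<le> 2 / \<beta> * Q c + D * C / (2 * \<beta>\<^sup>2) * Q c + C * Q c"
      using 1 2 3 4 by linarith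
    finally show ?thesis by (simp add: E_def algebra_simps)
  qed
  moreover have "E \<ge> 0" using \<open>\<beta> > 0\<close> C(1) D(1) by (simp add: E_def)
  ultimately show ?case by blast
qed

subsection \<open>Partial derivatives on closed rectangles\<close>

text \<open>Both side lengths are positive: on a degenerate rectangle the derivative within the set
  is not unique and \<open>pdx\<close>, \<open>pdy\<close> would not be determined.\<close>

definition closed_rect :: "(real \<times> real) set \<Rightarrow> bool" where
  "closed_rect S \<longleftrightarrow> (\<exists>a b c d. a < b \<and> c < d \<and> S = {a..b} \<times> {c..d})"

lemma closed_rectE:
  assumes "closed_rect S"
  obtains a b c d where "a < b" "c < d" "S = {a..b} \<times> {c..d}" "S = cbox (a, c) (b, d)"
  using assms unfolding closed_rect_def by (metis cbox_Pair_eq cbox_interval)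

lemma closed_rect_compact: "closed_rect S \<Longrightarrow> compact S"
  by (elim closed_rectE) (metis compact_cbox)

lemma closed_rect_convex: "closed_rect S \<Longrightarrow> convex S"
  by (elim closed_rectE) (metis convex_box(1))

lemma closed_rect_closure_refS: "closed_rect (closure refS)"
  unfolding closed_rect_def refS_def
  by (intro exI[of _ "-1"] exI[of _ 1]) (simp add: closure_Times)

lemma closure_refS: "closure refS = {-1..1} \<times> {-1..1}"
  by (simp add: refS_def closure_Times)

text \<open>\<open>frechet_derivative\<close> is a choice. A box with interior can be entered from
  each of its points, corners included, along both axes, so only one derivative is available to be
  chosen.\<close>

lemma frechet_derivative_closed_rect:
  assumes "closed_rect S" "p \<in> S" "(f has_derivative f') (at p within S)"
  shows "frechet_derivative f (at p within S) = f'"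
proof -
  obtain a b c d where S: "a < b" "c < d" "S = {a..b} \<times> {c..d}" "S = cbox (a, c) (b, d)"
    using assms(1) by (rule closed_rectE)
  have "(f has_derivative frechet_derivative f (at p within S)) (at p within S)"
    using assms(3) frechet_derivative_works differentiable_def by blast
  then show ?thesis
    using assms(2,3) S(1,2) unfolding S(4)
    by (intro frechet_derivative_unique_within_closed_interval[of "(a, c)" "(b, d)"])
      (auto simp: Basis_prod_def)
qed

lemma pdx_eq:
  assumes "closed_rect S" "p \<in> S" "(f has_derivative f') (at p within S)"
  shows "pdx S f p = f' (1, 0)"
  using frechet_derivative_closed_rect[OF assms] by (simp add: pdx_def)

lemma pdy_eq:
  assumes "closed_rect S" "p \<in> S" "(f has_derivative f') (at p within S)"
  shows "pdy S f p = f' (0, 1)"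
  using frechet_derivative_closed_rect[OF assms] by (simp add: pdy_def)

text \<open>The two choice terms have equivalent predicates, hence are equal even where no
  derivative exists.\<close>

lemma frechet_derivative_within_cong:
  assumes "\<And>q. q \<in> S \<Longrightarrow> f q = g q" "p \<in> S"
  shows "frechet_derivative f (at p within S) = frechet_derivative g (at p within S)"
proof -
  have "(f has_derivative h) (at p within S) \<longleftrightarrow> (g has_derivative h) (at p within S)" for h
    using assms by (metis has_derivative_transform)
  then show ?thesis by (simp add: frechet_derivative_def)
qed

lemma pdx_cong:
  assumes "\<And>q. q \<in> S \<Longrightarrow> f q = g q" "p \<in> S"
  shows "pdx S f p = pdx S g p"
  unfolding pdx_def using frechet_derivative_within_cong[of S f g] assms by simp

lemma pdy_cong:
  assumes "\<And>q. q \<in> S \<Longrightarrow> f q = g q" "p \<in> S"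
  shows "pdy S f p = pdy S g p"
  unfolding pdy_def using frechet_derivative_within_cong[of S f g] assms by simp

lemma has_derivative_pd:
  assumes "closed_rect S" "p \<in> S" "f differentiable (at p within S)"
  shows "(f has_derivative (\<lambda>h. fst h * pdx S f p + snd h * pdy S f p)) (at p within S)"
proof -
  let ?D = "frechet_derivative f (at p within S)"
  have D: "(f has_derivative ?D) (at p within S)"
    using assms(3) frechet_derivative_works by blast
  then interpret bounded_linear ?D by (rule has_derivative_bounded_linear)
  have "?D h = fst h * pdx S f p + snd h * pdy S f p" for h
  proof -
    have "h = fst h *\<^sub>R (1, 0) + snd h *\<^sub>R (0, 1)" by (simp add: prod_eq_iff)
    then have "?D h = ?D (fst h *\<^sub>R (1, 0) + snd h *\<^sub>R (0, 1))" by simp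
    also have "\<dots> = fst h * pdx S f p + snd h * pdy S f p"
      unfolding add scaleR pdx_def pdy_def by simp
    finally show ?thesis .
  qed
  then have "?D = (\<lambda>h. fst h * pdx S f p + snd h * pdy S f p)" by blast
  with D show ?thesis by simp
qed

text \<open>Class C^k up to the boundary: derivatives within the set are one-sided at sides and
  corners. Differentiability is built into the recursion instead of being deduced from continuous
  partials.\<close>

fun ck_on :: "nat \<Rightarrow> (real \<times> real) set \<Rightarrow> (real \<times> real \<Rightarrow> real) \<Rightarrow> bool" where
  "ck_on 0 S f \<longleftrightarrow> continuous_on S f"
| "ck_on (Suc k) S f \<longleftrightarrow>
     (\<forall>p\<in>S. f differentiable (at p within S)) \<and> ck_on k S (pdx S f) \<and> ck_on k S (pdy S f)"

lemma ck_on_cong: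
  assumes "\<And>q. q \<in> S \<Longrightarrow> f q = g q" "ck_on k S f"
  shows "ck_on k S g"
  using assms
proof (induction k arbitrary: f g)
  case 0
  then show ?case by (simp cong: continuous_on_cong)
next
  case (Suc k)
  have "g differentiable (at p within S)" if "p \<in> S" for p
    using Suc.prems that unfolding differentiable_def ck_on.simps
    by (metis has_derivative_transform)
  moreover have "ck_on k S (pdx S g)"
    using Suc.prems(2) by (intro Suc.IH[OF pdx_cong[of S f g, OF Suc.prems(1)]]) simp_all
  moreover have "ck_on k S (pdy S g)"
    using Suc.prems(2) by (intro Suc.IH[OF pdy_cong[of S f g, OF Suc.prems(1)]]) simp_all
  ultimately show ?case by simp
qed

lemma ck_on_continuous: "ck_on k S f \<Longrightarrow> continuous_on S f"
  by (cases k)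
    (auto simp: continuous_on_eq_continuous_within differentiable_imp_continuous_within)

lemma ck_on_SucD: "ck_on (Suc k) S f \<Longrightarrow> ck_on k S f"
proof (induction k arbitrary: f)
  case 0
  then show ?case using ck_on_continuous[of "Suc 0" S f] by simp
next
  case (Suc k)
  then show ?case unfolding ck_on.simps(2) by blast
qed

text \<open>Candidates for the partials suffice: uniqueness on a closed rectangle identifies them
  with \<open>pdx S f\<close> and \<open>pdy S f\<close> on \<open>S\<close>.\<close>

lemma ck_on_SucI:
  assumes "closed_rect S" "\<And>p. p \<in> S \<Longrightarrow> (f has_derivative (\<lambda>h. fst h * fx p + snd h * fy p)) (at p within S)"
    "ck_on k S fx" "ck_on k S fy"
  shows "ck_on (Suc k) S f"
proof -
  have "pdx S f p = fx p" "pdy S f p = fy p" if "p \<in> S" for p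
    using pdx_eq[OF assms(1) that assms(2)[OF that]] pdy_eq[OF assms(1) that assms(2)[OF that]]
    by auto
  then show ?thesis
    using assms(2,3,4) ck_on_cong[of S fx "pdx S f" k] ck_on_cong[of S fy "pdy S f" k]
    unfolding ck_on.simps differentiable_def by metis
qed

lemma ck_on_has_derivative:
  assumes "closed_rect S" "ck_on (Suc k) S f" "p \<in> S"
  shows "(f has_derivative (\<lambda>h. fst h * pdx S f p + snd h * pdy S f p)) (at p within S)"
  using assms by (intro has_derivative_pd) auto

lemma ck_on_const:
  assumes "closed_rect S"
  shows "ck_on k S (\<lambda>p. r)"
proof (induction k arbitrary: r)
  case (Suc k)
  then show ?case
    by (intro ck_on_SucI[OF assms, of _ "\<lambda>p. 0" "\<lambda>p. 0"]) auto
qed auto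

lemma ck_on_fst:
  assumes "closed_rect S"
  shows "ck_on k S fst"
proof (cases k)
  case (Suc j)
  then show ?thesis
    using ck_on_const[OF assms]
    unfolding Suc
    by (intro ck_on_SucI[OF assms, of _ "\<lambda>p. 1" "\<lambda>p. 0"])
      (auto intro: has_derivative_fst[OF has_derivative_ident])
qed (auto intro: continuous_intros)

lemma ck_on_snd:
  assumes "closed_rect S"
  shows "ck_on k S snd"
proof (cases k)
  case (Suc j)
  then show ?thesis
    using ck_on_const[OF assms]
    unfolding Suc
    by (intro ck_on_SucI[OF assms, of _ "\<lambda>p. 0" "\<lambda>p. 1"])
      (auto intro: has_derivative_snd[OF has_derivative_ident])
qed (auto intro: continuous_intros)

lemma ck_on_add:
  assumes "closed_rect S" "ck_on k S f" "ck_on k S g"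
  shows "ck_on k S (\<lambda>p. f p + g p)"
  using assms(2,3)
proof (induction k arbitrary: f g)
  case (Suc k)
  have D: "((\<lambda>p. f p + g p) has_derivative
      (\<lambda>h. fst h * (pdx S f p + pdx S g p) + snd h * (pdy S f p + pdy S g p))) (at p within S)"
    if "p \<in> S" for p
    using ck_on_has_derivative[OF assms(1) Suc.prems(1) that]
      ck_on_has_derivative[OF assms(1) Suc.prems(2) that]
    by (auto intro!: derivative_eq_intros simp: algebra_simps)
  then show ?case
    using Suc by (intro ck_on_SucI[OF assms(1) D]) auto
qed (auto intro: continuous_intros)

lemma ck_on_mult:
  assumes "closed_rect S" "ck_on k S f" "ck_on k S g"
  shows "ck_on k S (\<lambda>p. f p * g p)"
  using assms(2,3)
proof (induction k arbitrary: f g)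
  case (Suc k)
  have D: "((\<lambda>p. f p * g p) has_derivative
      (\<lambda>h. fst h * (pdx S f p * g p + f p * pdx S g p)
        + snd h * (pdy S f p * g p + f p * pdy S g p))) (at p within S)"
    if "p \<in> S" for p
    using ck_on_has_derivative[OF assms(1) Suc.prems(1) that]
      ck_on_has_derivative[OF assms(1) Suc.prems(2) that]
    by (auto intro!: derivative_eq_intros simp: algebra_simps)
  have "ck_on k S f" "ck_on k S g"
    using Suc.prems ck_on_SucD by blast+
  then show ?case
    using Suc by (intro ck_on_SucI[OF assms(1) D] ck_on_add[OF assms(1)]) auto
qed (auto intro: continuous_intros)

lemma ck_on_power:
  assumes "closed_rect S" "ck_on k S f"
  shows "ck_on k S (\<lambda>p. f p ^ n)"
  by (induction n) (auto intro: ck_on_const ck_on_mult assms)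

lemma ck_on_sum:
  assumes "closed_rect S" "\<And>i. i \<in> A \<Longrightarrow> ck_on k S (g i)"
  shows "ck_on k S (\<lambda>p. \<Sum>i\<in>A. g i p)"
  using assms(2)
  by (induction A rule: infinite_finite_induct) (auto intro: ck_on_const ck_on_add assms(1))

lemma has_derivative_lincomb:
  assumes "closed_rect S" "p \<in> S" "\<And>i. i \<in> A \<Longrightarrow> ck_on (Suc k) S (g i)"
  shows "((\<lambda>q. \<Sum>i\<in>A. c i * g i q) has_derivative
    (\<lambda>h. fst h * (\<Sum>i\<in>A. c i * pdx S (g i) p) + snd h * (\<Sum>i\<in>A. c i * pdy S (g i) p)))
    (at p within S)"
proof -
  have "((\<lambda>q. \<Sum>i\<in>A. c i * g i q) has_derivative
    (\<lambda>h. \<Sum>i\<in>A. c i * (fst h * pdx S (g i) p + snd h * pdy S (g i) p))) (at p within S)"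
    using ck_on_has_derivative[OF assms(1) assms(3) assms(2)]
    by (intro has_derivative_sum has_derivative_mult_right) blast
  then show ?thesis
    by (simp add: sum_distrib_left sum.distrib algebra_simps)
qed

text \<open>Only agreement on \<open>S\<close> is asked of \<open>f\<close>, so that the conclusion,
  itself an identity on \<open>S\<close>, can feed the next differentiation.\<close>

lemma pdx_lincomb:
  assumes "closed_rect S" "\<And>i. i \<in> A \<Longrightarrow> ck_on (Suc k) S (g i)"
    "\<And>q. q \<in> S \<Longrightarrow> f q = (\<Sum>i\<in>A. c i * g i q)" "p \<in> S"
  shows "pdx S f p = (\<Sum>i\<in>A. c i * pdx S (g i) p)"
  using pdx_cong[of S f "\<lambda>q. \<Sum>i\<in>A. c i * g i q", OF assms(3,4)]
    pdx_eq[OF assms(1,4) has_derivative_lincomb[OF assms(1,4,2)]] by simp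

lemma pdy_lincomb:
  assumes "closed_rect S" "\<And>i. i \<in> A \<Longrightarrow> ck_on (Suc k) S (g i)"
    "\<And>q. q \<in> S \<Longrightarrow> f q = (\<Sum>i\<in>A. c i * g i q)" "p \<in> S"
  shows "pdy S f p = (\<Sum>i\<in>A. c i * pdy S (g i) p)"
  using pdy_cong[of S f "\<lambda>q. \<Sum>i\<in>A. c i * g i q", OF assms(3,4)]
    pdy_eq[OF assms(1,4) has_derivative_lincomb[OF assms(1,4,2)]] by simp

text \<open>Compactness bounds the gradient and convexity turns the bound into a Lipschitz constant,
  the regularity that makes the Slobodeckij integrals of traces converge.\<close>

lemma ck_on_lipschitz_on:
  assumes "closed_rect S" "ck_on (Suc k) S f"
  shows "\<exists>L. L-lipschitz_on S f"
proof -
  have "continuous_on S (pdx S f)" "continuous_on S (pdy S f)"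
    using assms(2) by (auto intro: ck_on_continuous)
  then have "bounded (pdx S f ` S)" "bounded (pdy S f ` S)"
    using closed_rect_compact[OF assms(1)]
    by (auto intro: compact_imp_bounded compact_continuous_image)
  then obtain A B where A: "\<And>p. p \<in> S \<Longrightarrow> \<bar>pdx S f p\<bar> \<le> A" and B: "\<And>p. p \<in> S \<Longrightarrow> \<bar>pdy S f p\<bar> \<le> B"
    unfolding bounded_iff by auto
  have on: "onorm (\<lambda>h. fst h * pdx S f p + snd h * pdy S f p) \<le> \<bar>A\<bar> + \<bar>B\<bar>" if "p \<in> S" for p
  proof (rule onorm_le)
    fix h :: "real \<times> real"
    have "norm (fst h * pdx S f p + snd h * pdy S f p) \<le> \<bar>fst h\<bar> * \<bar>pdx S f p\<bar> + \<bar>snd h\<bar> * \<bar>pdy S f p\<bar>"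
      using abs_triangle_ineq[of "fst h * pdx S f p" "snd h * pdy S f p"] by (simp add: abs_mult)
    also have "\<dots> \<le> norm h * \<bar>A\<bar> + norm h * \<bar>B\<bar>"
      using A[OF that] B[OF that] norm_fst_le[of "fst h" "snd h"] norm_snd_le[of "snd h" "fst h"]
      by (intro add_mono mult_mono) auto
    finally show "norm (fst h * pdx S f p + snd h * pdy S f p) \<le> (\<bar>A\<bar> + \<bar>B\<bar>) * norm h"
      by (simp add: algebra_simps)
  qed
  have "norm (f p - f q) \<le> (\<bar>A\<bar> + \<bar>B\<bar>) * norm (p - q)" if "p \<in> S" "q \<in> S" for p q
    using differentiable_bound[OF closed_rect_convex[OF assms(1)]
        ck_on_has_derivative[OF assms] on, of p q] that by blast
  then have "(\<bar>A\<bar> + \<bar>B\<bar>)-lipschitz_on S f"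
    by (intro lipschitz_onI) (simp_all add: dist_norm)
  then show ?thesis by blast
qed

subsection \<open>Analytic functions are smooth up to the boundary\<close>

text \<open>Enumerating pairs turns the unordered double series into an ordinary one, to which the
  M-test and termwise differentiation apply.\<close>

lemma has_sum_prod_decode:
  "((\<lambda>n. g (prod_decode n)) has_sum s) UNIV \<longleftrightarrow> (g has_sum s) UNIV"
  by (rule has_sum_reindex_bij_betw[OF bij_prod_decode])

text \<open>Differentiation costs a factor i, which is at most 2^i; halving the radius supplies that
  power, and 2 / d makes up for the lost exponent.\<close>

lemma of_nat_mult_half_power_le:
  assumes "d > 0" "\<bar>x\<bar> \<le> d / 2"
  shows "real i * \<bar>x\<bar> ^ (i - 1) \<le> 2 / d * d ^ i"
proof (cases i)
  case (Suc j)
  have "real i \<le> 2 ^ i" using of_nat_less_two_power[of i, where 'a = real] by simp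
  moreover have "\<bar>x\<bar> ^ (i - 1) \<le> (d / 2) ^ (i - 1)" using assms by (intro power_mono) auto
  ultimately have "real i * \<bar>x\<bar> ^ (i - 1) \<le> 2 ^ i * (d / 2) ^ (i - 1)"
    by (intro mult_mono) auto
  also have "\<dots> = 2 / d * d ^ i" using assms Suc by (simp add: field_simps)
  finally show ?thesis .
qed (use assms in simp)

text \<open>At half the radius of summability both formally differentiated series are dominated by 2
  / d times the given majorant, so they converge uniformly and may be taken as the derivative.
  \<open>T\<close> is an arbitrary convex set there, which covers boundary points of a rectangle;
  the partials come out as power series again, ready for iteration.\<close>

lemma double_power_series_has_derivative:
  fixes c :: "nat \<times> nat \<Rightarrow> real"
  assumes "d > 0" "(\<lambda>(i, j). \<bar>c (i, j)\<bar> * d ^ (i + j)) summable_on UNIV"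
    and "convex T" "\<And>q. q \<in> T \<Longrightarrow> \<bar>fst q - x\<bar> \<le> d / 2 \<and> \<bar>snd q - y\<bar> \<le> d / 2"
    and f: "\<And>q. q \<in> T \<Longrightarrow> ((\<lambda>(i, j). ((fst q - x) ^ i * (snd q - y) ^ j) * c (i, j)) has_sum f q) UNIV"
  obtains fx fy where
    "\<And>q. q \<in> T \<Longrightarrow> (f has_derivative (\<lambda>h. fst h * fx q + snd h * fy q)) (at q within T)"
    "\<And>q. q \<in> T \<Longrightarrow> ((\<lambda>(i, j). ((fst q - x) ^ i * (snd q - y) ^ j) * (real (Suc i) * c (Suc i, j))) has_sum fx q) UNIV"
    "\<And>q. q \<in> T \<Longrightarrow> ((\<lambda>(i, j). ((fst q - x) ^ i * (snd q - y) ^ j) * (real (Suc j) * c (i, Suc j))) has_sum fy q) UNIV"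
proof -
  define t where "t n q = (case prod_decode n of (i, j) \<Rightarrow> ((fst q - x) ^ i * (snd q - y) ^ j) * c (i, j))"
    for n and q :: "real \<times> real"
  \<comment> \<open>For i = 0 the truncated exponent \<open>i - 1\<close> is harmless because the
    factor \<open>real i\<close> vanishes; likewise for j in \<open>t2\<close>.\<close>
  define t1 where "t1 = (\<lambda>(i, j) q. c (i, j) * (real i * (fst q - x) ^ (i - 1) * (snd q - y) ^ j))"
  define t2 where "t2 = (\<lambda>(i, j) q. c (i, j) * ((fst q - x) ^ i * (real j * (snd q - y) ^ (j - 1))))"
  define m where "m n = (case prod_decode n of (i, j) \<Rightarrow> 2 / d * (\<bar>c (i, j)\<bar> * d ^ (i + j)))" for n
  define g where "g = (\<lambda>(i, j). \<bar>c (i, j)\<bar> * d ^ (i + j))"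
  have "(\<lambda>n. g (prod_decode n)) summable_on UNIV"
    using assms(2) unfolding g_def[symmetric]
    by (rule summable_on_reindex_bij_betw[OF bij_prod_decode, THEN iffD2])
  moreover have "g p \<ge> 0" for p
    using \<open>d > 0\<close> by (cases p) (simp add: g_def)
  ultimately have "summable (\<lambda>n. g (prod_decode n))"
    using summable_on_UNIV_nonneg_real_iff[of "\<lambda>n. g (prod_decode n)"] by simp
  from summable_mult[OF this, of "2 / d"] have m: "summable m"
    unfolding m_def g_def split_def .
  have pw: "\<bar>u\<bar> ^ j \<le> d ^ j" if "\<bar>u\<bar> \<le> d / 2" for u j
    using that \<open>d > 0\<close> by (intro power_mono) auto
  have t1m: "norm (t1 (prod_decode n) q) \<le> m n" if "q \<in> T" for n q
  proof -
    obtain i j where ij: "prod_decode n = (i, j)" by fastforce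
    have "norm (t1 (prod_decode n) q) = \<bar>c (i, j)\<bar> * ((real i * \<bar>fst q - x\<bar> ^ (i - 1)) * \<bar>snd q - y\<bar> ^ j)"
      by (simp add: t1_def ij abs_mult power_abs)
    also have "\<dots> \<le> \<bar>c (i, j)\<bar> * ((2 / d * d ^ i) * d ^ j)"
      using assms(1,4) that by (intro mult_left_mono mult_mono of_nat_mult_half_power_le pw) auto
    also have "\<dots> = m n" by (simp add: m_def ij power_add)
    finally show ?thesis .
  qed
  have t2m: "norm (t2 (prod_decode n) q) \<le> m n" if "q \<in> T" for n q
  proof -
    obtain i j where ij: "prod_decode n = (i, j)" by fastforce
    have "norm (t2 (prod_decode n) q) = \<bar>c (i, j)\<bar> * (\<bar>fst q - x\<bar> ^ i * (real j * \<bar>snd q - y\<bar> ^ (j - 1)))"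
      by (simp add: t2_def ij abs_mult power_abs)
    also have "\<dots> \<le> \<bar>c (i, j)\<bar> * (d ^ i * (2 / d * d ^ j))"
      using assms(1,4) that by (intro mult_left_mono mult_mono of_nat_mult_half_power_le pw) auto
    also have "\<dots> = m n" by (simp add: m_def ij power_add)
    finally show ?thesis .
  qed
  define fx where "fx q = (\<Sum>n. t1 (prod_decode n) q)" for q
  define fy where "fy q = (\<Sum>n. t2 (prod_decode n) q)" for q
  have fx: "((\<lambda>p. t1 p q) has_sum fx q) UNIV" if "q \<in> T" for q
  proof -
    have *: "summable (\<lambda>n. norm (t1 (prod_decode n) q))"
      using t1m[OF that] by (intro summable_comparison_test'[OF m, of 0]) simp
    then have "((\<lambda>n. t1 (prod_decode n) q) has_sum fx q) UNIV"
      unfolding fx_def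
      by (rule norm_summable_imp_has_sum) (rule summable_sums[OF summable_norm_cancel[OF *]])
    then show ?thesis by (rule has_sum_prod_decode[THEN iffD1])
  qed
  have fy: "((\<lambda>p. t2 p q) has_sum fy q) UNIV" if "q \<in> T" for q
  proof -
    have *: "summable (\<lambda>n. norm (t2 (prod_decode n) q))"
      using t2m[OF that] by (intro summable_comparison_test'[OF m, of 0]) simp
    then have "((\<lambda>n. t2 (prod_decode n) q) has_sum fy q) UNIV"
      unfolding fy_def
      by (rule norm_summable_imp_has_sum) (rule summable_sums[OF summable_norm_cancel[OF *]])
    then show ?thesis by (rule has_sum_prod_decode[THEN iffD1])
  qed
  have fx': "((\<lambda>(i, j). ((fst q - x) ^ i * (snd q - y) ^ j) * (real (Suc i) * c (Suc i, j))) has_sum fx q) UNIV"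
    if "q \<in> T" for q
  proof -
    \<comment> \<open>Terms with i = 0 vanish, so the sum lives on the range of the index shift;
      pulling it back gives the usual form of a differentiated power series.\<close>
    define s where "s = (\<lambda>(i::nat, j::nat). (Suc i, j))"
    have "((\<lambda>p. t1 p q) has_sum fx q) (range s)"
    proof (subst has_sum_cong_neutral[where T = UNIV and g = "\<lambda>p. t1 p q"])
      fix p assume "p \<in> UNIV - range s"
      then have "fst p = 0" unfolding s_def by (cases p; cases "fst p") (auto simp: image_iff)
      then show "t1 p q = 0" by (cases p) (simp add: t1_def)
    qed (use fx[OF that] in auto)
    then have "(((\<lambda>p. t1 p q) \<circ> s) has_sum fx q) UNIV"
      by (subst (asm) has_sum_reindex) (auto simp: s_def inj_on_def)
    then show ?thesis
      by (simp add: t1_def s_def o_def split_def mult_ac)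
  qed
  have fy': "((\<lambda>(i, j). ((fst q - x) ^ i * (snd q - y) ^ j) * (real (Suc j) * c (i, Suc j))) has_sum fy q) UNIV"
    if "q \<in> T" for q
  proof -
    define s where "s = (\<lambda>(i::nat, j::nat). (i, Suc j))"
    have "((\<lambda>p. t2 p q) has_sum fy q) (range s)"
    proof (subst has_sum_cong_neutral[where T = UNIV and g = "\<lambda>p. t2 p q"])
      fix p assume "p \<in> UNIV - range s"
      then have "snd p = 0" unfolding s_def by (cases p; cases "snd p") (auto simp: image_iff)
      then show "t2 p q = 0" by (cases p) (simp add: t2_def)
    qed (use fy[OF that] in auto)
    then have "(((\<lambda>p. t2 p q) \<circ> s) has_sum fy q) UNIV"
      by (subst (asm) has_sum_reindex) (auto simp: s_def inj_on_def)
    then show ?thesis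
      by (simp add: t2_def s_def o_def split_def mult_ac)
  qed
  have D: "(t n has_derivative (\<lambda>h. fst h * t1 (prod_decode n) q + snd h * t2 (prod_decode n) q)) (at q within T)"
    for n q
  proof -
    obtain i j where ij: "prod_decode n = (i, j)" by fastforce
    show ?thesis
      unfolding t_def t1_def t2_def ij prod.case
      by (auto intro!: derivative_eq_intros simp: algebra_simps)
  qed
  have u1: "uniform_limit T (\<lambda>n q. \<Sum>i<n. t1 (prod_decode i) q) fx sequentially"
    unfolding fx_def using t1m m by (intro Weierstrass_m_test) auto
  have u2: "uniform_limit T (\<lambda>n q. \<Sum>i<n. t2 (prod_decode i) q) fy sequentially"
    unfolding fy_def using t2m m by (intro Weierstrass_m_test) auto
  have main: "(f has_derivative (\<lambda>h. fst h * fx q + snd h * fy q)) (at q within T)" if "q \<in> T" for q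
  proof -
    have sums: "(\<lambda>n. t n r) sums f r" if "r \<in> T" for r
    proof -
      have "((\<lambda>n. t n r) has_sum f r) UNIV"
        unfolding t_def by (subst has_sum_prod_decode[of "\<lambda>(i, j). ((fst r - x) ^ i * (snd r - y) ^ j) * c (i, j)"])
          (rule f[OF that])
      then show ?thesis by (rule has_sum_imp_sums)
    qed
    have "\<forall>\<^sub>F n in sequentially. \<forall>q\<in>T. \<forall>h. norm ((\<Sum>i<n. fst h * t1 (prod_decode i) q + snd h * t2 (prod_decode i) q)
        - (fst h * fx q + snd h * fy q)) \<le> e * norm h" if "e > 0" for e
    proof -
      have "\<forall>\<^sub>F n in sequentially. \<forall>q\<in>T. dist (\<Sum>i<n. t1 (prod_decode i) q) (fx q) < e / 2"
        using u1[unfolded uniform_limit_iff, rule_format, of "e / 2"] that by simp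
      moreover have "\<forall>\<^sub>F n in sequentially. \<forall>q\<in>T. dist (\<Sum>i<n. t2 (prod_decode i) q) (fy q) < e / 2"
        using u2[unfolded uniform_limit_iff, rule_format, of "e / 2"] that by simp
      ultimately show ?thesis
      proof eventually_elim
        case (elim n)
        show ?case
        proof (intro ballI allI)
          fix q and h :: "real \<times> real" assume q: "q \<in> T"
          define A where "A = (\<Sum>i<n. t1 (prod_decode i) q) - fx q"
          define B where "B = (\<Sum>i<n. t2 (prod_decode i) q) - fy q"
          have AB: "\<bar>A\<bar> \<le> e / 2" "\<bar>B\<bar> \<le> e / 2"
            using elim q by (auto simp: A_def B_def dist_real_def intro: less_imp_le)
          have "norm ((\<Sum>i<n. fst h * t1 (prod_decode i) q + snd h * t2 (prod_decode i) q)
            - (fst h * fx q + snd h * fy q)) = \<bar>fst h * A + snd h * B\<bar>"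
            by (simp add: A_def B_def sum.distrib sum_distrib_left algebra_simps)
          also have "\<dots> \<le> \<bar>fst h\<bar> * \<bar>A\<bar> + \<bar>snd h\<bar> * \<bar>B\<bar>"
            using abs_triangle_ineq[of "fst h * A" "snd h * B"] by (simp add: abs_mult)
          also have "\<dots> \<le> norm h * (e / 2) + norm h * (e / 2)"
            using AB norm_fst_le[of "fst h" "snd h"] norm_snd_le[of "snd h" "fst h"]
            by (intro add_mono mult_mono) auto
          finally show "norm ((\<Sum>i<n. fst h * t1 (prod_decode i) q + snd h * t2 (prod_decode i) q)
            - (fst h * fx q + snd h * fy q)) \<le> e * norm h" by (simp add: algebra_simps)
        qed
      qed
    qed
    \<comment> \<open>Termwise differentiation delivers some limit with the right derivative;
      uniqueness of sums identifies it with \<open>f\<close> on \<open>T\<close>.\<close>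
    from has_derivative_series[OF assms(3) D this \<open>q \<in> T\<close> sums[OF \<open>q \<in> T\<close>]]
    obtain g where g: "\<And>r. r \<in> T \<Longrightarrow> (\<lambda>n. t n r) sums g r"
      "\<And>r. r \<in> T \<Longrightarrow> (g has_derivative (\<lambda>h. fst h * fx r + snd h * fy r)) (at r within T)"
      by blast
    show ?thesis
      using sums_unique2[OF sums g(1)] by (intro has_derivative_transform[OF that _ g(2)[OF that]])
  qed
  show thesis by (rule that[OF main fx' fy'])
qed

text \<open>The partials are expanded about \<open>p\<close> on a whole relative neighbourhood, not
  merely evaluated at \<open>p\<close>; hence they are analytic in the same sense, and the argument
  can be repeated.\<close>

lemma real_analytic_on_local_derivative:
  assumes "closed_rect S" "real_analytic_on f S" "p \<in> S"
  obtains e c1 c2 fx fy where "e > 0"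
    "\<And>q. q \<in> S \<Longrightarrow> dist p q < e \<Longrightarrow> (f has_derivative (\<lambda>h. fst h * fx q + snd h * fy q)) (at q within S)"
    "\<And>q. q \<in> S \<Longrightarrow> dist p q < e \<Longrightarrow>
      ((\<lambda>(i, j). ((fst q - fst p) ^ i * (snd q - snd p) ^ j) *\<^sub>R c1 (i, j)) has_sum (fx q :: real)) UNIV"
    "\<And>q. q \<in> S \<Longrightarrow> dist p q < e \<Longrightarrow>
      ((\<lambda>(i, j). ((fst q - fst p) ^ i * (snd q - snd p) ^ j) *\<^sub>R c2 (i, j)) has_sum (fy q :: real)) UNIV"
proof -
  obtain a b a' b' where S: "a < b" "a' < b'" "S = {a..b} \<times> {a'..b'}"
    using assms(1) unfolding closed_rect_def by blast
  obtain r c where r: "r > 0" and c: "\<And>q. q \<in> S \<Longrightarrow> dist p q < r \<Longrightarrow>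
      ((\<lambda>(i, j). ((fst q - fst p) ^ i * (snd q - snd p) ^ j) *\<^sub>R c (i, j)) has_sum f q) UNIV"
    using assms(2,3) unfolding real_analytic_on_def by blast
  \<comment> \<open>A point displaced by d in both coordinates is within 2 d < r of
    \<open>p\<close>. Since d is at most half of each side length, one of the two displacements
    along each axis stays in the rectangle.\<close>
  define d where "d = min (r / 4) (min ((b - a) / 2) ((b' - a') / 2))"
  have d: "d > 0" "d \<le> r / 4" "d \<le> (b - a) / 2" "d \<le> (b' - a') / 2"
    unfolding d_def using S(1,2) r by (auto simp: min_def)
  have dist_le: "dist p q \<le> \<bar>fst q - fst p\<bar> + \<bar>snd q - snd p\<bar>" for q
    using sqrt_sum_squares_le_sum_abs[of "fst p - fst q" "snd p - snd q"]
    by (simp add: dist_prod_def dist_real_def abs_minus_commute)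
  \<comment> \<open>One of the four quadrants at p meets S near p: absolute convergence at a point of it
    is absolute convergence on a full neighbourhood.\<close>
  obtain u where u: "u \<in> {a..b}" "\<bar>u - fst p\<bar> = d"
  proof (cases "fst p + d \<le> b")
    case True
    then show thesis using that[of "fst p + d"] assms(3) d S by auto
  next
    case False
    then show thesis using that[of "fst p - d"] assms(3) d S by auto
  qed
  obtain v where v: "v \<in> {a'..b'}" "\<bar>v - snd p\<bar> = d"
  proof (cases "snd p + d \<le> b'")
    case True
    then show thesis using that[of "snd p + d"] assms(3) d S by auto
  next
    case False
    then show thesis using that[of "snd p - d"] assms(3) d S by auto
  qed
  have "dist p (u, v) < r" using dist_le[of "(u, v)"] u v d r by auto
  then have "(\<lambda>(i, j). ((u - fst p) ^ i * (v - snd p) ^ j) *\<^sub>R c (i, j)) summable_on UNIV"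
    using c[of "(u, v)"] u v S has_sum_imp_summable by fastforce
  \<comment> \<open>Unordered summability of reals is absolute; at (u, v) both displacements have
    modulus d, so the norms are the majorant at radius d.\<close>
  then have "(\<lambda>x. norm (case x of (i, j) \<Rightarrow> ((u - fst p) ^ i * (v - snd p) ^ j) *\<^sub>R c (i, j))) summable_on UNIV"
    using summable_on_iff_abs_summable_on_real by blast
  moreover have "norm (case x of (i, j) \<Rightarrow> ((u - fst p) ^ i * (v - snd p) ^ j) *\<^sub>R c (i, j))
      = (case x of (i, j) \<Rightarrow> \<bar>c (i, j)\<bar> * d ^ (i + j))" for x
    by (cases x) (simp add: abs_mult power_abs u v power_add)
  ultimately have sm: "(\<lambda>(i, j). \<bar>c (i, j)\<bar> * d ^ (i + j)) summable_on UNIV" by simp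
  \<comment> \<open>Relatively open in \<open>S\<close>, so derivatives within \<open>T\<close> and
    within \<open>S\<close> are the same; convex and of half the radius, as termwise differentiation
    demands.\<close>
  define T where "T = S \<inter> ({fst p - d / 2<..<fst p + d / 2} \<times> {snd p - d / 2<..<snd p + d / 2})"
  have "convex T"
    unfolding T_def using closed_rect_convex[OF assms(1)]
    by (intro convex_Int convex_Times) auto
  moreover have T: "\<bar>fst q - fst p\<bar> \<le> d / 2 \<and> \<bar>snd q - snd p\<bar> \<le> d / 2" if "q \<in> T" for q
  proof -
    have "fst p - d / 2 < fst q" "fst q < fst p + d / 2" "snd p - d / 2 < snd q" "snd q < snd p + d / 2"
      using that by (auto simp: T_def)
    then show ?thesis unfolding abs_le_iff by linarith
  qed
  moreover have "((\<lambda>(i, j). ((fst q - fst p) ^ i * (snd q - snd p) ^ j) * c (i, j)) has_sum f q) UNIV"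
    if "q \<in> T" for q
    using c[of q] T[OF that] that dist_le[of q] d r by (auto simp: T_def)
  ultimately obtain fx fy where f:
    "\<And>q. q \<in> T \<Longrightarrow> (f has_derivative (\<lambda>h. fst h * fx q + snd h * fy q)) (at q within T)"
    "\<And>q. q \<in> T \<Longrightarrow> ((\<lambda>(i, j). ((fst q - fst p) ^ i * (snd q - snd p) ^ j) * (real (Suc i) * c (Suc i, j))) has_sum fx q) UNIV"
    "\<And>q. q \<in> T \<Longrightarrow> ((\<lambda>(i, j). ((fst q - fst p) ^ i * (snd q - snd p) ^ j) * (real (Suc j) * c (i, Suc j))) has_sum fy q) UNIV"
    using double_power_series_has_derivative[OF d(1) sm] by blast
  have mem: "q \<in> T" if "q \<in> S" "dist p q < d / 2" for q
  proof -
    have "\<bar>fst p - fst q\<bar> \<le> dist p q" "\<bar>snd p - snd q\<bar> \<le> dist p q"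
      using dist_fst_le[of p q] dist_snd_le[of p q] by (simp_all add: dist_real_def)
    then show ?thesis using that unfolding T_def by (cases q) (auto simp: abs_le_iff)
  qed
  have within: "at q within T = at q within S" if "q \<in> T" for q
    by (rule at_within_nhd[where S = "{fst p - d / 2<..<fst p + d / 2} \<times> {snd p - d / 2<..<snd p + d / 2}"])
      (use that in \<open>auto simp: T_def intro: open_Times\<close>)
  show thesis
    using that[of "d / 2" fx fy "\<lambda>(i, j). real (Suc i) * c (Suc i, j)" "\<lambda>(i, j). real (Suc j) * c (i, Suc j)"]
      f within mem d(1) by simp
qed

lemma real_analytic_on_pd:
  fixes f :: "real \<times> real \<Rightarrow> real"
  assumes "closed_rect S" "real_analytic_on f S"
  shows "p \<in> S \<Longrightarrow> f differentiable (at p within S)"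
    and "real_analytic_on (pdx S f) S" "real_analytic_on (pdy S f) S"
proof -
  show "f differentiable (at p within S)" if p: "p \<in> S" for p
  proof -
    obtain e c1 c2 fx fy where "e > 0" and
      "\<And>q. q \<in> S \<Longrightarrow> dist p q < e \<Longrightarrow> (f has_derivative (\<lambda>h. fst h * fx q + snd h * fy q)) (at q within S)"
      by (rule real_analytic_on_local_derivative[OF assms p]) blast
    from this(2)[OF p] this(1) show ?thesis unfolding differentiable_def by auto
  qed
  show "real_analytic_on (pdx S f) S"
    unfolding real_analytic_on_def
  proof
    fix p assume "p \<in> S"
    then obtain e c1 c2 fx fy where e: "e > 0"
      "\<And>q. q \<in> S \<Longrightarrow> dist p q < e \<Longrightarrow> (f has_derivative (\<lambda>h. fst h * fx q + snd h * fy q)) (at q within S)"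
      "\<And>q. q \<in> S \<Longrightarrow> dist p q < e \<Longrightarrow>
        ((\<lambda>(i, j). ((fst q - fst p) ^ i * (snd q - snd p) ^ j) *\<^sub>R c1 (i, j)) has_sum (fx q :: real)) UNIV"
      by (rule real_analytic_on_local_derivative[OF assms]) blast
    have "pdx S f q = fx q" if "q \<in> S" "dist p q < e" for q
      using pdx_eq[OF assms(1) that(1) e(2)[OF that]] by simp
    then show "\<exists>r>0. \<exists>c. \<forall>q\<in>S. dist p q < r \<longrightarrow>
        ((\<lambda>(i, j). ((fst q - fst p) ^ i * (snd q - snd p) ^ j) *\<^sub>R c (i, j)) has_sum pdx S f q) UNIV"
      using e(1,3) by (intro exI[of _ e] conjI exI[of _ c1]) simp_all
  qed
  show "real_analytic_on (pdy S f) S"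
    unfolding real_analytic_on_def
  proof
    fix p assume "p \<in> S"
    then obtain e c1 c2 fx fy where e: "e > 0"
      "\<And>q. q \<in> S \<Longrightarrow> dist p q < e \<Longrightarrow> (f has_derivative (\<lambda>h. fst h * fx q + snd h * fy q)) (at q within S)"
      "\<And>q. q \<in> S \<Longrightarrow> dist p q < e \<Longrightarrow>
        ((\<lambda>(i, j). ((fst q - fst p) ^ i * (snd q - snd p) ^ j) *\<^sub>R c2 (i, j)) has_sum (fy q :: real)) UNIV"
      by (rule real_analytic_on_local_derivative[OF assms]) blast
    have "pdy S f q = fy q" if "q \<in> S" "dist p q < e" for q
      using pdy_eq[OF assms(1) that(1) e(2)[OF that]] by simp
    then show "\<exists>r>0. \<exists>c. \<forall>q\<in>S. dist p q < r \<longrightarrow>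
        ((\<lambda>(i, j). ((fst q - fst p) ^ i * (snd q - snd p) ^ j) *\<^sub>R c (i, j)) has_sum pdy S f q) UNIV"
      using e(1,3) by (intro exI[of _ e] conjI exI[of _ c2]) simp_all
  qed
qed

lemma real_analytic_on_imp_ck_on:
  assumes "closed_rect S" "real_analytic_on f S"
  shows "ck_on k S f"
  using assms(2)
proof (induction k arbitrary: f)
  case 0
  then show ?case
    using real_analytic_on_pd(1)[OF assms(1)]
    by (auto simp: continuous_on_eq_continuous_within intro: differentiable_imp_continuous_within)
next
  case (Suc k)
  then show ?case using real_analytic_on_pd[OF assms(1) Suc.prems] by simp
qed

text \<open>Element maps are vector valued, the classes \<open>ck_on\<close> are scalar; with
  \<open>fst\<close> and \<open>snd\<close> this passes to components.\<close>

lemma real_analytic_on_bounded_linear: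
  assumes "bounded_linear h" "real_analytic_on f S"
  shows "real_analytic_on (h \<circ> f) S"
  unfolding real_analytic_on_def
proof
  fix p assume "p \<in> S"
  with assms(2) obtain r c where r: "r > 0" "\<And>q. q \<in> S \<Longrightarrow> dist p q < r \<Longrightarrow>
      ((\<lambda>(i, j). ((fst q - fst p) ^ i * (snd q - snd p) ^ j) *\<^sub>R c (i, j)) has_sum f q) UNIV"
    unfolding real_analytic_on_def by blast
  interpret bounded_linear h by fact
  have "((\<lambda>(i, j). ((fst q - fst p) ^ i * (snd q - snd p) ^ j) *\<^sub>R h (c (i, j))) has_sum (h \<circ> f) q) UNIV"
    if "q \<in> S" "dist p q < r" for q
    using has_sum_bounded_linear[OF assms(1) r(2)[OF that]]
    by (simp add: o_def split_def scaleR)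
  then show "\<exists>r>0. \<exists>c. \<forall>q\<in>S. dist p q < r \<longrightarrow>
      ((\<lambda>(i, j). ((fst q - fst p) ^ i * (snd q - snd p) ^ j) *\<^sub>R c (i, j)) has_sum (h \<circ> f) q) UNIV"
    using r(1) by (intro exI[of _ r] conjI exI[of _ "h \<circ> c"]) (auto simp: o_def)
qed

subsection \<open>A maximum principle on the grid\<close>

text \<open>A positive derivative means growth to the right, a negative one growth to the left; a
  maximum excludes each sign only if there is room on that side.\<close>

lemma max_on_interval_first_derivative:
  fixes g :: "real \<Rightarrow> real"
  assumes "(g has_real_derivative l) (at t within {a..b})" "t \<in> {a..b}"
    "\<And>s. s \<in> {a..b} \<Longrightarrow> g s \<le> g t"
  shows "t < b \<Longrightarrow> l \<le> 0" "a < t \<Longrightarrow> 0 \<le> l"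
proof -
  show "l \<le> 0" if "t < b"
  proof (rule ccontr)
    assume "\<not> l \<le> 0"
    then obtain d where d: "d > 0" "\<And>h. h > 0 \<Longrightarrow> t + h \<in> {a..b} \<Longrightarrow> h < d \<Longrightarrow> g t < g (t + h)"
      using has_real_derivative_pos_inc_right[OF assms(1)] by auto
    define h where "h = min (d / 2) (b - t)"
    have "h > 0" "h < d" "t + h \<in> {a..b}" using d(1) that assms(2) by (auto simp: h_def min_def)
    then show False using d(2)[of h] assms(3)[of "t + h"] by auto
  qed
  show "0 \<le> l" if "a < t"
  proof (rule ccontr)
    assume "\<not> 0 \<le> l"
    then obtain d where d: "d > 0" "\<And>h. h > 0 \<Longrightarrow> t - h \<in> {a..b} \<Longrightarrow> h < d \<Longrightarrow> g t < g (t - h)"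
      using has_real_derivative_neg_dec_left[OF assms(1)] by auto
    define h where "h = min (d / 2) (t - a)"
    have "h > 0" "h < d" "t - h \<in> {a..b}" using d(1) that assms(2) by (auto simp: h_def min_def)
    then show False using d(2)[of h] assms(3)[of "t - h"] by auto
  qed
qed

text \<open>If D > 0, then g' is positive just right of t and negative just left of it, so g grows
  on moving to whichever side is available. At an endpoint this rests on g' t = 0, which a maximum
  alone does not give.\<close>

lemma max_on_interval_second_derivative:
  fixes g :: "real \<Rightarrow> real"
  assumes "a < b" "t \<in> {a..b}" "\<And>s. s \<in> {a..b} \<Longrightarrow> (g has_real_derivative g' s) (at s within {a..b})"
    "(g' has_real_derivative D) (at t within {a..b})" "g' t = 0" "\<And>s. s \<in> {a..b} \<Longrightarrow> g s \<le> g t"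
  shows "D \<le> 0"
proof (rule ccontr)
  assume "\<not> D \<le> 0"
  then have "D > 0" by simp
  have cont: "continuous_on {a..b} g"
    using assms(3) by (meson DERIV_continuous_on)
  have der: "(g has_real_derivative g' s) (at s)" if "a < s" "s < b" for s
    using assms(3)[of s] that by (simp add: at_within_Icc_at)
  show False
  proof (cases "t < b")
    case True
    obtain d where d: "d > 0" "\<And>h. h > 0 \<Longrightarrow> t + h \<in> {a..b} \<Longrightarrow> h < d \<Longrightarrow> g' t < g' (t + h)"
      using has_real_derivative_pos_inc_right[OF assms(4) \<open>D > 0\<close>] by auto
    define h where "h = min (d / 2) (b - t)"
    have h: "h > 0" "h < d" "t + h \<le> b" using d(1) True by (auto simp: h_def min_def)
    have cont': "continuous_on {t..t + h} g"
      using h assms(2) by (intro continuous_on_subset[OF cont]) simp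
    have "g t < g (t + h)"
    proof (rule DERIV_pos_imp_increasing_open[of t "t + h" g])
      fix s assume "t < s" "s < t + h"
      then show "\<exists>y. (g has_real_derivative y) (at s) \<and> 0 < y"
        using der[of s] d(2)[of "s - t"] h assms(2,5) by (intro exI[of _ "g' s"]) auto
    qed (use h cont' in simp_all)
    then show False using assms(6)[of "t + h"] h assms(2) by auto
  next
    case False
    then have "t = b" using assms(2) by auto
    obtain d where d: "d > 0" "\<And>h. h > 0 \<Longrightarrow> t - h \<in> {a..b} \<Longrightarrow> h < d \<Longrightarrow> g' (t - h) < g' t"
      using has_real_derivative_pos_inc_left[OF assms(4) \<open>D > 0\<close>] by auto
    define h where "h = min (d / 2) (t - a)"
    have h: "h > 0" "h < d" "a \<le> t - h" using d(1) \<open>t = b\<close> assms(1) by (auto simp: h_def min_def)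
    have cont': "continuous_on {t - h..t} g"
      using h assms(2) by (intro continuous_on_subset[OF cont]) simp
    have "g (t - h) > g t"
    proof (rule DERIV_neg_imp_decreasing_open[of "t - h" t g])
      fix s assume "t - h < s" "s < t"
      then show "\<exists>y. (g has_real_derivative y) (at s) \<and> y < 0"
        using der[of s] d(2)[of "t - s"] h assms(2,5) \<open>t = b\<close> by (intro exI[of _ "g' s"]) auto
    qed (use h cont' in simp_all)
    then show False using assms(6)[of "t - h"] h assms(2) by auto
  qed
qed

lemma ck_on_has_real_derivative_fst:
  assumes "a < b" "c < d" "ck_on (Suc k) ({a..b} \<times> {c..d}) f" "t \<in> {a..b}" "v \<in> {c..d}"
  shows "((\<lambda>t. f (t, v)) has_real_derivative pdx ({a..b} \<times> {c..d}) f (t, v)) (at t within {a..b})"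
proof -
  have "closed_rect ({a..b} \<times> {c..d})" using assms(1,2) unfolding closed_rect_def by blast
  from ck_on_has_derivative[OF this assms(3), of "(t, v)"]
  have "(f has_derivative (\<lambda>h. fst h * pdx ({a..b} \<times> {c..d}) f (t, v) + snd h * pdy ({a..b} \<times> {c..d}) f (t, v)))
      (at (t, v) within (\<lambda>t. (t, v)) ` {a..b})"
    using assms(4,5) by (auto intro: has_derivative_subset)
  from has_derivative_in_compose[OF _ this, of "\<lambda>h. (h, 0)"]
  have "((\<lambda>t. f (t, v)) has_derivative (\<lambda>h. h * pdx ({a..b} \<times> {c..d}) f (t, v))) (at t within {a..b})"
    by (simp add: has_derivative_Pair)
  then show ?thesis unfolding has_field_derivative_def by (simp only: mult_commute_abs)
qed

lemma ck_on_has_real_derivative_snd: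
  assumes "a < b" "c < d" "ck_on (Suc k) ({a..b} \<times> {c..d}) f" "u \<in> {a..b}" "t \<in> {c..d}"
  shows "((\<lambda>t. f (u, t)) has_real_derivative pdy ({a..b} \<times> {c..d}) f (u, t)) (at t within {c..d})"
proof -
  have "closed_rect ({a..b} \<times> {c..d})" using assms(1,2) unfolding closed_rect_def by blast
  from ck_on_has_derivative[OF this assms(3), of "(u, t)"]
  have "(f has_derivative (\<lambda>h. fst h * pdx ({a..b} \<times> {c..d}) f (u, t) + snd h * pdy ({a..b} \<times> {c..d}) f (u, t)))
      (at (u, t) within (\<lambda>t. (u, t)) ` {c..d})"
    using assms(4,5) by (auto intro: has_derivative_subset)
  from has_derivative_in_compose[OF _ this, of "\<lambda>h. (0, h)"]
  have "((\<lambda>t. f (u, t)) has_derivative (\<lambda>h. h * pdy ({a..b} \<times> {c..d}) f (u, t))) (at t within {c..d})"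
    by (simp add: has_derivative_Pair)
  then show ?thesis unfolding has_field_derivative_def by (simp only: mult_commute_abs)
qed

text \<open>Slices through the maximum point reduce everything to one variable. The second-order
  conclusions are conditional, since at a side the normal derivative of a maximum may be
  nonzero.\<close>

lemma max_on_rect:
  assumes "a < b" "c < d" "ck_on 2 ({a..b} \<times> {c..d}) f" "u \<in> {a..b}" "v \<in> {c..d}"
    and max: "\<And>q. q \<in> {a..b} \<times> {c..d} \<Longrightarrow> f q \<le> f (u, v)"
  shows "u < b \<Longrightarrow> pdx ({a..b} \<times> {c..d}) f (u, v) \<le> 0"
    "a < u \<Longrightarrow> pdx ({a..b} \<times> {c..d}) f (u, v) \<ge> 0"
    "v < d \<Longrightarrow> pdy ({a..b} \<times> {c..d}) f (u, v) \<le> 0"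
    "c < v \<Longrightarrow> pdy ({a..b} \<times> {c..d}) f (u, v) \<ge> 0"
    "pdx ({a..b} \<times> {c..d}) f (u, v) = 0 \<Longrightarrow> pdx ({a..b} \<times> {c..d}) (pdx ({a..b} \<times> {c..d}) f) (u, v) \<le> 0"
    "pdy ({a..b} \<times> {c..d}) f (u, v) = 0 \<Longrightarrow> pdy ({a..b} \<times> {c..d}) (pdy ({a..b} \<times> {c..d}) f) (u, v) \<le> 0"
proof -
  have ck: "ck_on (Suc (Suc 0)) ({a..b} \<times> {c..d}) f"
    using assms(3) by (simp only: numeral_2_eq_2)
  then have ckx: "ck_on (Suc 0) ({a..b} \<times> {c..d}) (pdx ({a..b} \<times> {c..d}) f)"
    and cky: "ck_on (Suc 0) ({a..b} \<times> {c..d}) (pdy ({a..b} \<times> {c..d}) f)" by simp_all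
  have mx: "f (s, v) \<le> f (u, v)" if "s \<in> {a..b}" for s using max assms(5) that by auto
  have my: "f (u, s) \<le> f (u, v)" if "s \<in> {c..d}" for s using max assms(4) that by auto
  note dx = ck_on_has_real_derivative_fst[OF assms(1,2) ck _ assms(5)]
  note dy = ck_on_has_real_derivative_snd[OF assms(1,2) ck assms(4)]
  show "u < b \<Longrightarrow> pdx ({a..b} \<times> {c..d}) f (u, v) \<le> 0" "a < u \<Longrightarrow> pdx ({a..b} \<times> {c..d}) f (u, v) \<ge> 0"
    using max_on_interval_first_derivative[OF dx[OF assms(4)] assms(4) mx] by blast+
  show "v < d \<Longrightarrow> pdy ({a..b} \<times> {c..d}) f (u, v) \<le> 0" "c < v \<Longrightarrow> pdy ({a..b} \<times> {c..d}) f (u, v) \<ge> 0"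
    using max_on_interval_first_derivative[OF dy[OF assms(5)] assms(5) my] by blast+
  show "pdx ({a..b} \<times> {c..d}) (pdx ({a..b} \<times> {c..d}) f) (u, v) \<le> 0"
    if "pdx ({a..b} \<times> {c..d}) f (u, v) = 0"
    by (rule max_on_interval_second_derivative[OF assms(1,4) dx
        ck_on_has_real_derivative_fst[OF assms(1,2) ckx assms(4,5)] that mx])
  show "pdy ({a..b} \<times> {c..d}) (pdy ({a..b} \<times> {c..d}) f) (u, v) \<le> 0"
    if "pdy ({a..b} \<times> {c..d}) f (u, v) = 0"
    by (rule max_on_interval_second_derivative[OF assms(2,5) dy
        ck_on_has_real_derivative_snd[OF assms(1,2) cky assms(4,5)] that my])
qed

section \<open>Sides of cells and bounds on grid points\<close>

lemma rect_sides_box: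
  assumes "a < b" "c < d"
  shows "rect_sides ({a<..<b} \<times> {c<..<d}) =
    {{a} \<times> {c..d}, {b} \<times> {c..d}, {a..b} \<times> {c}, {a..b} \<times> {d}}"
proof -
  \<comment> \<open>\<open>rect_sides\<close> quantifies over all presentations of the open box;
    closures recover the endpoints, so there is only one.\<close>
  have uniq: "a' = a \<and> b' = b \<and> c' = c \<and> d' = d"
    if "a' < b'" "c' < d'" "{a<..<b} \<times> {c<..<d} = {a'<..<b'} \<times> {c'<..<d'}" for a' b' c' d' :: real
  proof -
    have "closure ({a<..<b} \<times> {c<..<d}) = closure ({a'<..<b'} \<times> {c'<..<d'})"
      using that(3) by simp
    then have "{a..b} \<times> {c..d} = {a'..b'} \<times> {c'..d'}"
      using assms that(1,2) by (simp add: closure_Times)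
    then show ?thesis using assms that(1,2) by (auto simp: times_eq_iff Icc_eq_Icc)
  qed
  show ?thesis
  proof (intro equalityI subsetI)
    fix e assume "e \<in> rect_sides ({a<..<b} \<times> {c<..<d})"
    then obtain a' b' c' d' where e: "a' < b'" "c' < d'" "{a<..<b} \<times> {c<..<d} = {a'<..<b'} \<times> {c'<..<d'}"
      "e \<in> {{a'} \<times> {c'..d'}, {b'} \<times> {c'..d'}, {a'..b'} \<times> {c'}, {a'..b'} \<times> {d'}}"
      unfolding rect_sides_def by (elim CollectE exE conjE)
    show "e \<in> {{a} \<times> {c..d}, {b} \<times> {c..d}, {a..b} \<times> {c}, {a..b} \<times> {d}}"
      using e(4) uniq[OF e(1,2,3)] by simp
  next
    fix e assume "e \<in> {{a} \<times> {c..d}, {b} \<times> {c..d}, {a..b} \<times> {c}, {a..b} \<times> {d}}"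
    with assms show "e \<in> rect_sides ({a<..<b} \<times> {c<..<d})"
      unfolding rect_sides_def by (intro CollectI exI conjI) (assumption | rule refl)+
  qed
qed

lemma refinement_mono:
  assumes "refinement k x" "i \<le> j" "j \<le> k"
  shows "x i \<le> x j"
  using assms(2,3)
proof (induction j rule: dec_induct)
  case (step n)
  then have "x n < x (Suc n)" using assms(1) unfolding refinement_def by simp
  then show ?case using step by simp
qed simp

lemma refinement_bounds:
  assumes "refinement k x" "i \<le> k"
  shows "-1 \<le> x i" "x i \<le> 1"
  using refinement_mono[OF assms(1), of 0 i] refinement_mono[OF assms(1), of i k] assms
  unfolding refinement_def by auto

lemma frontier_Omega: "frontier Omega = {-1..1} \<times> {-1..1} - {-1<..<1} \<times> {-1<..<1}"
  unfolding frontier_def Omega_def by (simp add: closure_Times interior_Times)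

text \<open>At a positive maximum of the family the first derivatives vanish, also where several cells
  meet: the one-sided derivatives seen from the cells on both sides of an edge have opposite
  signs, and they agree.\<close>
lemma grid_maximum_principle:
  fixes f :: "nat \<Rightarrow> real \<times> real \<Rightarrow> real"
  assumes "a > 0" and ref: "refinement k x" "refinement k' y"
    and Om: "bij_betw Om {1..N} (grid_cells k x k' y)"
    and ck: "\<And>l. l \<in> {1..N} \<Longrightarrow> ck_on 2 (closure (Om l)) (f l)"
    and pde: "\<And>l p. l \<in> {1..N} \<Longrightarrow> p \<in> closure (Om l) \<Longrightarrow> diff_op \<epsilon> a (closure (Om l)) (f l) p = 0"
    and bd: "\<And>l e p. l \<in> {1..N} \<Longrightarrow> e \<in> rect_sides (Om l) \<Longrightarrow> e \<subseteq> frontier Omega \<Longrightarrow> p \<in> e \<Longrightarrow> f l p = 0"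
    and match: "\<And>m n e p. m \<in> {1..N} \<Longrightarrow> n \<in> {1..N} \<Longrightarrow> m \<noteq> n \<Longrightarrow>
      e \<in> rect_sides (Om m) \<Longrightarrow> e \<in> rect_sides (Om n) \<Longrightarrow> p \<in> e \<Longrightarrow>
      f m p = f n p \<and> pdx (closure (Om m)) (f m) p = pdx (closure (Om n)) (f n) p
        \<and> pdy (closure (Om m)) (f m) p = pdy (closure (Om n)) (f n) p"
    and "l \<in> {1..N}" "p \<in> closure (Om l)"
  shows "f l p \<le> 0"
proof (rule ccontr)
  assume "\<not> f l p \<le> 0"
  have cell: "\<exists>i j. i < k \<and> j < k' \<and> Om l = {x i<..<x (Suc i)} \<times> {y j<..<y (Suc j)}"
    if "l \<in> {1..N}" for l
    using bij_betwE[OF Om] that unfolding grid_cells_def by blast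
  have index: "\<exists>l\<in>{1..N}. Om l = {x i<..<x (Suc i)} \<times> {y j<..<y (Suc j)}"
    if "i < k" "j < k'" for i j
  proof -
    have "{x i<..<x (Suc i)} \<times> {y j<..<y (Suc j)} \<in> grid_cells k x k' y"
      using that unfolding grid_cells_def by blast
    then have "{x i<..<x (Suc i)} \<times> {y j<..<y (Suc j)} \<in> Om ` {1..N}"
      unfolding bij_betw_imp_surj_on[OF Om] .
    then show ?thesis by (elim imageE) (rule bexI, rule sym)
  qed
  have lt: "\<And>i. i < k \<Longrightarrow> x i < x (Suc i)" "\<And>j. j < k' \<Longrightarrow> y j < y (Suc j)"
    using ref unfolding refinement_def by auto
  have closure: "closure ({x i<..<x (Suc i)} \<times> {y j<..<y (Suc j)}) = {x i..x (Suc i)} \<times> {y j..y (Suc j)}"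
    if "i < k" "j < k'" for i j
    using lt that by (simp add: closure_Times)
  have "\<exists>q\<in>closure (Om l). \<forall>r\<in>closure (Om l). f l r \<le> f l q" if "l \<in> {1..N}" for l
  proof (rule continuous_attains_sup)
    from cell[OF that]
    obtain i j where "i < k" "j < k'" "Om l = {x i<..<x (Suc i)} \<times> {y j<..<y (Suc j)}"
      by blast
    then show "compact (closure (Om l))" "closure (Om l) \<noteq> {}"
      using closure[of i j] lt(1)[of i] lt(2)[of j] by (auto intro: compact_Times)
    show "continuous_on (closure (Om l)) (f l)"
      using ck[OF that] by (rule ck_on_continuous)
  qed
  then obtain z where z: "\<And>l. l \<in> {1..N} \<Longrightarrow> z l \<in> closure (Om l)"
    "\<And>l r. l \<in> {1..N} \<Longrightarrow> r \<in> closure (Om l) \<Longrightarrow> f l r \<le> f l (z l)" by metis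
  have "Max ((\<lambda>l. f l (z l)) ` {1..N}) \<in> (\<lambda>l. f l (z l)) ` {1..N}"
    using \<open>l \<in> {1..N}\<close> by (intro Max_in) auto
  then obtain m where m: "m \<in> {1..N}" "f m (z m) = Max ((\<lambda>l. f l (z l)) ` {1..N})" by auto
  have "f n (z n) \<le> f m (z m)" if "n \<in> {1..N}" for n
    unfolding m(2) using that by (intro Max_ge) auto
  then have max: "f n r \<le> f m (z m)" if "n \<in> {1..N}" "r \<in> closure (Om n)" for n r
    using z(2)[OF that] that(1) by fastforce
  have pos: "f m (z m) > 0"
    using max[OF \<open>l \<in> {1..N}\<close> \<open>p \<in> closure (Om l)\<close>] \<open>\<not> f l p \<le> 0\<close> by simp
  obtain u v where uv: "z m = (u, v)" by fastforce
  obtain i j where ij: "i < k" "j < k'" and Om_m: "Om m = {x i<..<x (Suc i)} \<times> {y j<..<y (Suc j)}"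
    using cell[OF m(1)] by blast
  define S where "S = {x i..x (Suc i)} \<times> {y j..y (Suc j)}"
  have S: "closure (Om m) = S" unfolding S_def Om_m by (rule closure[OF ij])
  have u: "u \<in> {x i..x (Suc i)}" and v: "v \<in> {y j..y (Suc j)}"
    using z(1)[OF m(1)] unfolding S S_def uv by auto
  have sides: "rect_sides ({x i<..<x (Suc i)} \<times> {y j<..<y (Suc j)}) =
      {{x i} \<times> {y j..y (Suc j)}, {x (Suc i)} \<times> {y j..y (Suc j)},
       {x i..x (Suc i)} \<times> {y j}, {x i..x (Suc i)} \<times> {y (Suc j)}}" if "i < k" "j < k'" for i j
    using lt that by (intro rect_sides_box)
  note here = max_on_rect[OF lt(1)[OF ij(1)] lt(2)[OF ij(2)], folded S_def,
      OF ck[OF m(1), unfolded S] u v max[OF m(1), unfolded S uv]]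
  have inner: "e \<in> rect_sides (Om m) \<Longrightarrow> (u, v) \<in> e \<Longrightarrow> \<not> e \<subseteq> frontier Omega" for e
    using bd[OF m(1), of e "(u, v)"] pos uv by auto
  have bounds: "-1 \<le> x i" "x (Suc i) \<le> 1" "-1 \<le> y j" "y (Suc j) \<le> 1"
    using ref ij by (auto intro: refinement_bounds)
  \<comment> \<open>A cell across an edge through the maximum point has the same value there, hence
    its own maximum, and the same gradient. The condition \<open>ne\<close> ensures that it is
    another cell, since matching is available only between distinct ones.\<close>
  have nbr: "\<exists>n\<in>{1..N}. closure (Om n) = {x i'..x (Suc i')} \<times> {y j'..y (Suc j')} \<and>
      ck_on 2 ({x i'..x (Suc i')} \<times> {y j'..y (Suc j')}) (f n) \<and>
      (\<forall>q\<in>{x i'..x (Suc i')} \<times> {y j'..y (Suc j')}. f n q \<le> f n (u, v)) \<and>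
      pdx S (f m) (u, v) = pdx ({x i'..x (Suc i')} \<times> {y j'..y (Suc j')}) (f n) (u, v) \<and>
      pdy S (f m) (u, v) = pdy ({x i'..x (Suc i')} \<times> {y j'..y (Suc j')}) (f n) (u, v)"
    if ij': "i' < k" "j' < k'" and ne: "x i' \<noteq> x i \<or> y j' \<noteq> y j" and "(u, v) \<in> e"
      and e: "e \<in> rect_sides (Om m)" "e \<in> rect_sides ({x i'<..<x (Suc i')} \<times> {y j'<..<y (Suc j')})"
    for i' j' e
  proof -
    obtain n where n: "n \<in> {1..N}" "Om n = {x i'<..<x (Suc i')} \<times> {y j'<..<y (Suc j')}"
      using index[OF ij'] by blast
    have cn: "closure (Om n) = {x i'..x (Suc i')} \<times> {y j'..y (Suc j')}"
      unfolding n(2) by (rule closure[OF ij'])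
    have "closure (Om n) \<noteq> closure (Om m)"
      unfolding cn S S_def using ne lt(1)[OF ij(1)] lt(2)[OF ij(2)] by (auto simp: times_eq_iff Icc_eq_Icc)
    then have "m \<noteq> n" by auto
    from match[OF m(1) n(1) this e(1) _ \<open>(u, v) \<in> e\<close>] e(2) n(2)
    have eq: "f m (u, v) = f n (u, v)" "pdx S (f m) (u, v) = pdx (closure (Om n)) (f n) (u, v)"
      "pdy S (f m) (u, v) = pdy (closure (Om n)) (f n) (u, v)" unfolding S by auto
    show ?thesis
      using n(1) cn ck[OF n(1)] max[OF n(1)] eq unfolding uv by (intro bexI[of _ n]) auto
  qed
  have Dx: "pdx S (f m) (u, v) = 0"
  proof (rule antisym)
    show "pdx S (f m) (u, v) \<le> 0"
    proof (cases "u < x (Suc i)")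
      case False
      then have ux: "u = x (Suc i)" using u by auto
      let ?e = "{x (Suc i)} \<times> {y j..y (Suc j)}"
      have e: "?e \<in> rect_sides (Om m)" "(u, v) \<in> ?e" using sides[OF ij] Om_m ux v by auto
      \<comment> \<open>In the last column this edge would lie on the boundary of the domain, where
        the function is 0, against the positive maximum. The other three directions are
        alike.\<close>
      have "Suc i \<noteq> k"
      proof
        assume "Suc i = k"
        then have "?e \<subseteq> frontier Omega"
          using bounds ref(1) unfolding frontier_Omega refinement_def by auto
        then show False using inner[OF e] by simp
      qed
      then have i': "Suc i < k" using ij by simp
      from nbr[OF i' ij(2) _ e(2,1)] lt(1)[OF ij(1)] sides[OF i' ij(2)] obtain n where n: "n \<in> {1..N}"
        "ck_on 2 ({x (Suc i)..x (Suc (Suc i))} \<times> {y j..y (Suc j)}) (f n)"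
        "\<forall>q\<in>{x (Suc i)..x (Suc (Suc i))} \<times> {y j..y (Suc j)}. f n q \<le> f n (u, v)"
        "pdx S (f m) (u, v) = pdx ({x (Suc i)..x (Suc (Suc i))} \<times> {y j..y (Suc j)}) (f n) (u, v)"
        by auto
      show ?thesis
        unfolding n(4) using max_on_rect(1)[OF lt(1)[OF i'] lt(2)[OF ij(2)] n(2) _ v, of u] n(3)
          lt(1)[OF i'] ux by auto
    qed (use here in blast)
    show "0 \<le> pdx S (f m) (u, v)"
    proof (cases "x i < u")
      case False
      then have ux: "u = x i" using u by auto
      let ?e = "{x i} \<times> {y j..y (Suc j)}"
      have e: "?e \<in> rect_sides (Om m)" "(u, v) \<in> ?e" using sides[OF ij] Om_m ux v by auto
      have "i \<noteq> 0"
      proof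
        assume "i = 0"
        then have "?e \<subseteq> frontier Omega"
          using bounds ref(1) unfolding frontier_Omega refinement_def by auto
        then show False using inner[OF e] by simp
      qed
      then obtain i' where i': "i = Suc i'" using not0_implies_Suc by blast
      have "i' < k" using ij i' by simp
      from nbr[OF this ij(2) _ e(2,1)] lt(1)[OF this] sides[OF this ij(2)] obtain n where n: "n \<in> {1..N}"
        "ck_on 2 ({x i'..x (Suc i')} \<times> {y j..y (Suc j)}) (f n)"
        "\<forall>q\<in>{x i'..x (Suc i')} \<times> {y j..y (Suc j)}. f n q \<le> f n (u, v)"
        "pdx S (f m) (u, v) = pdx ({x i'..x (Suc i')} \<times> {y j..y (Suc j)}) (f n) (u, v)"
        unfolding i' by auto
      show ?thesis
        unfolding n(4) using max_on_rect(2)[OF lt(1)[OF \<open>i' < k\<close>] lt(2)[OF ij(2)] n(2) _ v, of u] n(3)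
          lt(1)[OF \<open>i' < k\<close>] ux i' by auto
    qed (use here in blast)
  qed
  have Dy: "pdy S (f m) (u, v) = 0"
  proof (rule antisym)
    show "pdy S (f m) (u, v) \<le> 0"
    proof (cases "v < y (Suc j)")
      case False
      then have vy: "v = y (Suc j)" using v by auto
      let ?e = "{x i..x (Suc i)} \<times> {y (Suc j)}"
      have e: "?e \<in> rect_sides (Om m)" "(u, v) \<in> ?e" using sides[OF ij] Om_m vy u by auto
      have "Suc j \<noteq> k'"
      proof
        assume "Suc j = k'"
        then have "?e \<subseteq> frontier Omega"
          using bounds ref(2) unfolding frontier_Omega refinement_def by auto
        then show False using inner[OF e] by simp
      qed
      then have j': "Suc j < k'" using ij by simp
      from nbr[OF ij(1) j' _ e(2,1)] lt(2)[OF ij(2)] sides[OF ij(1) j'] obtain n where n: "n \<in> {1..N}"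
        "ck_on 2 ({x i..x (Suc i)} \<times> {y (Suc j)..y (Suc (Suc j))}) (f n)"
        "\<forall>q\<in>{x i..x (Suc i)} \<times> {y (Suc j)..y (Suc (Suc j))}. f n q \<le> f n (u, v)"
        "pdy S (f m) (u, v) = pdy ({x i..x (Suc i)} \<times> {y (Suc j)..y (Suc (Suc j))}) (f n) (u, v)"
        by auto
      show ?thesis
        unfolding n(4) using max_on_rect(3)[OF lt(1)[OF ij(1)] lt(2)[OF j'] n(2) u, of v] n(3)
          lt(2)[OF j'] vy by auto
    qed (use here in blast)
    show "0 \<le> pdy S (f m) (u, v)"
    proof (cases "y j < v")
      case False
      then have vy: "v = y j" using v by auto
      let ?e = "{x i..x (Suc i)} \<times> {y j}"
      have e: "?e \<in> rect_sides (Om m)" "(u, v) \<in> ?e" using sides[OF ij] Om_m vy u by auto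
      have "j \<noteq> 0"
      proof
        assume "j = 0"
        then have "?e \<subseteq> frontier Omega"
          using bounds ref(2) unfolding frontier_Omega refinement_def by auto
        then show False using inner[OF e] by simp
      qed
      then obtain j' where j': "j = Suc j'" using not0_implies_Suc by blast
      have "j' < k'" using ij j' by simp
      from nbr[OF ij(1) this _ e(2,1)] lt(2)[OF this] sides[OF ij(1) this] obtain n where n: "n \<in> {1..N}"
        "ck_on 2 ({x i..x (Suc i)} \<times> {y j'..y (Suc j')}) (f n)"
        "\<forall>q\<in>{x i..x (Suc i)} \<times> {y j'..y (Suc j')}. f n q \<le> f n (u, v)"
        "pdy S (f m) (u, v) = pdy ({x i..x (Suc i)} \<times> {y j'..y (Suc j')}) (f n) (u, v)"
        unfolding j' by auto
      show ?thesis
        unfolding n(4) using max_on_rect(4)[OF lt(1)[OF ij(1)] lt(2)[OF \<open>j' < k'\<close>] n(2) u, of v] n(3)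
          lt(2)[OF \<open>j' < k'\<close>] vy j' by auto
    qed (use here in blast)
  qed
  \<comment> \<open>With the gradient zero, both second-order tests apply within cell
    \<open>m\<close>; the equation then sets the sum of a nonnegative and a positive term to
    0.\<close>
  have "pdx S (pdx S (f m)) (u, v) + pdy S (pdy S (f m)) (u, v) \<le> 0"
    using here(5)[OF _ Dx] here(6)[OF _ Dy] by simp
  then have "0 \<le> - \<epsilon>\<^sup>2 * (pdx S (pdx S (f m)) (u, v) + pdy S (pdy S (f m)) (u, v))"
    by (simp add: mult_nonneg_nonpos)
  moreover have "0 < a * f m (u, v)" using \<open>a > 0\<close> pos uv by simp
  ultimately show False
    using pde[OF m(1) z(1)[OF m(1)]] unfolding diff_op_def S uv by simp
qed

subsection \<open>Integrals of squares as quadratic forms\<close>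

text \<open>Integrability of each kernel permits exchanging the integral with the finite sums, and
  the kernel integrals become the matrix; the default value 0 of a divergent integral would break
  linearity.\<close>

lemma quadratic_form_on_integral:
  assumes "\<And>i j. i \<in> A \<Longrightarrow> j \<in> A \<Longrightarrow> integrable M (k i j)"
    and "\<And>c t. q c t = (\<Sum>i\<in>A. \<Sum>j\<in>A. c i * c j * k i j t)"
  shows "quadratic_form_on A (\<lambda>c. \<integral>t. q c t \<partial>M)"
proof (rule quadratic_form_onI)
  fix c
  have "has_bochner_integral M (\<lambda>t. \<Sum>i\<in>A. \<Sum>j\<in>A. c i * c j * k i j t)
      (\<Sum>i\<in>A. \<Sum>j\<in>A. c i * c j * integral\<^sup>L M (k i j))"
    using assms(1)
    by (intro has_bochner_integral_sum has_bochner_integral_mult_right has_bochner_integral_integrable) auto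
  then show "(\<integral>t. q c t \<partial>M) = (\<Sum>i\<in>A. \<Sum>j\<in>A. c i * c j * integral\<^sup>L M (k i j))"
    unfolding assms(2) by (rule has_bochner_integral_integral_eq)
qed

text \<open>Continuity on the closed box provides integrability, while the expansion of \<psi> is
  asked for on the open box, over which the integral runs.\<close>

lemma quadratic_form_on_integral_square:
  fixes \<phi> :: "'i \<Rightarrow> 'a::euclidean_space \<Rightarrow> real"
  assumes "\<And>i. i \<in> A \<Longrightarrow> continuous_on (cbox a b) (\<phi> i)"
    and "\<And>c t. t \<in> box a b \<Longrightarrow> \<psi> c t = (\<Sum>i\<in>A. c i * \<phi> i t)"
  shows "quadratic_form_on A (\<lambda>c. LINT t:box a b|lborel. (\<psi> c t)\<^sup>2)"
  unfolding set_lebesgue_integral_def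
proof (rule quadratic_form_on_integral
    [where k = "\<lambda>i j t. indicator (box a b) t *\<^sub>R (\<phi> i t * \<phi> j t)"])
  fix i j assume "i \<in> A" "j \<in> A"
  then have "continuous_on (cbox a b) (\<lambda>t. \<phi> i t * \<phi> j t)"
    using assms(1) by (intro continuous_intros) auto
  then have "set_integrable lborel (cbox a b) (\<lambda>t. \<phi> i t * \<phi> j t)"
    unfolding set_integrable_def by (intro borel_integrable_compact) auto
  then have "set_integrable lborel (box a b) (\<lambda>t. \<phi> i t * \<phi> j t)"
    by (rule set_integrable_subset) (auto simp: box_subset_cbox)
  then show "integrable lborel (\<lambda>t. indicator (box a b) t *\<^sub>R (\<phi> i t * \<phi> j t))"
    unfolding set_integrable_def .
next
  fix c t
  show "indicator (box a b) t *\<^sub>R (\<psi> c t)\<^sup>2 =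
      (\<Sum>i\<in>A. \<Sum>j\<in>A. c i * c j * (indicator (box a b) t *\<^sub>R (\<phi> i t * \<phi> j t)))"
  proof (cases "t \<in> box a b")
    case True
    then show ?thesis by (simp add: assms(2) power2_eq_square sum_product mult_ac)
  qed simp
qed

text \<open>The boundary of the box is negligible, so the zero integral passes to the closed box,
  where a continuous nonnegative integrand must vanish everywhere. The integrand \<psi> and its
  continuous version \<phi> may differ on the boundary.\<close>

lemma integral_square_eq_0D:
  fixes \<psi> :: "'a::euclidean_space \<Rightarrow> real"
  assumes "(LINT t:box a b|lborel. (\<psi> t)\<^sup>2) = 0" "continuous_on (cbox a b) \<phi>"
    "\<And>t. t \<in> box a b \<Longrightarrow> \<psi> t = \<phi> t" "box a b \<noteq> {}" "t \<in> cbox a b"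
  shows "\<phi> t = 0"
proof -
  have cont: "continuous_on (cbox a b) (\<lambda>t. (\<phi> t)\<^sup>2)"
    using assms(2) by (intro continuous_intros)
  have "set_integrable lborel (cbox a b) (\<lambda>t. (\<phi> t)\<^sup>2)"
    unfolding set_integrable_def using cont by (intro borel_integrable_compact) auto
  then have si: "set_integrable lborel (box a b) (\<lambda>t. (\<phi> t)\<^sup>2)"
    by (rule set_integrable_subset) (auto simp: box_subset_cbox)
  have "(LINT t:box a b|lborel. (\<phi> t)\<^sup>2) = (LINT t:box a b|lborel. (\<psi> t)\<^sup>2)"
    using assms(3) by (intro set_lebesgue_integral_cong) auto
  then have "((\<lambda>t. (\<phi> t)\<^sup>2) has_integral 0) (box a b)"
    using set_borel_integral_eq_integral[OF si] assms(1) by (simp add: has_integral_iff)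
  then have "((\<lambda>t. (\<phi> t)\<^sup>2) has_integral 0) (cbox a b)"
    by (simp add: has_integral_open_interval)
  from has_integral_0_cbox_imp_0[OF cont _ this assms(4,5)] show ?thesis by simp
qed

section \<open>Trace norms on the reference interval\<close>

lemma refI_box: "refI = box (-1) 1"
  by (simp add: refI_def box_real)

lemma refS_box: "refS = box (-1, -1) (1, 1)" "closure refS = cbox (-1, -1) (1, 1)"
  by (simp_all add: refS_def closure_Times box_prod cbox_Pair_eq box_real)

lemma l2_sq_nonneg: "l2_sq v \<ge> 0"
  unfolding l2_sq_def set_lebesgue_integral_def by (intro Bochner_Integration.integral_nonneg) simp

text \<open>The double integral of a nonnegative integrand is nonnegative even when it diverges, its
  value then being 0.\<close>

lemma frac_sq_ge_l2_sq: "l2_sq v \<le> frac_sq \<sigma> v"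
  unfolding frac_sq_def set_lebesgue_integral_def
  by (simp add: Bochner_Integration.integral_nonneg)

lemma frac_sq_nonneg: "frac_sq \<sigma> v \<ge> 0"
  using l2_sq_nonneg frac_sq_ge_l2_sq by (rule order_trans)

lemma frac1_sq_ge_l2_sq: "l2_sq v \<le> frac1_sq \<sigma> v"
  unfolding frac1_sq_def using frac_sq_nonneg[of \<sigma> "deriv v"] by simp

lemma l2_sq_eq_0D:
  assumes "l2_sq v = 0" "continuous_on {-1..1} \<phi>" "\<And>t. t \<in> refI \<Longrightarrow> v t = \<phi> t" "t \<in> {-1..1}"
  shows "\<phi> t = 0"
proof (rule integral_square_eq_0D[where \<psi> = v and \<phi> = \<phi> and a = "-1" and b = 1])
  show "(LINT t:box (-1) 1|lborel. (v t)\<^sup>2) = 0"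
    using assms(1) by (simp add: l2_sq_def refI_box)
qed (use assms in \<open>simp_all add: refI_box box_real\<close>)

lemma quadratic_form_on_l2_sq:
  assumes "\<And>i. i \<in> A \<Longrightarrow> continuous_on {-1..1} (\<phi> i)"
    and "\<And>c t. t \<in> refI \<Longrightarrow> \<psi> c t = (\<Sum>i\<in>A. c i * \<phi> i t)"
  shows "quadratic_form_on A (\<lambda>c. l2_sq (\<psi> c))"
  unfolding l2_sq_def refI_box
  by (rule quadratic_form_on_integral_square[where \<phi> = \<phi>]) (use assms in \<open>simp_all add: refI_box\<close>)

text \<open>For \<sigma> = 1/2 the denominator is |t - t'|^2, which a product of two Lipschitz
  differences absorbs exactly. The polarized kernel is therefore bounded on the square of the
  interval, both iterated integrals exist, and they can be expanded in the coefficients.\<close>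

lemma quadratic_form_on_frac_sq:
  assumes lip: "\<And>i. i \<in> A \<Longrightarrow> \<exists>L. L-lipschitz_on {-1..1} (\<phi> i)"
    and lin: "\<And>c t. t \<in> refI \<Longrightarrow> \<psi> c t = (\<Sum>i\<in>A. c i * \<phi> i t)"
  shows "quadratic_form_on A (\<lambda>c. frac_sq (1/2) (\<psi> c))"
  unfolding frac_sq_def
proof (rule quadratic_form_on_add)
  have cont: "continuous_on {-1..1} (\<phi> i)" if "i \<in> A" for i
    using lip[OF that] lipschitz_on_continuous_on by blast
  then show "quadratic_form_on A (\<lambda>c. l2_sq (\<psi> c))"
    using lin by (intro quadratic_form_on_l2_sq[of A \<phi>]) auto
  \<comment> \<open>The basis functions are controlled on the interval only; the cut-off makes them,
    and with them the kernel, measurable on the whole line.\<close>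
  define \<rho> :: "real \<Rightarrow> real" where "\<rho> = indicator refI"
  define \<phi>' where "\<phi>' i t = \<rho> t * \<phi> i t" for i t
  \<comment> \<open>On the diagonal numerator and denominator both vanish and the quotient is
    0.\<close>
  define k where "k i j t s = \<rho> t * (\<rho> s * ((\<phi>' i t - \<phi>' i s) * (\<phi>' j t - \<phi>' j s) / \<bar>t - s\<bar>\<^sup>2))" for i j t s
  have [measurable]: "\<rho> \<in> borel_measurable borel" unfolding \<rho>_def refI_def by measurable
  have meas: "\<phi>' i \<in> borel_measurable borel" if "i \<in> A" for i
  proof -
    have "continuous_on refI (\<phi> i)"
      using cont[OF that] by (rule continuous_on_subset) (auto simp: refI_def)
    then have "(\<lambda>t. indicator refI t *\<^sub>R \<phi> i t) \<in> borel_measurable borel"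
      by (intro borel_measurable_continuous_on_indicator) (auto simp: refI_def)
    then show ?thesis unfolding \<phi>'_def \<rho>_def by simp
  qed
  have int: "integrable lborel \<rho>"
    unfolding \<rho>_def refI_def by (intro integrable_real_indicator) auto
  have \<rho>: "0 \<le> \<rho> t" "\<rho> t \<noteq> 0 \<Longrightarrow> t \<in> refI" "t \<in> refI \<Longrightarrow> \<rho> t = 1" for t
    unfolding \<rho>_def by (auto simp: indicator_def split: if_splits)
  have bound: "\<exists>L. L \<ge> 0 \<and> (\<forall>t s. \<bar>k i j t s\<bar> \<le> L * (\<rho> t * \<rho> s))" if "i \<in> A" "j \<in> A" for i j
  proof -
    from lip[OF that(1)] lip[OF that(2)]
    obtain L L' where L: "L-lipschitz_on {-1..1} (\<phi> i)" "L'-lipschitz_on {-1..1} (\<phi> j)"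
      by blast
    then have LL: "0 \<le> L" "0 \<le> L'" by (auto dest: lipschitz_on_nonneg)
    have "\<bar>k i j t s\<bar> \<le> L * L' * (\<rho> t * \<rho> s)" for t s
    proof (cases "t \<in> refI \<and> s \<in> refI \<and> t \<noteq> s")
      case True
      then have ts: "t \<in> {-1..1}" "s \<in> {-1..1}" by (auto simp: refI_def)
      have "\<bar>\<phi> i t - \<phi> i s\<bar> \<le> L * \<bar>t - s\<bar>" "\<bar>\<phi> j t - \<phi> j s\<bar> \<le> L' * \<bar>t - s\<bar>"
        using lipschitz_onD[OF L(1) ts] lipschitz_onD[OF L(2) ts] by (simp_all add: dist_real_def)
      then have "\<bar>\<phi> i t - \<phi> i s\<bar> * \<bar>\<phi> j t - \<phi> j s\<bar> \<le> (L * \<bar>t - s\<bar>) * (L' * \<bar>t - s\<bar>)"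
        using LL by (intro mult_mono) auto
      then have "\<bar>\<phi> i t - \<phi> i s\<bar> * \<bar>\<phi> j t - \<phi> j s\<bar> / \<bar>t - s\<bar>\<^sup>2 \<le> L * L'"
        using True by (simp add: divide_le_eq power2_eq_square mult_ac)
      then show ?thesis using True by (simp add: k_def \<phi>'_def \<rho> abs_mult)
    next
      case False
      then have "k i j t s = 0" unfolding k_def using \<rho>(2) by auto
      then show ?thesis using LL \<rho>(1) by simp
    qed
    then show ?thesis using LL by (intro exI[of _ "L * L'"]) simp
  qed
  have k_meas: "case_prod (k i j) \<in> borel_measurable (lborel \<Otimes>\<^sub>M lborel)" if "i \<in> A" "j \<in> A" for i j
  proof -
    note [measurable] = meas[OF that(1)] meas[OF that(2)]
    show ?thesis unfolding k_def by measurable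
  qed
  have k_int: "integrable lborel (k i j t)" if "i \<in> A" "j \<in> A" for i j t
  proof -
    from bound[OF that] obtain L where L: "\<And>t s. \<bar>k i j t s\<bar> \<le> L * (\<rho> t * \<rho> s)" by blast
    note [measurable] = meas[OF that(1)] meas[OF that(2)]
    show ?thesis
    proof (rule Bochner_Integration.integrable_bound)
      show "integrable lborel (\<lambda>s. L * (\<rho> t * \<rho> s))" using int by simp
      show "k i j t \<in> borel_measurable lborel" unfolding k_def by measurable
      show "AE s in lborel. norm (k i j t s) \<le> norm (L * (\<rho> t * \<rho> s))"
        using L abs_ge_self by (auto intro!: AE_I2 intro: order_trans)
    qed
  qed
  \<comment> \<open>The outer integrand inherits the bound: integrating the majorant over s leaves a
    multiple of \<rho> t. Its measurability comes from joint measurability of the kernel.\<close>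
  have kk_int: "integrable lborel (\<lambda>t. \<integral>s. k i j t s \<partial>lborel)" if "i \<in> A" "j \<in> A" for i j
  proof -
    from bound[OF that] obtain L where L: "\<And>t s. \<bar>k i j t s\<bar> \<le> L * (\<rho> t * \<rho> s)" by blast
    show ?thesis
    proof (rule Bochner_Integration.integrable_bound)
      show "integrable lborel (\<lambda>t. (L * integral\<^sup>L lborel \<rho>) * \<rho> t)" using int by simp
      show "(\<lambda>t. \<integral>s. k i j t s \<partial>lborel) \<in> borel_measurable lborel"
        using lborel.borel_measurable_lebesgue_integral[OF k_meas[OF that]] .
      have "norm (\<integral>s. k i j t s \<partial>lborel) \<le> norm (L * integral\<^sup>L lborel \<rho> * \<rho> t)" for t
      proof -
        have "norm (\<integral>s. k i j t s \<partial>lborel) \<le> (\<integral>s. norm (k i j t s) \<partial>lborel)"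
          by (rule integral_norm_bound)
        also have "\<dots> \<le> (\<integral>s. L * (\<rho> t * \<rho> s) \<partial>lborel)"
          using k_int[OF that] int L by (intro integral_mono) auto
        also have "\<dots> = L * integral\<^sup>L lborel \<rho> * \<rho> t" by simp
        finally show ?thesis by simp
      qed
      then show "AE t in lborel. norm (\<integral>s. k i j t s \<partial>lborel) \<le> norm (L * integral\<^sup>L lborel \<rho> * \<rho> t)"
        by simp
    qed
  qed
  \<comment> \<open>The exponent 1 + 2 * (1 / 2) is 2, so the real power becomes a square.\<close>
  have expand: "indicator refI t *\<^sub>R (indicator refI s *\<^sub>R ((\<psi> c t - \<psi> c s)\<^sup>2 / \<bar>t - s\<bar> powr (1 + 2 * (1 / 2))))
      = (\<Sum>i\<in>A. \<Sum>j\<in>A. c i * c j * k i j t s)" for c t s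
  proof (cases "t \<in> refI \<and> s \<in> refI")
    case True
    have "\<psi> c t - \<psi> c s = (\<Sum>i\<in>A. c i * (\<phi> i t - \<phi> i s))"
      using lin True by (simp add: sum_subtractf right_diff_distrib)
    then have sq: "(\<psi> c t - \<psi> c s)\<^sup>2 =
        (\<Sum>i\<in>A. \<Sum>j\<in>A. c i * c j * ((\<phi> i t - \<phi> i s) * (\<phi> j t - \<phi> j s)))"
      by (simp add: power2_eq_square sum_product mult_ac)
    have "(\<psi> c t - \<psi> c s)\<^sup>2 / \<bar>t - s\<bar>\<^sup>2 =
        (\<Sum>i\<in>A. \<Sum>j\<in>A. c i * c j * ((\<phi> i t - \<phi> i s) * (\<phi> j t - \<phi> j s) / \<bar>t - s\<bar>\<^sup>2))"
      unfolding sq sum_divide_distrib by simp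
    then show ?thesis using True by (simp add: k_def \<phi>'_def \<rho>)
  next
    case False
    then show ?thesis unfolding k_def \<rho>_def by (auto simp: indicator_def)
  qed
  have inner: "indicator refI t *\<^sub>R (\<integral>s. indicator refI s *\<^sub>R ((\<psi> c t - \<psi> c s)\<^sup>2 / \<bar>t - s\<bar> powr (1 + 2 * (1 / 2))) \<partial>lborel)
      = (\<Sum>i\<in>A. \<Sum>j\<in>A. c i * c j * (\<integral>s. k i j t s \<partial>lborel))" for c t
  proof -
    have "indicator refI t *\<^sub>R (\<integral>s. indicator refI s *\<^sub>R ((\<psi> c t - \<psi> c s)\<^sup>2 / \<bar>t - s\<bar> powr (1 + 2 * (1 / 2))) \<partial>lborel)
        = (\<integral>s. (\<Sum>i\<in>A. \<Sum>j\<in>A. c i * c j * k i j t s) \<partial>lborel)"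
      unfolding expand[symmetric] by (simp only: real_scaleR_def integral_mult_right_zero)
    also have "\<dots> = (\<Sum>i\<in>A. \<Sum>j\<in>A. c i * c j * (\<integral>s. k i j t s \<partial>lborel))"
      using k_int
      by (intro has_bochner_integral_integral_eq has_bochner_integral_sum has_bochner_integral_mult_right
          has_bochner_integral_integrable) auto
    finally show ?thesis .
  qed
  show "quadratic_form_on A (\<lambda>c. LINT t:refI|lborel. LINT t':refI|lborel. (\<psi> c t - \<psi> c t')\<^sup>2 / \<bar>t - t'\<bar> powr (1 + 2 * (1 / 2)))"
    unfolding set_lebesgue_integral_def
    by (rule quadratic_form_on_integral[OF kk_int inner])
qed

subsection \<open>Elements and their sides\<close>

lemma element_map_closure:
  assumes "element_map R F" "p \<in> closure refS"
  shows "F p \<in> closure R"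
  using assms unfolding element_map_def bij_betw_def by blast

lemma phys_element_map:
  assumes "element_map R F" "p \<in> closure refS"
  shows "phys F v (F p) = v p"
  using assms unfolding element_map_def bij_betw_def phys_def by (simp add: inv_into_f_f)

lemma ck_on_element_map:
  assumes "element_map R F"
  shows "ck_on k (closure refS) (fst \<circ> F)" "ck_on k (closure refS) (snd \<circ> F)"
proof -
  have "real_analytic_on F (closure refS)" using assms unfolding element_map_def by simp
  from real_analytic_on_bounded_linear[OF bounded_linear_fst this]
    real_analytic_on_bounded_linear[OF bounded_linear_snd this]
  show "ck_on k (closure refS) (fst \<circ> F)" "ck_on k (closure refS) (snd \<circ> F)"
    by (auto intro: real_analytic_on_imp_ck_on[OF closed_rect_closure_refS])
qed

lemma continuous_on_element_map:
  assumes "element_map R F"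
  shows "continuous_on (closure refS) F"
  using continuous_on_Pair[OF ck_on_continuous[OF ck_on_element_map(1)[OF assms]]
      ck_on_continuous[OF ck_on_element_map(2)[OF assms]]]
  by (simp add: o_def)

lemma lipschitz_on_element_map:
  assumes "element_map R F"
  shows "\<exists>L. L-lipschitz_on (closure refS) F"
proof -
  have "\<exists>L. L-lipschitz_on (closure refS) (fst \<circ> F)" "\<exists>L. L-lipschitz_on (closure refS) (snd \<circ> F)"
    using ck_on_element_map[OF assms, of "Suc 0"] ck_on_lipschitz_on[OF closed_rect_closure_refS] by blast+
  then obtain L L' where "L-lipschitz_on (closure refS) (fst \<circ> F)" "L'-lipschitz_on (closure refS) (snd \<circ> F)"
    by blast
  from lipschitz_on_Pair[OF this] show ?thesis by (auto simp: o_def)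
qed

text \<open>Here analyticity of the inverse element map enters: it makes transported monomials
  smooth up to the sides of the cell. The scalar \<open>r\<close> accommodates the factor 0 or 1 in
  \<open>cell_monomial\<close>.\<close>

lemma ck_on_phys_monomial:
  assumes "closed_rect (closure R)" "element_map R F"
  shows "ck_on k (closure R) (phys F (\<lambda>p. r * (fst p ^ i * snd p ^ j)))"
proof -
  let ?G = "inv_into (closure refS) F"
  have "real_analytic_on ?G (closure R)" using assms(2) unfolding element_map_def by simp
  from real_analytic_on_bounded_linear[OF bounded_linear_fst this]
    real_analytic_on_bounded_linear[OF bounded_linear_snd this]
  have "ck_on k (closure R) (fst \<circ> ?G)" "ck_on k (closure R) (snd \<circ> ?G)"
    by (auto intro: real_analytic_on_imp_ck_on[OF assms(1)])
  then have "ck_on k (closure R) (\<lambda>q. r * ((fst \<circ> ?G) q ^ i * (snd \<circ> ?G) q ^ j))"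
    by (intro ck_on_mult ck_on_power ck_on_const assms(1))
  then show ?thesis by (simp add: phys_def o_def)
qed

lemma continuous_on_jacobian:
  assumes "element_map R F"
  shows "continuous_on (closure refS) (jacobian F)"
proof -
  have "ck_on (Suc 0) (closure refS) (fst \<circ> F)" "ck_on (Suc 0) (closure refS) (snd \<circ> F)"
    by (rule ck_on_element_map[OF assms])+
  then show ?thesis unfolding jacobian_def[abs_def] by (auto intro!: continuous_intros)
qed

lemma continuous_on_diff_op:
  assumes "ck_on 2 S f"
  shows "continuous_on S (diff_op \<epsilon> a S f)"
proof -
  have "ck_on (Suc (Suc 0)) S f" using assms by (simp only: numeral_2_eq_2)
  moreover from this have "continuous_on S f" by (rule ck_on_continuous)
  ultimately show ?thesis unfolding diff_op_def[abs_def] by (auto intro!: continuous_intros)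
qed

lemma continuous_on_elem_op:
  assumes "element_map R F" "ck_on 2 (closure R) (phys F v)"
  shows "continuous_on (closure refS) (elem_op \<epsilon> a R F v)"
  unfolding elem_op_def[abs_def]
  using element_map_closure[OF assms(1)]
  by (intro continuous_intros continuous_on_jacobian[OF assms(1)]
      continuous_on_compose2[OF continuous_on_diff_op[OF assms(2)] continuous_on_element_map[OF assms(1)]]) auto

lemma side_params_closure_refS: "s \<in> side_params \<Longrightarrow> t \<in> {-1..1} \<Longrightarrow> s t \<in> closure refS"
  unfolding side_params_def closure_refS by auto

lemma side_params_lipschitz_on: "s \<in> side_params \<Longrightarrow> 1-lipschitz_on X s"
  unfolding side_params_def by (auto intro!: lipschitz_onI simp: dist_Pair_Pair)

lemma lipschitz_on_element_side:
  assumes "element_map R F" "s \<in> side_params"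
  shows "\<exists>L. L-lipschitz_on {-1..1} (F \<circ> s)"
proof -
  obtain L where "L-lipschitz_on (closure refS) F" using lipschitz_on_element_map[OF assms(1)] by blast
  then have "L-lipschitz_on (s ` {-1..1}) F"
    using side_params_closure_refS[OF assms(2)] by (auto intro: lipschitz_on_subset)
  from lipschitz_on_compose[OF side_params_lipschitz_on[OF assms(2)] this] show ?thesis by blast
qed

lemma finite_side_params: "finite side_params"
  unfolding side_params_def by simp

lemma finite_edges: "finite (inter_edges N M)" "finite (boundary_edges N M)"
proof -
  have "inter_edges N M \<subseteq> {1..N} \<times> side_params \<times> {1..N} \<times> side_params"
    unfolding inter_edges_def by auto
  then show "finite (inter_edges N M)"
    using finite_side_params by (auto intro: finite_subset)
  have "boundary_edges N M \<subseteq> {1..N} \<times> side_params"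
    unfolding boundary_edges_def by auto
  then show "finite (boundary_edges N M)"
    using finite_side_params by (auto intro: finite_subset)
qed

text \<open>The parametrizations are told apart by their values at 0, the midpoints of the
  sides.\<close>

lemma card_side_params: "card side_params = 4"
proof -
  have "distinct (map (\<lambda>s. s (0::real)) [\<lambda>t. (-1, t), \<lambda>t. (1, t), \<lambda>t. (t, -1), \<lambda>t. (t, 1 :: real)])" by simp
  then have "distinct [\<lambda>t. (-1, t), \<lambda>t. (1, t), \<lambda>t. (t, -1), \<lambda>t. (t, 1 :: real)]"
    by (rule distinct_map[THEN iffD1, THEN conjunct1])
  from distinct_card[OF this] show ?thesis unfolding side_params_def by simp
qed

text \<open>The four sides of the square have distinct images, so they exhaust the four sides of the cell.\<close>
lemma element_map_sides:
  assumes "a < b" "c < d" "R = {a<..<b} \<times> {c<..<d}" "element_map R F" "e \<in> rect_sides R"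
  obtains s where "s \<in> side_params" "elem_side F s = e"
proof -
  have injF: "inj_on F (closure refS)"
    using assms(4) unfolding element_map_def bij_betw_def by blast
  \<comment> \<open>The midpoint of a side of the square lies on no other side, so by injectivity of
    \<open>F\<close> sides with equal images coincide.\<close>
  have mid: "s = s'" if "s \<in> side_params" "s' \<in> side_params" "t \<in> {-1..1}" "s 0 = s' t" for s s' t
    using that unfolding side_params_def by auto
  have "inj_on (elem_side F) side_params"
  proof (rule inj_onI)
    fix s s' assume s: "s \<in> side_params" "s' \<in> side_params" "elem_side F s = elem_side F s'"
    have "F (s 0) \<in> elem_side F s" unfolding elem_side_def by auto
    then obtain t where t: "t \<in> {-1..1}" "F (s 0) = F (s' t)" using s(3) unfolding elem_side_def by auto
    then have "s 0 = s' t"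
      using injF side_params_closure_refS[OF s(1), of 0] side_params_closure_refS[OF s(2) t(1)]
      by (auto dest: inj_onD)
    then show "s = s'" using mid s t(1) by blast
  qed
  then have card: "card (elem_side F ` side_params) = 4"
    by (simp add: card_image card_side_params)
  have sides: "rect_sides R = {{a} \<times> {c..d}, {b} \<times> {c..d}, {a..b} \<times> {c}, {a..b} \<times> {d}}"
    unfolding assms(3) by (rule rect_sides_box[OF assms(1,2)])
  have "elem_side F ` side_params = rect_sides R"
  proof (rule card_seteq)
    show "finite (rect_sides R)" unfolding sides by simp
    show "elem_side F ` side_params \<subseteq> rect_sides R"
      using assms(4) unfolding element_map_def by blast
    have "card (rect_sides R) \<le> 4"
      using card_length[of "[{a} \<times> {c..d}, {b} \<times> {c..d}, {a..b} \<times> {c}, {a..b} \<times> {d}]"]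
      unfolding sides by simp
    then show "card (rect_sides R) \<le> card (elem_side F ` side_params)" using card by simp
  qed
  with assms(5) have "e \<in> elem_side F ` side_params" by simp
  then show thesis by (elim imageE) (rule that, simp_all)
qed

section \<open>Cells and shared edges of a decomposition\<close>

lemma decomposition_cell:
  assumes "decomposition N Om M" "l \<in> {1..N}"
  obtains a b c d where "a < b" "c < d" "Om l = {a<..<b} \<times> {c<..<d}"
proof -
  from assms(1) obtain k x k' y where r: "refinement k x" "refinement k' y"
    "bij_betw Om {1..N} (grid_cells k x k' y)"
    unfolding decomposition_def by blast
  from bij_betwE[OF r(3)] assms(2) have "Om l \<in> grid_cells k x k' y" by blast
  then obtain i j where ij: "i < k" "j < k'" "Om l = {x i<..<x (Suc i)} \<times> {y j<..<y (Suc j)}"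
    unfolding grid_cells_def by blast
  then show thesis using r(1,2) unfolding refinement_def by (intro that[OF _ _ ij(3)]) simp_all
qed

lemma decomposition_closed_rect:
  assumes "decomposition N Om M" "l \<in> {1..N}"
  shows "closed_rect (closure (Om l))"
proof -
  from decomposition_cell[OF assms] obtain a b c d where
    h: "a < b" "c < d" "Om l = {a<..<b} \<times> {c<..<d}" by blast
  then have "closure (Om l) = {a..b} \<times> {c..d}" by (simp add: closure_Times)
  with h(1,2) show ?thesis unfolding closed_rect_def by blast
qed

lemma decomposition_element_map:
  "decomposition N Om M \<Longrightarrow> l \<in> {1..N} \<Longrightarrow> element_map (Om l) (M l)"
  unfolding decomposition_def by simp

text \<open>The second cell contains the edge points because the two edge images agree as sets; so
  both traces can be evaluated along the parametrization coming from \<open>m\<close>, as in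
  \<open>jump\<close>.\<close>

lemma inter_edgesD:
  assumes "decomposition N Om M" "(m, s, n, s') \<in> inter_edges N M"
  shows "m \<in> {1..N}" "n \<in> {1..N}" "s \<in> side_params"
    "\<And>t. t \<in> {-1..1} \<Longrightarrow> M m (s t) \<in> closure (Om m)"
    "\<And>t. t \<in> {-1..1} \<Longrightarrow> M m (s t) \<in> closure (Om n)"
proof -
  show mn: "m \<in> {1..N}" "n \<in> {1..N}" "s \<in> side_params"
    using assms(2) unfolding inter_edges_def by auto
  have s': "s' \<in> side_params" and eq: "elem_side (M m) s = elem_side (M n) s'"
    using assms(2) unfolding inter_edges_def by auto
  fix t :: real assume t: "t \<in> {-1..1}"
  show "M m (s t) \<in> closure (Om m)"
    by (rule element_map_closure[OF decomposition_element_map[OF assms(1) mn(1)]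
        side_params_closure_refS[OF mn(3) t]])
  have "M m (s t) \<in> elem_side (M m) s"
    using t unfolding elem_side_def by blast
  then have "M m (s t) \<in> elem_side (M n) s'" unfolding eq .
  then obtain r where "r \<in> {-1..1}" "M m (s t) = M n (s' r)" unfolding elem_side_def by blast
  then show "M m (s t) \<in> closure (Om n)"
    using element_map_closure[OF decomposition_element_map[OF assms(1) mn(2)]
        side_params_closure_refS[OF s']] by simp
qed

lemma set_integral_square_nonneg: "0 \<le> (LINT p:X|lborel. (g p :: real)\<^sup>2)"
  unfolding set_lebesgue_integral_def by (intro Bochner_Integration.integral_nonneg) simp

lemma frac1_sq_nonneg: "0 \<le> frac1_sq \<sigma> v"
  using l2_sq_nonneg frac1_sq_ge_l2_sq by (rule order_trans)

subsection \<open>Definiteness and quadraticity of the forms\<close>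

lemma V_form_sums_nonneg:
  "0 \<le> (\<Sum>l=1..N. LINT p:refS|lborel. (elem_op \<epsilon> a (Om l) (M l) (u l) p)\<^sup>2)"
  "0 \<le> (\<Sum>(m, s, n, s')\<in>inter_edges N M.
        l2_sq (jump (phys (M m) (u m)) (phys (M n) (u n)) (M m \<circ> s)) +
        frac_sq (1/2) (jump (pdx (closure (Om m)) (phys (M m) (u m)))
                            (pdx (closure (Om n)) (phys (M n) (u n))) (M m \<circ> s)) +
        frac_sq (1/2) (jump (pdy (closure (Om m)) (phys (M m) (u m)))
                            (pdy (closure (Om n)) (phys (M n) (u n))) (M m \<circ> s)))"
  "0 \<le> (\<Sum>(l, s)\<in>boundary_edges N M. frac1_sq (1/2) (phys (M l) (u l) \<circ> M l \<circ> s))"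
  by (auto intro!: sum_nonneg add_nonneg_nonneg set_integral_square_nonneg l2_sq_nonneg frac_sq_nonneg
      frac1_sq_nonneg)

lemma V_form_nonneg: "0 \<le> V_form \<epsilon> a N Om M u"
  unfolding V_form_def by (intro add_nonneg_nonneg V_form_sums_nonneg)

text \<open>A vanishing sum of nonnegative terms vanishes termwise, and each fractional norm
  dominates the L2 norm; only these L2 norms are retained.\<close>

lemma V_form_eq_0D:
  assumes "V_form \<epsilon> a N Om M u = 0"
  shows "l \<in> {1..N} \<Longrightarrow> (LINT p:refS|lborel. (elem_op \<epsilon> a (Om l) (M l) (u l) p)\<^sup>2) = 0"
    and "(m, s, n, s') \<in> inter_edges N M \<Longrightarrow>
        l2_sq (jump (phys (M m) (u m)) (phys (M n) (u n)) (M m \<circ> s)) = 0 \<and>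
        l2_sq (jump (pdx (closure (Om m)) (phys (M m) (u m)))
                            (pdx (closure (Om n)) (phys (M n) (u n))) (M m \<circ> s)) = 0 \<and>
        l2_sq (jump (pdy (closure (Om m)) (phys (M m) (u m)))
                            (pdy (closure (Om n)) (phys (M n) (u n))) (M m \<circ> s)) = 0"
    and "(l, s) \<in> boundary_edges N M \<Longrightarrow> l2_sq (phys (M l) (u l) \<circ> M l \<circ> s) = 0"
proof -
  let ?A = "\<Sum>l=1..N. LINT p:refS|lborel. (elem_op \<epsilon> a (Om l) (M l) (u l) p)\<^sup>2"
  let ?b = "\<lambda>(m, s, n, s').
        l2_sq (jump (phys (M m) (u m)) (phys (M n) (u n)) (M m \<circ> s)) +
        frac_sq (1/2) (jump (pdx (closure (Om m)) (phys (M m) (u m)))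
                            (pdx (closure (Om n)) (phys (M n) (u n))) (M m \<circ> s)) +
        frac_sq (1/2) (jump (pdy (closure (Om m)) (phys (M m) (u m)))
                            (pdy (closure (Om n)) (phys (M n) (u n))) (M m \<circ> s))"
  let ?c = "\<lambda>(l, s). frac1_sq (1/2) (phys (M l) (u l) \<circ> M l \<circ> s)"
  have V: "?A = 0" "sum ?b (inter_edges N M) = 0" "sum ?c (boundary_edges N M) = 0"
    using assms V_form_sums_nonneg(1)[of \<epsilon> a Om M u N] V_form_sums_nonneg(2)[of M u Om N]
      V_form_sums_nonneg(3)[of M u N]
    unfolding V_form_def by linarith+
  have pos: "0 \<le> ?b z" for z
    by (auto intro!: add_nonneg_nonneg l2_sq_nonneg frac_sq_nonneg split: prod.split)
  show "(LINT p:refS|lborel. (elem_op \<epsilon> a (Om l) (M l) (u l) p)\<^sup>2) = 0" if "l \<in> {1..N}"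
    using V(1) that by (subst (asm) sum_nonneg_eq_0_iff) (auto intro: set_integral_square_nonneg)
  show "l2_sq (jump (phys (M m) (u m)) (phys (M n) (u n)) (M m \<circ> s)) = 0 \<and>
        l2_sq (jump (pdx (closure (Om m)) (phys (M m) (u m)))
                            (pdx (closure (Om n)) (phys (M n) (u n))) (M m \<circ> s)) = 0 \<and>
        l2_sq (jump (pdy (closure (Om m)) (phys (M m) (u m)))
                            (pdy (closure (Om n)) (phys (M n) (u n))) (M m \<circ> s)) = 0"
    if "(m, s, n, s') \<in> inter_edges N M"
  proof -
    have "\<forall>z\<in>inter_edges N M. ?b z = 0"
      using sum_nonneg_eq_0_iff[OF finite_edges(1)[of N M], of ?b] V(2) pos by blast
    from bspec[OF this that] have "?b (m, s, n, s') = 0" .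
    then have z: "l2_sq (jump (phys (M m) (u m)) (phys (M n) (u n)) (M m \<circ> s)) +
        frac_sq (1/2) (jump (pdx (closure (Om m)) (phys (M m) (u m)))
                            (pdx (closure (Om n)) (phys (M n) (u n))) (M m \<circ> s)) +
        frac_sq (1/2) (jump (pdy (closure (Om m)) (phys (M m) (u m)))
                            (pdy (closure (Om n)) (phys (M n) (u n))) (M m \<circ> s)) = 0"
      by simp
    show ?thesis
      using z l2_sq_nonneg[of "jump (phys (M m) (u m)) (phys (M n) (u n)) (M m \<circ> s)"]
        l2_sq_nonneg[of "jump (pdx (closure (Om m)) (phys (M m) (u m)))
                            (pdx (closure (Om n)) (phys (M n) (u n))) (M m \<circ> s)"]
        l2_sq_nonneg[of "jump (pdy (closure (Om m)) (phys (M m) (u m)))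
                            (pdy (closure (Om n)) (phys (M n) (u n))) (M m \<circ> s)"]
        frac_sq_ge_l2_sq[of "jump (pdx (closure (Om m)) (phys (M m) (u m)))
                            (pdx (closure (Om n)) (phys (M n) (u n))) (M m \<circ> s)" "1/2"]
        frac_sq_ge_l2_sq[of "jump (pdy (closure (Om m)) (phys (M m) (u m)))
                            (pdy (closure (Om n)) (phys (M n) (u n))) (M m \<circ> s)" "1/2"]
      by linarith
  qed
  show "l2_sq (phys (M l) (u l) \<circ> M l \<circ> s) = 0" if "(l, s) \<in> boundary_edges N M"
  proof -
    have "\<forall>z\<in>boundary_edges N M. ?c z = 0"
      using sum_nonneg_eq_0_iff[OF finite_edges(2)[of N M], of ?c] V(3) frac1_sq_nonneg
      by (simp add: split_def)
    from bspec[OF this that] have "frac1_sq (1/2) (phys (M l) (u l) \<circ> M l \<circ> s) = 0" by simp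
    then show ?thesis
      using frac1_sq_ge_l2_sq[of "phys (M l) (u l) \<circ> M l \<circ> s" "1/2"]
        l2_sq_nonneg[of "phys (M l) (u l) \<circ> M l \<circ> s"] by linarith
  qed
qed

lemma continuous_on_jump:
  assumes "decomposition N Om M" "(m, s, n, s') \<in> inter_edges N M"
    "continuous_on (closure (Om m)) f" "continuous_on (closure (Om n)) g"
  shows "continuous_on {-1..1} (jump f g (M m \<circ> s))"
proof -
  note e = inter_edgesD[OF assms(1,2)]
  obtain L where "L-lipschitz_on {-1..1} (M m \<circ> s)"
    using lipschitz_on_element_side[OF decomposition_element_map[OF assms(1) e(1)] e(3)] by blast
  then have c: "continuous_on {-1..1} (M m \<circ> s)" by (rule lipschitz_on_continuous_on)
  show ?thesis
    unfolding jump_def[abs_def]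
    by (intro continuous_on_diff continuous_on_compose2[OF assms(3) c] continuous_on_compose2[OF assms(4) c])
      (use e in auto)
qed

lemma lipschitz_on_jump:
  assumes "decomposition N Om M" "(m, s, n, s') \<in> inter_edges N M"
    "\<exists>L. L-lipschitz_on (closure (Om m)) f" "\<exists>L. L-lipschitz_on (closure (Om n)) g"
  shows "\<exists>L. L-lipschitz_on {-1..1} (jump f g (M m \<circ> s))"
proof -
  note e = inter_edgesD[OF assms(1,2)]
  obtain L where L: "L-lipschitz_on {-1..1} (M m \<circ> s)"
    using lipschitz_on_element_side[OF decomposition_element_map[OF assms(1) e(1)] e(3)] by blast
  obtain L1 where "L1-lipschitz_on (closure (Om m)) f" using assms(3) by blast
  then have "L1-lipschitz_on ((M m \<circ> s) ` {-1..1}) f"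
    by (rule lipschitz_on_subset) (use e(4) in auto)
  note 1 = lipschitz_on_compose[OF L this]
  obtain L2 where "L2-lipschitz_on (closure (Om n)) g" using assms(4) by blast
  then have "L2-lipschitz_on ((M m \<circ> s) ` {-1..1}) g"
    by (rule lipschitz_on_subset) (use e(5) in auto)
  note 2 = lipschitz_on_compose[OF L this]
  from lipschitz_on_diff[OF 1 2] show ?thesis
    unfolding jump_def[abs_def] o_def by blast
qed

text \<open>Continuity turns the zero L2 norms into pointwise conditions on closed cells and edges,
  which are the hypotheses of the maximum principle. The one-sided conclusion is meant to be applied
  to \<open>u\<close> and to its negative.\<close>

lemma V_form_eq_0_imp_nonpos:
  assumes dec: "decomposition N Om M" and "a > 0" and V: "V_form \<epsilon> a N Om M u = 0"
    and ck: "\<And>l. l \<in> {1..N} \<Longrightarrow> ck_on 2 (closure (Om l)) (phys (M l) (u l))"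
    and "l \<in> {1..N}" "p \<in> closure refS"
  shows "u l p \<le> 0"
proof -
  from dec obtain k x k' y where grid: "refinement k x" "refinement k' y"
    "bij_betw Om {1..N} (grid_cells k x k' y)"
    unfolding decomposition_def by blast
  define f where "f l = phys (M l) (u l)" for l
  note el = decomposition_element_map[OF dec]
  have ck1: "continuous_on (closure (Om l)) (f l)" "continuous_on (closure (Om l)) (pdx (closure (Om l)) (f l))"
    "continuous_on (closure (Om l)) (pdy (closure (Om l)) (f l))" if "l \<in> {1..N}" for l
  proof -
    have c2: "ck_on (Suc (Suc 0)) (closure (Om l)) (f l)"
      using ck[OF that] unfolding f_def by (simp only: numeral_2_eq_2)
    then show "continuous_on (closure (Om l)) (f l)" by (rule ck_on_continuous)
    from c2 have "ck_on (Suc 0) (closure (Om l)) (pdx (closure (Om l)) (f l))"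
      "ck_on (Suc 0) (closure (Om l)) (pdy (closure (Om l)) (f l))" by simp_all
    then show "continuous_on (closure (Om l)) (pdx (closure (Om l)) (f l))"
      "continuous_on (closure (Om l)) (pdy (closure (Om l)) (f l))" by (blast intro: ck_on_continuous)+
  qed
  \<comment> \<open>The form sums over parametrized sides, the maximum principle speaks of sides as
    sets; each such set is the image of a parametrization.\<close>
  have side: "\<exists>s\<in>side_params. elem_side (M l) s = e" if "l \<in> {1..N}" "e \<in> rect_sides (Om l)" for l e
  proof -
    from decomposition_cell[OF dec that(1)] obtain a b c d where
      "a < b" "c < d" "Om l = {a<..<b} \<times> {c<..<d}" by blast
    from element_map_sides[OF this el[OF that(1)] that(2)] show ?thesis by blast
  qed
  have pde: "diff_op \<epsilon> a (closure (Om l)) (f l) q = 0" if l: "l \<in> {1..N}" and q: "q \<in> closure (Om l)" for l q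
  proof -
    have cont: "continuous_on (closure refS) (elem_op \<epsilon> a (Om l) (M l) (u l))"
      by (rule continuous_on_elem_op[OF el[OF l] ck[OF l]])
    have zero: "elem_op \<epsilon> a (Om l) (M l) (u l) r = 0" if "r \<in> closure refS" for r
      by (rule integral_square_eq_0D[where \<psi> = "elem_op \<epsilon> a (Om l) (M l) (u l)"
            and \<phi> = "elem_op \<epsilon> a (Om l) (M l) (u l)" and a = "(-1, -1)" and b = "(1, 1)"])
        (use V_form_eq_0D(1)[OF V l] cont that in \<open>simp_all add: refS_box[symmetric] refS_def\<close>)
    \<comment> \<open>The factor \<open>sqrt (jacobian F p)\<close> is known to be positive over the
      open square only, so the equation is obtained in the open cell and then extended by
      continuity.\<close>
    have "diff_op \<epsilon> a (closure (Om l)) (f l) r = 0" if "r \<in> Om l" for r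
    proof -
      from that el[OF l] have "r \<in> M l ` refS" unfolding element_map_def by simp
      then obtain z where z: "z \<in> refS" "r = M l z" by blast
      then have "jacobian (M l) z > 0" using el[OF l] unfolding element_map_def by simp
      then show ?thesis
        using zero[of z] z closure_subset[of refS] unfolding elem_op_def f_def by auto
    qed
    from continuous_constant_on_closure[OF continuous_on_diff_op[OF ck[OF l, folded f_def]] this q]
    show ?thesis .
  qed
  have bd: "f l q = 0" if l: "l \<in> {1..N}" and e: "e \<in> rect_sides (Om l)" "e \<subseteq> frontier Omega" and q: "q \<in> e" for l e q
  proof -
    obtain s where s: "s \<in> side_params" "elem_side (M l) s = e" using side[OF l e(1)] by blast
    then have "(l, s) \<in> boundary_edges N M" using l e(2) unfolding boundary_edges_def by auto
    from V_form_eq_0D(3)[OF V this] have z: "l2_sq (f l \<circ> M l \<circ> s) = 0" unfolding f_def .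
    obtain L where "L-lipschitz_on {-1..1} (M l \<circ> s)"
      using lipschitz_on_element_side[OF el[OF l] s(1)] by blast
    then have c: "continuous_on {-1..1} (M l \<circ> s)" by (rule lipschitz_on_continuous_on)
    have "continuous_on {-1..1} (\<lambda>t. f l ((M l \<circ> s) t))"
      by (rule continuous_on_compose2[OF ck1(1)[OF l] c])
        (use element_map_closure[OF el[OF l] side_params_closure_refS[OF s(1)]] in auto)
    then have "continuous_on {-1..1} (f l \<circ> M l \<circ> s)" by (simp add: o_def)
    from l2_sq_eq_0D[OF z this refl] have "(f l \<circ> M l \<circ> s) t = 0" if "t \<in> {-1..1}" for t
      using that .
    then show ?thesis using q unfolding s(2)[symmetric] elem_side_def by auto
  qed
  have match: "f m q = f n q \<and> pdx (closure (Om m)) (f m) q = pdx (closure (Om n)) (f n) q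
        \<and> pdy (closure (Om m)) (f m) q = pdy (closure (Om n)) (f n) q"
    if mn: "m \<in> {1..N}" "n \<in> {1..N}" "m < n" and e: "e \<in> rect_sides (Om m)" "e \<in> rect_sides (Om n)"
      and q: "q \<in> e" for m n e q
  proof -
    obtain s where s: "s \<in> side_params" "elem_side (M m) s = e" using side[OF mn(1) e(1)] by blast
    obtain s' where s': "s' \<in> side_params" "elem_side (M n) s' = e" using side[OF mn(2) e(2)] by blast
    have edge: "(m, s, n, s') \<in> inter_edges N M"
      using mn s s' unfolding inter_edges_def by auto
    obtain t where t: "t \<in> {-1..1}" "q = M m (s t)" using q unfolding s(2)[symmetric] elem_side_def by blast
    have J: "jump g h (M m \<circ> s) t = 0"
      if "l2_sq (jump g h (M m \<circ> s)) = 0" "continuous_on (closure (Om m)) g" "continuous_on (closure (Om n)) h"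
      for g h
      by (rule l2_sq_eq_0D[OF that(1) continuous_on_jump[OF dec edge that(2,3)] refl t(1)])
    note z = V_form_eq_0D(2)[OF V edge, folded f_def]
    show ?thesis
      using J[of "f m" "f n"] J[of "pdx (closure (Om m)) (f m)" "pdx (closure (Om n)) (f n)"]
        J[of "pdy (closure (Om m)) (f m)" "pdy (closure (Om n)) (f n)"] z ck1[OF mn(1)] ck1[OF mn(2)]
      unfolding jump_def t(2) by simp
  qed
  \<comment> \<open>\<open>inter_edges\<close> lists a shared edge with the smaller index in front;
    the relation itself is symmetric.\<close>
  have match': "f m q = f n q \<and> pdx (closure (Om m)) (f m) q = pdx (closure (Om n)) (f n) q
        \<and> pdy (closure (Om m)) (f m) q = pdy (closure (Om n)) (f n) q"
    if mn: "m \<in> {1..N}" "n \<in> {1..N}" "m \<noteq> n" and e: "e \<in> rect_sides (Om m)" "e \<in> rect_sides (Om n)"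
      and q: "q \<in> e" for m n e q
  proof (cases "m < n")
    case True
    from match[OF mn(1,2) this e q] show ?thesis .
  next
    case False
    then have "n < m" using mn(3) by simp
    from match[OF mn(2,1) this e(2,1) q] show ?thesis by simp
  qed
  have "f l (M l p) \<le> 0"
  proof (rule grid_maximum_principle[OF \<open>a > 0\<close> grid])
    show "ck_on 2 (closure (Om l)) (f l)" if "l \<in> {1..N}" for l
      using ck[OF that] unfolding f_def .
  qed (fact pde bd match' \<open>l \<in> {1..N}\<close> element_map_closure[OF el[OF \<open>l \<in> {1..N}\<close>] \<open>p \<in> closure refS\<close>])+
  then show ?thesis
    unfolding f_def phys_element_map[OF el[OF \<open>l \<in> {1..N}\<close>] \<open>p \<in> closure refS\<close>] .
qed

section \<open>Linear dependence of derivatives and traces on the coefficients\<close>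

lemma ck_on_2D:
  assumes "ck_on 2 S f"
  shows "ck_on (Suc 0) S (pdx S f)" "ck_on (Suc 0) S (pdy S f)" "ck_on (Suc (Suc 0)) S f"
  using assms by (simp_all add: numeral_2_eq_2)

lemma second_pd_lincomb:
  assumes S: "closed_rect S" and ck: "\<And>i. i \<in> A \<Longrightarrow> ck_on 2 S (g i)"
    and f: "\<And>q. q \<in> S \<Longrightarrow> f q = (\<Sum>i\<in>A. c i * g i q)" and p: "p \<in> S"
  shows "pdx S (pdx S f) p = (\<Sum>i\<in>A. c i * pdx S (pdx S (g i)) p)"
    and "pdy S (pdx S f) p = (\<Sum>i\<in>A. c i * pdy S (pdx S (g i)) p)"
    and "pdy S (pdy S f) p = (\<Sum>i\<in>A. c i * pdy S (pdy S (g i)) p)"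
proof -
  note c = ck_on_2D[OF ck]
  have x: "pdx S f q = (\<Sum>i\<in>A. c i * pdx S (g i) q)" if "q \<in> S" for q
    by (rule pdx_lincomb[OF S c(3) f that])
  have y: "pdy S f q = (\<Sum>i\<in>A. c i * pdy S (g i) q)" if "q \<in> S" for q
    by (rule pdy_lincomb[OF S c(3) f that])
  show "pdx S (pdx S f) p = (\<Sum>i\<in>A. c i * pdx S (pdx S (g i)) p)"
    by (rule pdx_lincomb[OF S c(1) x p])
  show "pdy S (pdx S f) p = (\<Sum>i\<in>A. c i * pdy S (pdx S (g i)) p)"
    by (rule pdy_lincomb[OF S c(1) x p])
  show "pdy S (pdy S f) p = (\<Sum>i\<in>A. c i * pdy S (pdy S (g i)) p)"
    by (rule pdy_lincomb[OF S c(2) y p])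
qed

lemma diff_op_lincomb:
  assumes S: "closed_rect S" and ck: "\<And>i. i \<in> A \<Longrightarrow> ck_on 2 S (g i)"
    and f: "\<And>q. q \<in> S \<Longrightarrow> f q = (\<Sum>i\<in>A. c i * g i q)" and p: "p \<in> S"
  shows "diff_op \<epsilon> a S f p = (\<Sum>i\<in>A. c i * diff_op \<epsilon> a S (g i) p)"
proof -
  have "pdx S (pdx S f) p = (\<Sum>i\<in>A. c i * pdx S (pdx S (g i)) p)"
    by (rule second_pd_lincomb(1)[OF S ck f p])
  moreover have "pdy S (pdy S f) p = (\<Sum>i\<in>A. c i * pdy S (pdy S (g i)) p)"
    by (rule second_pd_lincomb(3)[OF S ck f p])
  ultimately show ?thesis
    unfolding diff_op_def f[OF p]
    by (simp add: sum.distrib sum_distrib_left sum_subtractf sum_negf algebra_simps)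
qed

text \<open>Sides run parallel to an axis at unit speed, so differentiation along one is a single
  partial derivative, the same \<open>D\<close> for all functions and points. On the open interval
  it is two-sided, as \<open>deriv\<close> requires.\<close>

lemma side_params_derivative:
  assumes "s \<in> side_params"
  obtains D where "D \<in> {pdx (closure refS), pdy (closure refS)}"
    "\<And>f t. ck_on (Suc 0) (closure refS) f \<Longrightarrow> t \<in> refI \<Longrightarrow>
      ((\<lambda>t. f (s t)) has_real_derivative D f (s t)) (at t)"
proof -
  have at: "at t within {-1..1} = at t" if "t \<in> refI" for t :: real
    using that by (simp add: refI_def at_within_Icc_at)
  consider r where "r \<in> {-1, 1}" "s = (\<lambda>t. (r, t))" | r where "r \<in> {-1, 1}" "s = (\<lambda>t. (t, r))"
    using assms unfolding side_params_def by blast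
  then show thesis
  proof cases
    case 1
    show thesis
    proof (rule that[of "pdy (closure refS)"])
      fix f and t :: real assume f: "ck_on (Suc 0) (closure refS) f" and t: "t \<in> refI"
      have "((\<lambda>t. f (r, t)) has_real_derivative pdy ({-1..1} \<times> {-1..1}) f (r, t)) (at t within {-1..1})"
        by (rule ck_on_has_real_derivative_snd) (use f t 1(1) in \<open>auto simp: closure_refS refI_def simp del: ck_on.simps\<close>)
      then show "((\<lambda>t. f (s t)) has_real_derivative pdy (closure refS) f (s t)) (at t)"
        unfolding closure_refS 1(2) at[OF t] .
    qed simp
  next
    case 2
    show thesis
    proof (rule that[of "pdx (closure refS)"])
      fix f and t :: real assume f: "ck_on (Suc 0) (closure refS) f" and t: "t \<in> refI"
      have "((\<lambda>t. f (t, r)) has_real_derivative pdx ({-1..1} \<times> {-1..1}) f (t, r)) (at t within {-1..1})"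
        by (rule ck_on_has_real_derivative_fst) (use f t 2(1) in \<open>auto simp: closure_refS refI_def simp del: ck_on.simps\<close>)
      then show "((\<lambda>t. f (s t)) has_real_derivative pdx (closure refS) f (s t)) (at t)"
        unfolding closure_refS 2(2) at[OF t] .
    qed simp
  qed
qed

text \<open>Composition with \<open>F\<close> undoes \<open>phys\<close>, so the trace is
  \<open>v c\<close> on a side of the reference square and the element map drops out. This identity
  is available on the closed interval only, hence \<open>deriv\<close> is computed on the open
  one.\<close>

lemma quadratic_form_on_boundary_term:
  assumes F: "element_map R F" and s: "s \<in> side_params"
    and ck: "\<And>i. i \<in> A \<Longrightarrow> ck_on 2 (closure refS) (g i)"
    and v: "\<And>c p. v c p = (\<Sum>i\<in>A. c i * g i p)"
  shows "quadratic_form_on A (\<lambda>c. frac1_sq (1/2) (phys F (v c) \<circ> F \<circ> s))"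
  unfolding frac1_sq_def
proof (rule quadratic_form_on_add)
  note s01 = side_params_closure_refS[OF s]
  have cont_s: "continuous_on {-1..1} s"
    using side_params_lipschitz_on[OF s] by (rule lipschitz_on_continuous_on)
  have tr: "(phys F (v c) \<circ> F \<circ> s) t = v c (s t)" if "t \<in> {-1..1}" for c t
    using phys_element_map[OF F s01[OF that]] by simp
  have refI: "t \<in> refI \<Longrightarrow> t \<in> {-1..1}" for t by (simp add: refI_def)
  show "quadratic_form_on A (\<lambda>c. l2_sq (phys F (v c) \<circ> F \<circ> s))"
  proof (rule quadratic_form_on_l2_sq)
    show "continuous_on {-1..1} (\<lambda>t. g i (s t))" if "i \<in> A" for i
      by (rule continuous_on_compose2[OF ck_on_continuous[OF ck[OF that]] cont_s]) (use s01 in blast)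
    show "(phys F (v c) \<circ> F \<circ> s) t = (\<Sum>i\<in>A. c i * g i (s t))" if "t \<in> refI" for c t
      unfolding tr[OF refI[OF that]] v ..
  qed
  obtain D where D: "D \<in> {pdx (closure refS), pdy (closure refS)}"
    "\<And>f t. ck_on (Suc 0) (closure refS) f \<Longrightarrow> t \<in> refI \<Longrightarrow>
      ((\<lambda>t. f (s t)) has_real_derivative D f (s t)) (at t)"
    using side_params_derivative[OF s] by blast
  have ck1: "ck_on (Suc 0) (closure refS) (g i)" if "i \<in> A" for i
    using ck_on_SucD[OF ck_on_2D(3)[OF ck[OF that]]] .
  have ckD: "ck_on (Suc 0) (closure refS) (D (g i))" if "i \<in> A" for i
    using D(1) ck_on_2D(1,2)[OF ck[OF that]] by blast
  show "quadratic_form_on A (\<lambda>c. frac_sq (1/2) (deriv (phys F (v c) \<circ> F \<circ> s)))"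
  proof (rule quadratic_form_on_frac_sq)
    show "\<exists>L. L-lipschitz_on {-1..1} (\<lambda>t. D (g i) (s t))" if "i \<in> A" for i
    proof -
      from ck_on_lipschitz_on[OF closed_rect_closure_refS ckD[OF that]]
      obtain L where "L-lipschitz_on (closure refS) (D (g i))" by blast
      then have "L-lipschitz_on (s ` {-1..1}) (D (g i))"
        by (rule lipschitz_on_subset) (use s01 in blast)
      from lipschitz_on_compose[OF side_params_lipschitz_on[OF s] this]
      show ?thesis unfolding o_def by blast
    qed
    show "deriv (phys F (v c) \<circ> F \<circ> s) t = (\<Sum>i\<in>A. c i * D (g i) (s t))" if t: "t \<in> refI" for c t
    proof (rule DERIV_imp_deriv)
      have "((\<lambda>t. \<Sum>i\<in>A. c i * g i (s t)) has_real_derivative (\<Sum>i\<in>A. c i * D (g i) (s t))) (at t)"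
        by (intro DERIV_sum DERIV_cmult D(2) ck1 t)
      moreover have "open refI" by (simp add: refI_def)
      moreover have "\<And>r. r \<in> refI \<Longrightarrow> (\<Sum>i\<in>A. c i * g i (s r)) = (phys F (v c) \<circ> F \<circ> s) r"
        unfolding tr[OF refI] v ..
      ultimately show "((phys F (v c) \<circ> F \<circ> s) has_real_derivative (\<Sum>i\<in>A. c i * D (g i) (s t))) (at t)"
        using has_field_derivative_transform_within_open t by blast
    qed
  qed
qed

text \<open>\<open>phys F\<close> is linear and the Jacobian weight does not depend on the
  coefficients, so the integrand is the square of a linear form in them.\<close>

lemma quadratic_form_on_element_term:
  assumes R: "closed_rect (closure R)" and F: "element_map R F"
    and ck: "\<And>i. i \<in> A \<Longrightarrow> ck_on 2 (closure R) (phys F (g i))"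
    and v: "\<And>c p. v c p = (\<Sum>i\<in>A. c i * g i p)"
  shows "quadratic_form_on A (\<lambda>c. LINT p:refS|lborel. (elem_op \<epsilon> a R F (v c) p)\<^sup>2)"
  unfolding refS_box(1)
proof (rule quadratic_form_on_integral_square)
  show "continuous_on (cbox (-1, -1) (1, 1)) (elem_op \<epsilon> a R F (g i))" if "i \<in> A" for i
    unfolding refS_box(2)[symmetric] by (rule continuous_on_elem_op[OF F ck[OF that]])
  fix c and p :: "real \<times> real" assume "p \<in> box (-1, -1) (1, 1)"
  then have p: "p \<in> closure refS" using refS_box(1) closure_subset by blast
  have "phys F (v c) q = (\<Sum>i\<in>A. c i * phys F (g i) q)" for q
    unfolding phys_def by (simp add: v)
  from diff_op_lincomb[OF R ck this element_map_closure[OF F p]]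
  show "elem_op \<epsilon> a R F (v c) p = (\<Sum>i\<in>A. c i * elem_op \<epsilon> a R F (g i) p)"
    unfolding elem_op_def by (simp add: sum_distrib_left mult_ac)
qed

text \<open>Smoothness enters twice: on the cells for the operator and the jumps, on the reference
  square for the boundary traces.\<close>

lemma quadratic_form_on_V_form:
  assumes dec: "decomposition N Om M"
    and ck: "\<And>i l. i \<in> A \<Longrightarrow> l \<in> {1..N} \<Longrightarrow> ck_on 2 (closure (Om l)) (phys (M l) (g i l))"
    and ck': "\<And>i l. i \<in> A \<Longrightarrow> l \<in> {1..N} \<Longrightarrow> ck_on 2 (closure refS) (g i l)"
    and u: "\<And>c l p. u c l p = (\<Sum>i\<in>A. c i * g i l p)"
  shows "quadratic_form_on A (\<lambda>c. V_form \<epsilon> a N Om M (u c))"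
  unfolding V_form_def
proof (intro quadratic_form_on_add quadratic_form_on_sum)
  note rect = decomposition_closed_rect[OF dec] and el = decomposition_element_map[OF dec]
  show "quadratic_form_on A (\<lambda>c. LINT p:refS|lborel. (elem_op \<epsilon> a (Om l) (M l) (u c l) p)\<^sup>2)"
    if l: "l \<in> {1..N}" for l
    by (rule quadratic_form_on_element_term[OF rect[OF l] el[OF l] ck[OF _ l] u])
  have lin: "phys (M l) (u c l) q = (\<Sum>i\<in>A. c i * phys (M l) (g i l) q)" for c l q
    unfolding phys_def by (simp add: u)
  show "quadratic_form_on A (\<lambda>c. case z of (m, s, n, s') \<Rightarrow>
        l2_sq (jump (phys (M m) (u c m)) (phys (M n) (u c n)) (M m \<circ> s)) +
        frac_sq (1/2) (jump (pdx (closure (Om m)) (phys (M m) (u c m)))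
                            (pdx (closure (Om n)) (phys (M n) (u c n))) (M m \<circ> s)) +
        frac_sq (1/2) (jump (pdy (closure (Om m)) (phys (M m) (u c m)))
                            (pdy (closure (Om n)) (phys (M n) (u c n))) (M m \<circ> s)))"
    if z: "z \<in> inter_edges N M" for z
  proof -
    obtain m s n s' where z': "z = (m, s, n, s')" by (metis prod.collapse)
    note edge = z[unfolded z']
    note e = inter_edgesD[OF dec edge]
    have refI: "t \<in> refI \<Longrightarrow> t \<in> {-1..1}" for t by (simp add: refI_def)
    have ck1: "ck_on (Suc 0) (closure (Om l)) (pdx (closure (Om l)) (phys (M l) (g i l)))"
      "ck_on (Suc 0) (closure (Om l)) (pdy (closure (Om l)) (phys (M l) (g i l)))"
      "continuous_on (closure (Om l)) (phys (M l) (g i l))"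
      if "i \<in> A" "l \<in> {1..N}" for i l
      using ck_on_2D[OF ck[OF that]] ck_on_continuous by blast+
    have pd: "pdx (closure (Om l)) (phys (M l) (u c l)) q = (\<Sum>i\<in>A. c i * pdx (closure (Om l)) (phys (M l) (g i l)) q)"
      "pdy (closure (Om l)) (phys (M l) (u c l)) q = (\<Sum>i\<in>A. c i * pdy (closure (Om l)) (phys (M l) (g i l)) q)"
      if l: "l \<in> {1..N}" and q: "q \<in> closure (Om l)" for c l q
      using pdx_lincomb[OF rect[OF l] ck_on_2D(3)[OF ck[OF _ l]] lin q]
        pdy_lincomb[OF rect[OF l] ck_on_2D(3)[OF ck[OF _ l]] lin q] by simp_all
    have "quadratic_form_on A (\<lambda>c. l2_sq (jump (phys (M m) (u c m)) (phys (M n) (u c n)) (M m \<circ> s)))"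
    proof (rule quadratic_form_on_l2_sq)
      show "continuous_on {-1..1} (jump (phys (M m) (g i m)) (phys (M n) (g i n)) (M m \<circ> s))"
        if "i \<in> A" for i
        by (rule continuous_on_jump[OF dec edge ck1(3)[OF that e(1)] ck1(3)[OF that e(2)]])
      show "jump (phys (M m) (u c m)) (phys (M n) (u c n)) (M m \<circ> s) t
          = (\<Sum>i\<in>A. c i * jump (phys (M m) (g i m)) (phys (M n) (g i n)) (M m \<circ> s) t)" for c t
        unfolding jump_def lin by (simp add: sum_subtractf right_diff_distrib)
    qed
    moreover have "quadratic_form_on A (\<lambda>c. frac_sq (1/2) (jump (pdx (closure (Om m)) (phys (M m) (u c m)))
                            (pdx (closure (Om n)) (phys (M n) (u c n))) (M m \<circ> s)))"
    proof (rule quadratic_form_on_frac_sq)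
      show "\<exists>L. L-lipschitz_on {-1..1} (jump (pdx (closure (Om m)) (phys (M m) (g i m)))
          (pdx (closure (Om n)) (phys (M n) (g i n))) (M m \<circ> s))" if "i \<in> A" for i
        by (rule lipschitz_on_jump[OF dec edge ck_on_lipschitz_on[OF rect[OF e(1)] ck1(1)[OF that e(1)]]
              ck_on_lipschitz_on[OF rect[OF e(2)] ck1(1)[OF that e(2)]]])
      show "jump (pdx (closure (Om m)) (phys (M m) (u c m))) (pdx (closure (Om n)) (phys (M n) (u c n))) (M m \<circ> s) t
          = (\<Sum>i\<in>A. c i * jump (pdx (closure (Om m)) (phys (M m) (g i m)))
              (pdx (closure (Om n)) (phys (M n) (g i n))) (M m \<circ> s) t)" if "t \<in> refI" for c t
        using pd(1)[OF e(1) e(4)[OF refI[OF that]]] pd(1)[OF e(2) e(5)[OF refI[OF that]]]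
        by (simp add: jump_def sum_subtractf right_diff_distrib)
    qed
    moreover have "quadratic_form_on A (\<lambda>c. frac_sq (1/2) (jump (pdy (closure (Om m)) (phys (M m) (u c m)))
                            (pdy (closure (Om n)) (phys (M n) (u c n))) (M m \<circ> s)))"
    proof (rule quadratic_form_on_frac_sq)
      show "\<exists>L. L-lipschitz_on {-1..1} (jump (pdy (closure (Om m)) (phys (M m) (g i m)))
          (pdy (closure (Om n)) (phys (M n) (g i n))) (M m \<circ> s))" if "i \<in> A" for i
        by (rule lipschitz_on_jump[OF dec edge ck_on_lipschitz_on[OF rect[OF e(1)] ck1(2)[OF that e(1)]]
              ck_on_lipschitz_on[OF rect[OF e(2)] ck1(2)[OF that e(2)]]])
      show "jump (pdy (closure (Om m)) (phys (M m) (u c m))) (pdy (closure (Om n)) (phys (M n) (u c n))) (M m \<circ> s) t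
          = (\<Sum>i\<in>A. c i * jump (pdy (closure (Om m)) (phys (M m) (g i m)))
              (pdy (closure (Om n)) (phys (M n) (g i n))) (M m \<circ> s) t)" if "t \<in> refI" for c t
        using pd(2)[OF e(1) e(4)[OF refI[OF that]]] pd(2)[OF e(2) e(5)[OF refI[OF that]]]
        by (simp add: jump_def sum_subtractf right_diff_distrib)
    qed
    ultimately show ?thesis
      unfolding z' prod.case by (intro quadratic_form_on_add)
  qed
  show "quadratic_form_on A (\<lambda>c. case z of (l, s) \<Rightarrow> frac1_sq (1/2) (phys (M l) (u c l) \<circ> M l \<circ> s))"
    if "z \<in> boundary_edges N M" for z
  proof -
    obtain l s where z: "z = (l, s)" by fastforce
    then have l: "l \<in> {1..N}" and s: "s \<in> side_params"
      using that unfolding boundary_edges_def by auto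
    show ?thesis
      unfolding z prod.case by (rule quadratic_form_on_boundary_term[OF el[OF l] s ck'[OF _ l] u])
  qed
qed

text \<open>\<open>U_form\<close> differentiates within the open square, the smoothness classes
  within the closed one; at interior points both give the same filter.\<close>

lemma pd_refS:
  assumes "p \<in> refS"
  shows "pdx refS f p = pdx (closure refS) f p" "pdy refS f p = pdy (closure refS) f p"
proof -
  have op: "open refS" unfolding refS_def by (intro open_Times) auto
  then have "p \<in> interior (closure refS)"
    using assms interior_maximal[OF closure_subset] by blast
  then have "at p within refS = at p within closure refS"
    by (simp only: at_within_open[OF assms op] at_within_interior)
  then show "pdx refS f p = pdx (closure refS) f p" "pdy refS f p = pdy (closure refS) f p"
    by (simp_all add: pdx_def pdy_def)
qed

lemma second_pd_refS:
  assumes "p \<in> refS"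
  shows "pdx refS (pdx refS f) p = pdx (closure refS) (pdx (closure refS) f) p"
    "pdy refS (pdx refS f) p = pdy (closure refS) (pdx (closure refS) f) p"
    "pdy refS (pdy refS f) p = pdy (closure refS) (pdy (closure refS) f) p"
  using pdx_cong[OF pd_refS(1) assms] pdy_cong[OF pd_refS(1) assms] pdy_cong[OF pd_refS(2) assms]
    pd_refS[OF assms] by simp_all

text \<open>The integrand is a weighted sum of six squares of linear forms; integrability of each
  allows the integral to be split.\<close>

lemma quadratic_form_on_U_form:
  assumes ck: "\<And>i l. i \<in> A \<Longrightarrow> l \<in> {1..N} \<Longrightarrow> ck_on 2 (closure refS) (g i l)"
    and u: "\<And>c l p. u c l p = (\<Sum>i\<in>A. c i * g i l p)"
  shows "quadratic_form_on A (\<lambda>c. U_form \<epsilon> N (u c))"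
  unfolding U_form_def
proof (rule quadratic_form_on_sum)
  fix l assume l: "l \<in> {1..N}"
  let ?S = "closure refS"
  let ?I = "\<lambda>h. LINT p:refS|lborel. (h p)\<^sup>2"
  note c = ck[OF _ l]
  have cont: "continuous_on ?S (g i l)" "continuous_on ?S (pdx ?S (g i l))" "continuous_on ?S (pdy ?S (g i l))"
    "continuous_on ?S (pdx ?S (pdx ?S (g i l)))" "continuous_on ?S (pdy ?S (pdx ?S (g i l)))"
    "continuous_on ?S (pdy ?S (pdy ?S (g i l)))" if "i \<in> A" for i
    using ck_on_2D[OF c[OF that]] ck_on_continuous[OF c[OF that]]
      ck_on_continuous[OF ck_on_2D(1)[OF c[OF that]]] ck_on_continuous[OF ck_on_2D(2)[OF c[OF that]]]
    by simp_all
  have lin: "u c l p = (\<Sum>i\<in>A. c i * g i l p)" "pdx ?S (u c l) p = (\<Sum>i\<in>A. c i * pdx ?S (g i l) p)"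
    "pdy ?S (u c l) p = (\<Sum>i\<in>A. c i * pdy ?S (g i l) p)"
    "pdx ?S (pdx ?S (u c l)) p = (\<Sum>i\<in>A. c i * pdx ?S (pdx ?S (g i l)) p)"
    "pdy ?S (pdx ?S (u c l)) p = (\<Sum>i\<in>A. c i * pdy ?S (pdx ?S (g i l)) p)"
    "pdy ?S (pdy ?S (u c l)) p = (\<Sum>i\<in>A. c i * pdy ?S (pdy ?S (g i l)) p)" if "p \<in> ?S" for c p
    using u pdx_lincomb[OF closed_rect_closure_refS ck_on_2D(3)[OF c] u that]
      pdy_lincomb[OF closed_rect_closure_refS ck_on_2D(3)[OF c] u that]
      second_pd_lincomb[OF closed_rect_closure_refS c u that] by blast+
  \<comment> \<open>Stated for a generic linear family, then instantiated with the function and with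
    its first and second partials.\<close>
  have int: "set_integrable lborel refS (\<lambda>p. (h p)\<^sup>2)" and quad: "quadratic_form_on A (\<lambda>c. ?I (\<psi> c))"
    if cont': "\<And>i. i \<in> A \<Longrightarrow> continuous_on ?S (\<phi> i)" and lin': "\<And>c p. p \<in> ?S \<Longrightarrow> \<psi> c p = (\<Sum>i\<in>A. c i * \<phi> i p)" and "h = \<psi> c'"
    for \<phi> \<psi> h c'
  proof -
    have "continuous_on ?S (\<lambda>p. (\<Sum>i\<in>A. c' i * \<phi> i p)\<^sup>2)" using that(1) by (intro continuous_intros) auto
    then have "continuous_on ?S (\<lambda>p. (h p)\<^sup>2)"
      by (rule continuous_on_eq) (simp add: that(2,3))
    then have "set_integrable lborel ?S (\<lambda>p. (h p)\<^sup>2)"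
      unfolding set_integrable_def
      by (intro borel_integrable_compact closed_rect_compact closed_rect_closure_refS)
    then show "set_integrable lborel refS (\<lambda>p. (h p)\<^sup>2)"
      by (rule set_integrable_subset) (auto simp: refS_box(1) closure_subset)
    show "quadratic_form_on A (\<lambda>c. ?I (\<psi> c))"
      unfolding refS_box(1)
    proof (rule quadratic_form_on_integral_square[where \<phi> = \<phi>])
      show "continuous_on (cbox (-1, -1) (1, 1)) (\<phi> i)" if "i \<in> A" for i
        using cont'[OF that] unfolding refS_box(2) .
      show "\<psi> c p = (\<Sum>i\<in>A. c i * \<phi> i p)" if "p \<in> box (-1, -1) (1, 1)" for c p
        using lin' closure_subset that unfolding refS_box(1)[symmetric] by blast
    qed
  qed
  have meas: "refS \<in> sets lborel" by (simp add: refS_box(1))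
  have "(LINT p:refS|lborel.
        \<epsilon> ^ 4 * ((pdx refS (pdx refS (u c l)) p)\<^sup>2 + 2 * (pdy refS (pdx refS (u c l)) p)\<^sup>2
               + (pdy refS (pdy refS (u c l)) p)\<^sup>2) +
        \<epsilon>\<^sup>2 * ((pdx refS (u c l) p)\<^sup>2 + (pdy refS (u c l) p)\<^sup>2) + (u c l p)\<^sup>2)
      = \<epsilon> ^ 4 * (?I (pdx ?S (pdx ?S (u c l))) + 2 * ?I (pdy ?S (pdx ?S (u c l))) + ?I (pdy ?S (pdy ?S (u c l))))
        + \<epsilon>\<^sup>2 * (?I (pdx ?S (u c l)) + ?I (pdy ?S (u c l))) + ?I (u c l)" for c
  proof -
    have "(LINT p:refS|lborel.
        \<epsilon> ^ 4 * ((pdx refS (pdx refS (u c l)) p)\<^sup>2 + 2 * (pdy refS (pdx refS (u c l)) p)\<^sup>2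
               + (pdy refS (pdy refS (u c l)) p)\<^sup>2) +
        \<epsilon>\<^sup>2 * ((pdx refS (u c l) p)\<^sup>2 + (pdy refS (u c l) p)\<^sup>2) + (u c l p)\<^sup>2)
      = (LINT p:refS|lborel.
        \<epsilon> ^ 4 * ((pdx ?S (pdx ?S (u c l)) p)\<^sup>2 + 2 * (pdy ?S (pdx ?S (u c l)) p)\<^sup>2
               + (pdy ?S (pdy ?S (u c l)) p)\<^sup>2) +
        \<epsilon>\<^sup>2 * ((pdx ?S (u c l) p)\<^sup>2 + (pdy ?S (u c l) p)\<^sup>2) + (u c l p)\<^sup>2)"
    proof (rule set_lebesgue_integral_cong[OF meas], intro allI impI)
      fix p assume p: "p \<in> refS"
      show "\<epsilon> ^ 4 * ((pdx refS (pdx refS (u c l)) p)\<^sup>2 + 2 * (pdy refS (pdx refS (u c l)) p)\<^sup>2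
               + (pdy refS (pdy refS (u c l)) p)\<^sup>2) +
        \<epsilon>\<^sup>2 * ((pdx refS (u c l) p)\<^sup>2 + (pdy refS (u c l) p)\<^sup>2) + (u c l p)\<^sup>2 =
        \<epsilon> ^ 4 * ((pdx ?S (pdx ?S (u c l)) p)\<^sup>2 + 2 * (pdy ?S (pdx ?S (u c l)) p)\<^sup>2
               + (pdy ?S (pdy ?S (u c l)) p)\<^sup>2) +
        \<epsilon>\<^sup>2 * ((pdx ?S (u c l) p)\<^sup>2 + (pdy ?S (u c l) p)\<^sup>2) + (u c l p)\<^sup>2"
        unfolding second_pd_refS[OF p] unfolding pd_refS[OF p] ..
    qed
    also have "\<dots> = \<epsilon> ^ 4 * (?I (pdx ?S (pdx ?S (u c l))) + 2 * ?I (pdy ?S (pdx ?S (u c l))) + ?I (pdy ?S (pdy ?S (u c l))))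
        + \<epsilon>\<^sup>2 * (?I (pdx ?S (u c l)) + ?I (pdy ?S (u c l))) + ?I (u c l)"
    proof -
      define H where "H h p = indicator refS p *\<^sub>R (h p)\<^sup>2" for h :: "real \<times> real \<Rightarrow> real" and p
      have H: "has_bochner_integral lborel (H h) (?I h)" if "set_integrable lborel refS (\<lambda>p. (h p)\<^sup>2)" for h
        using that unfolding H_def set_integrable_def set_lebesgue_integral_def
        by (rule has_bochner_integral_integrable)
      note i = H[OF int[OF cont(1) lin(1) refl]] H[OF int[OF cont(2) lin(2) refl]] H[OF int[OF cont(3) lin(3) refl]]
        H[OF int[OF cont(4) lin(4) refl]] H[OF int[OF cont(5) lin(5) refl]] H[OF int[OF cont(6) lin(6) refl]]
      have "has_bochner_integral lborel
          (\<lambda>p. \<epsilon> ^ 4 * (H (pdx ?S (pdx ?S (u c l))) p + 2 * H (pdy ?S (pdx ?S (u c l))) p + H (pdy ?S (pdy ?S (u c l))) p)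
            + \<epsilon>\<^sup>2 * (H (pdx ?S (u c l)) p + H (pdy ?S (u c l)) p) + H (u c l) p)
          (\<epsilon> ^ 4 * (?I (pdx ?S (pdx ?S (u c l))) + 2 * ?I (pdy ?S (pdx ?S (u c l))) + ?I (pdy ?S (pdy ?S (u c l))))
            + \<epsilon>\<^sup>2 * (?I (pdx ?S (u c l)) + ?I (pdy ?S (u c l))) + ?I (u c l))"
        by (intro has_bochner_integral_add has_bochner_integral_mult_right i)
      from has_bochner_integral_integral_eq[OF this] show ?thesis
        unfolding set_lebesgue_integral_def H_def by (simp add: algebra_simps)
    qed
    finally show ?thesis .
  qed
  moreover have "quadratic_form_on A (\<lambda>c. \<epsilon> ^ 4 * (?I (pdx ?S (pdx ?S (u c l))) + 2 * ?I (pdy ?S (pdx ?S (u c l))) + ?I (pdy ?S (pdy ?S (u c l))))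
        + \<epsilon>\<^sup>2 * (?I (pdx ?S (u c l)) + ?I (pdy ?S (u c l))) + ?I (u c l))"
    by (intro quadratic_form_on_add quadratic_form_on_cmult quad[OF cont(1) lin(1) refl] quad[OF cont(2) lin(2) refl]
        quad[OF cont(3) lin(3) refl] quad[OF cont(4) lin(4) refl] quad[OF cont(5) lin(5) refl] quad[OF cont(6) lin(6) refl])
  ultimately show "quadratic_form_on A (\<lambda>c. LINT p:refS|lborel.
        \<epsilon> ^ 4 * ((pdx refS (pdx refS (u c l)) p)\<^sup>2 + 2 * (pdy refS (pdx refS (u c l)) p)\<^sup>2
               + (pdy refS (pdy refS (u c l)) p)\<^sup>2) +
        \<epsilon>\<^sup>2 * ((pdx refS (u c l) p)\<^sup>2 + (pdy refS (u c l) p)\<^sup>2) + (u c l p)\<^sup>2)"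
    by simp
qed

subsection \<open>The coercivity estimate\<close>

lemma poly_eq_0_on_interval:
  fixes c :: "nat \<Rightarrow> real"
  assumes "\<And>x. x \<in> {-1..1} \<Longrightarrow> (\<Sum>i\<le>n. c i * x ^ i) = 0" "i \<le> n"
  shows "c i = 0"
proof (rule ccontr)
  assume "c i \<noteq> 0"
  then have "finite {x. (\<Sum>i\<le>n. c i * x ^ i) = 0}"
    using assms(2) polyfun_finite_roots[of c n] by blast
  moreover have "{-1..1} \<subseteq> {x. (\<Sum>i\<le>n. c i * x ^ i) = 0}" using assms(1) by blast
  ultimately have "finite {-1..(1::real)}" by (rule rev_finite_subset)
  then show False by (simp add: infinite_Icc)
qed

text \<open>For fixed y this is a polynomial in x with infinitely many zeros; its coefficients are
  polynomials in y, to which the same argument applies.\<close>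

lemma poly2_eq_0_on_square:
  fixes c :: "nat \<Rightarrow> nat \<Rightarrow> real"
  assumes "\<And>x y. x \<in> {-1..1} \<Longrightarrow> y \<in> {-1..1} \<Longrightarrow> (\<Sum>i\<le>n. \<Sum>j\<le>n. c i j * x ^ i * y ^ j) = 0"
    and "i \<le> n" "j \<le> n"
  shows "c i j = 0"
proof -
  have "(\<Sum>j\<le>n. c i j * y ^ j) = 0" if "y \<in> {-1..1}" for y
  proof (rule poly_eq_0_on_interval[OF _ assms(2)])
    show "(\<Sum>i\<le>n. (\<Sum>j\<le>n. c i j * y ^ j) * x ^ i) = 0" if "x \<in> {-1..1}" for x
      using assms(1)[OF that \<open>y \<in> {-1..1}\<close>] unfolding sum_distrib_right by (simp only: mult_ac)
  qed
  from poly_eq_0_on_interval[OF this assms(3)] show ?thesis .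
qed

text \<open>Basis of the broken polynomial space: a monomial on cell m, extended by 0 to the other
  cells. The index triples let all cells share one finite coordinate set.\<close>

definition cell_monomial :: "nat \<times> nat \<times> nat \<Rightarrow> nat \<Rightarrow> real \<times> real \<Rightarrow> real" where
  "cell_monomial = (\<lambda>(m, i, j) l p. (if l = m then 1 else 0) * (fst p ^ i * snd p ^ j))"

definition cell_poly :: "nat \<Rightarrow> nat \<Rightarrow> (nat \<times> nat \<times> nat \<Rightarrow> real) \<Rightarrow> nat \<Rightarrow> real \<times> real \<Rightarrow> real" where
  "cell_poly N W c l p = (\<Sum>\<alpha>\<in>{1..N} \<times> {..W} \<times> {..W}. c \<alpha> * cell_monomial \<alpha> l p)"

lemma cell_poly_eq:
  assumes "l \<in> {1..N}"
  shows "cell_poly N W c l p = (\<Sum>i\<le>W. \<Sum>j\<le>W. c (l, i, j) * fst p ^ i * snd p ^ j)"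
proof -
  have "cell_poly N W c l p =
      (\<Sum>m\<in>{1..N}. \<Sum>i\<le>W. \<Sum>j\<le>W. c (m, i, j) * cell_monomial (m, i, j) l p)"
    unfolding cell_poly_def sum.cartesian_product by (simp add: split_def)
  also have "\<dots> = (\<Sum>m\<in>{1..N}. if l = m then \<Sum>i\<le>W. \<Sum>j\<le>W. c (m, i, j) * fst p ^ i * snd p ^ j else 0)"
    by (intro sum.cong) (simp_all add: cell_monomial_def mult_ac)
  finally show ?thesis using assms by simp
qed

text \<open>Padding with zero coefficients embeds degree W into degree W', so one coefficient space
  serves all admissible degrees.\<close>

lemma spectral_space_cell_poly:
  assumes "u \<in> spectral_space N W" "W \<le> W'"
  shows "\<exists>c. \<forall>l\<in>{1..N}. u l = cell_poly N W' c l"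
proof -
  from assms(1) have "\<forall>l\<in>{1..N}. \<exists>d. \<forall>\<xi> \<eta>. u l (\<xi>, \<eta>) = (\<Sum>i\<le>W. \<Sum>j\<le>W. d i j * \<xi> ^ i * \<eta> ^ j)"
    unfolding spectral_space_def by (simp only: mem_Collect_eq)
  from bchoice[OF this] obtain d where
    d: "\<And>l \<xi> \<eta>. l \<in> {1..N} \<Longrightarrow> u l (\<xi>, \<eta>) = (\<Sum>i\<le>W. \<Sum>j\<le>W. d l i j * \<xi> ^ i * \<eta> ^ j)"
    by blast
  define c where "c = (\<lambda>(l, i, j). if i \<le> W \<and> j \<le> W then d l i j else 0)"
  have "u l p = cell_poly N W' c l p" if l: "l \<in> {1..N}" for l p
  proof -
    have "(\<Sum>j\<le>W'. c (l, i, j) * fst p ^ i * snd p ^ j) = (\<Sum>j\<le>W. c (l, i, j) * fst p ^ i * snd p ^ j)" for i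
      using assms(2) by (intro sum.mono_neutral_right) (auto simp: c_def)
    then have "cell_poly N W' c l p = (\<Sum>i\<le>W'. \<Sum>j\<le>W. c (l, i, j) * fst p ^ i * snd p ^ j)"
      unfolding cell_poly_eq[OF l] by simp
    also have "\<dots> = (\<Sum>i\<le>W. \<Sum>j\<le>W. c (l, i, j) * fst p ^ i * snd p ^ j)"
      using assms(2) by (intro sum.mono_neutral_right) (auto simp: c_def)
    also have "\<dots> = (\<Sum>i\<le>W. \<Sum>j\<le>W. d l i j * fst p ^ i * snd p ^ j)"
      by (intro sum.cong refl) (simp add: c_def)
    also have "\<dots> = u l p" using d[OF l, of "fst p" "snd p"] by simp
    finally show ?thesis by simp
  qed
  then show ?thesis by (intro exI[of _ c] ballI ext)
qed

lemma U_form_cong: "(\<And>l. l \<in> {1..N} \<Longrightarrow> u l = v l) \<Longrightarrow> U_form \<epsilon> N u = U_form \<epsilon> N v"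
  unfolding U_form_def by (intro sum.cong) simp_all

text \<open>A member of \<open>spectral_space\<close> is arbitrary at indices outside
  \<open>{1..N}\<close>; the form reads only indices inside.\<close>

lemma V_form_cong:
  assumes "\<And>l. l \<in> {1..N} \<Longrightarrow> u l = v l"
  shows "V_form \<epsilon> a N Om M u = V_form \<epsilon> a N Om M v"
proof -
  have 1: "(case z of (m, s, n, s') \<Rightarrow>
        l2_sq (jump (phys (M m) (u m)) (phys (M n) (u n)) (M m \<circ> s)) +
        frac_sq (1/2) (jump (pdx (closure (Om m)) (phys (M m) (u m)))
                            (pdx (closure (Om n)) (phys (M n) (u n))) (M m \<circ> s)) +
        frac_sq (1/2) (jump (pdy (closure (Om m)) (phys (M m) (u m)))
                            (pdy (closure (Om n)) (phys (M n) (u n))) (M m \<circ> s))) =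
      (case z of (m, s, n, s') \<Rightarrow>
        l2_sq (jump (phys (M m) (v m)) (phys (M n) (v n)) (M m \<circ> s)) +
        frac_sq (1/2) (jump (pdx (closure (Om m)) (phys (M m) (v m)))
                            (pdx (closure (Om n)) (phys (M n) (v n))) (M m \<circ> s)) +
        frac_sq (1/2) (jump (pdy (closure (Om m)) (phys (M m) (v m)))
                            (pdy (closure (Om n)) (phys (M n) (v n))) (M m \<circ> s)))"
    if z: "z \<in> inter_edges N M" for z
  proof -
    obtain m s n s' where z': "z = (m, s, n, s')" by (metis prod.collapse)
    then have "u m = v m" "u n = v n"
      using z assms unfolding inter_edges_def by auto
    then show ?thesis unfolding z' by simp
  qed
  have 2: "(case z of (l, s) \<Rightarrow> frac1_sq (1/2) (phys (M l) (u l) \<circ> M l \<circ> s)) =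
      (case z of (l, s) \<Rightarrow> frac1_sq (1/2) (phys (M l) (v l) \<circ> M l \<circ> s))"
    if z: "z \<in> boundary_edges N M" for z
  proof -
    obtain l s where z': "z = (l, s)" by fastforce
    then have "u l = v l" using z assms unfolding boundary_edges_def by auto
    then show ?thesis unfolding z' by simp
  qed
  show ?thesis
    unfolding V_form_def
    by (intro arg_cong2[where f = "(+)"] sum.cong refl 1 2) (simp_all add: assms)
qed

text \<open>The squared length of the coefficient vector mediates: it bounds U from above, and
  definiteness of V bounds it by V.\<close>

lemma cell_poly_coercive:
  assumes dec: "decomposition N Om M" and "a > 0"
  shows "\<exists>C\<ge>0. \<forall>c. U_form \<epsilon> N (cell_poly N W c) \<le> C * V_form \<epsilon> a N Om M (cell_poly N W c)"
proof -
  define A where "A = {1..N} \<times> {..W} \<times> {..W}"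
  have poly: "cell_poly N W c l p = (\<Sum>\<alpha>\<in>A. c \<alpha> * cell_monomial \<alpha> l p)" for c l p
    unfolding cell_poly_def A_def ..
  have ck: "ck_on 2 (closure (Om l)) (phys (M l) (cell_monomial \<alpha> l))" if "l \<in> {1..N}" for \<alpha> l
    using ck_on_phys_monomial[OF decomposition_closed_rect[OF dec that] decomposition_element_map[OF dec that]]
    by (cases \<alpha>) (simp only: cell_monomial_def prod.case)
  have ck': "ck_on 2 (closure refS) (cell_monomial \<alpha> l)" for \<alpha> l
    unfolding cell_monomial_def split_def
    by (intro ck_on_mult ck_on_power ck_on_const ck_on_fst ck_on_snd closed_rect_closure_refS)
  have ckp: "ck_on 2 (closure (Om l)) (phys (M l) (cell_poly N W c l))" if l: "l \<in> {1..N}" for c l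
  proof -
    have "ck_on 2 (closure (Om l)) (\<lambda>q. \<Sum>\<alpha>\<in>A. c \<alpha> * phys (M l) (cell_monomial \<alpha> l) q)"
      by (intro ck_on_sum ck_on_mult ck_on_const decomposition_closed_rect[OF dec l] ck[OF l])
    then show ?thesis by (simp add: phys_def poly o_def)
  qed
  have QU: "quadratic_form_on A (\<lambda>c. U_form \<epsilon> N (cell_poly N W c))"
    by (rule quadratic_form_on_U_form[OF ck' poly])
  have QV: "quadratic_form_on A (\<lambda>c. V_form \<epsilon> a N Om M (cell_poly N W c))"
    by (rule quadratic_form_on_V_form[OF dec ck ck' poly])
  have definite: "c \<alpha> = 0" if V: "V_form \<epsilon> a N Om M (cell_poly N W c) = 0" and "\<alpha> \<in> A" for c \<alpha>
  proof -
    obtain B where B: "\<And>c. V_form \<epsilon> a N Om M (cell_poly N W c) = (\<Sum>i\<in>A. \<Sum>j\<in>A. c i * c j * B i j)"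
      using QV unfolding quadratic_form_on_def by blast
    \<comment> \<open>A quadratic form is even, so the negated coefficients also give V = 0, and the
      one-sided bound holds for both signs.\<close>
    have V': "V_form \<epsilon> a N Om M (cell_poly N W (\<lambda>\<alpha>. - c \<alpha>)) = 0"
      using V unfolding B by simp
    have zero: "cell_poly N W c l p = 0" if "l \<in> {1..N}" "p \<in> closure refS" for l p
    proof -
      have "cell_poly N W (\<lambda>\<alpha>. - c \<alpha>) l p = - cell_poly N W c l p"
        by (simp add: poly sum_negf)
      then show ?thesis
        using V_form_eq_0_imp_nonpos[OF dec \<open>a > 0\<close> V ckp that]
          V_form_eq_0_imp_nonpos[OF dec \<open>a > 0\<close> V' ckp that] by simp
    qed
    obtain l i j where \<alpha>: "\<alpha> = (l, i, j)" "l \<in> {1..N}" "i \<le> W" "j \<le> W"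
      using \<open>\<alpha> \<in> A\<close> unfolding A_def by auto
    have "c (l, i, j) = 0"
    proof (rule poly2_eq_0_on_square[OF _ \<alpha>(3,4)])
      fix x y :: real assume "x \<in> {-1..1}" "y \<in> {-1..1}"
      then show "(\<Sum>i\<le>W. \<Sum>j\<le>W. c (l, i, j) * x ^ i * y ^ j) = 0"
        using zero[OF \<alpha>(2), of "(x, y)"] unfolding cell_poly_eq[OF \<alpha>(2)] closure_refS by simp
    qed
    then show ?thesis using \<alpha>(1) by simp
  qed
  have "finite A" unfolding A_def by simp
  then have "\<exists>C\<ge>0. \<forall>c. (\<Sum>\<alpha>\<in>A. (c \<alpha>)\<^sup>2) \<le> C * V_form \<epsilon> a N Om M (cell_poly N W c)"
    by (rule positive_definite_coercive[OF _ QV]) (fact V_form_nonneg definite)+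
  then obtain C where C: "C \<ge> 0" "\<And>c. (\<Sum>\<alpha>\<in>A. (c \<alpha>)\<^sup>2) \<le> C * V_form \<epsilon> a N Om M (cell_poly N W c)"
    by blast
  obtain D where D: "D \<ge> 0" "\<And>c. U_form \<epsilon> N (cell_poly N W c) \<le> D * (\<Sum>\<alpha>\<in>A. (c \<alpha>)\<^sup>2)"
    using quadratic_form_on_upper_bound[OF QU] by blast
  have "U_form \<epsilon> N (cell_poly N W c) \<le> (D * C) * V_form \<epsilon> a N Om M (cell_poly N W c)" for c
    using D(2)[of c] mult_left_mono[OF C(2)[of c] D(1)] by (simp add: mult.assoc)
  then show ?thesis using C(1) D(1) by (intro exI[of _ "D * C"]) simp
qed

theorem theorem3p1:
  fixes a \<epsilon> K :: real and N :: nat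
    and Om :: "nat \<Rightarrow> (real \<times> real) set"
    and M :: "nat \<Rightarrow> real \<times> real \<Rightarrow> real \<times> real"
  assumes "a > 0" and "0 < \<epsilon>" and "\<epsilon> \<le> 1"
    and "decomposition N Om M"
    and "K > 0"
  shows "\<exists>C>0. \<forall>W::nat. W \<ge> 2 \<and> real W \<le> K / \<epsilon> \<longrightarrow>
           (\<forall>u\<in>spectral_space N W.
              U_form \<epsilon> N u \<le> C * (ln (real W))\<^sup>2 * V_form \<epsilon> a N Om M u)"
proof -
  define W' where "W' = nat \<lfloor>K / \<epsilon>\<rfloor>"
  obtain C where C: "C \<ge> 0"
    "\<And>c. U_form \<epsilon> N (cell_poly N W' c) \<le> C * V_form \<epsilon> a N Om M (cell_poly N W' c)"
    using cell_poly_coercive[OF assms(4,1)] by blast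
  \<comment> \<open>Dividing by (ln 2)^2 settles the worst case W = 2, where ln W is smallest;
    adding 1 keeps the constant positive even if C = 0.\<close>
  define C' where "C' = C / (ln 2)\<^sup>2 + 1"
  have ln2: "ln 2 > (0::real)" by simp
  have "C' > 0" using C(1) by (simp add: C'_def add_nonneg_pos)
  moreover have "U_form \<epsilon> N u \<le> C' * (ln (real W))\<^sup>2 * V_form \<epsilon> a N Om M u"
    if W: "W \<ge> 2" "real W \<le> K / \<epsilon>" and u: "u \<in> spectral_space N W" for W u
  proof -
    have "W \<le> W'" using W(2) by (simp add: W'_def le_nat_floor)
    from spectral_space_cell_poly[OF u this]
    obtain c where c: "\<And>l. l \<in> {1..N} \<Longrightarrow> u l = cell_poly N W' c l" by blast
    have "(ln 2)\<^sup>2 \<le> (ln (real W))\<^sup>2" using W(1) by (intro power_mono) auto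
    then have "C' * (ln 2)\<^sup>2 \<le> C' * (ln (real W))\<^sup>2" using \<open>C' > 0\<close> by simp
    moreover have "C \<le> C' * (ln 2)\<^sup>2" using ln2 by (simp add: C'_def distrib_right)
    ultimately have CC: "C \<le> C' * (ln (real W))\<^sup>2" by linarith
    have "U_form \<epsilon> N u = U_form \<epsilon> N (cell_poly N W' c)" by (rule U_form_cong[OF c])
    also have "\<dots> \<le> C * V_form \<epsilon> a N Om M (cell_poly N W' c)" by (rule C(2))
    also have "\<dots> = C * V_form \<epsilon> a N Om M u" by (simp only: V_form_cong[OF c])
    also have "\<dots> \<le> C' * (ln (real W))\<^sup>2 * V_form \<epsilon> a N Om M u"
      by (rule mult_right_mono[OF CC V_form_nonneg])
    finally show ?thesis .
  qed
  ultimately show ?thesis by blast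
qed

end
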